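(* Let $\mathcal Q_1$, $\mathcal Q_2$ be two general quadrics in $\mathbf P^{2d-1}$ with the smooth intersection $V$ and let $\mathcal R_1$, $\mathcal R_2$ be their rulings ($\mathcal R_i$ a ruling of $\mathcal Q_i$). If there exists a closed chain $$ L_1,\ L_2,\ \dots,\ L_{2n},\ L_{2n+1}=L_1 $$ of distinct $(d-1)$-dimensional linear subspaces, such that $L_{2i-1}\in\mathcal R_1$, $L_{2i}\in\mathcal R_2$ $(1\le i\le n)$ and $L_j\cap L_{j+1}\in F(V)$ $(1\le j\le 2n)$, then there are such closed chains of subspaces of length $2n$ through any point of $F(V)$.
   Context: Dimensions of linear subspaces are projective dimensions. Each quadric in $\mathbf P^{2d-1}$ contains at most two unirational families of $(d-1)$-dimensional linear subspaces; such a family is called a ruling of the quadric. $F(V)$ denotes the set of all $(d-2)$-dimensional linear subspaces contained in $V$. A chain $L_1,\dots,L_{2n},L_{2n+1}=L_1$ passes through a point $x\in F(V)$ if $x$ is one of the intersections $L_j\cap L_{j+1}$.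
   Formalization: Distinct subspaces through every point of F(V) is false when a member of the chain is tangent to V; there the chain through the point is only shown to close after 2n steps, each member meeting V exactly in its two consecutive intersections, some member tangent to V. *)

theory Defs
  imports "HOL-Analysis.Analysis"
begin

text \<open>
  Projective space of dimension 2d-1 is the space of lines in the complex vector space
  \<open>complex ^ 'n\<close>, where \<open>'n\<close> has 2d elements.  Subsets of projective space are represented by
  their affine cones; a linear subspace of projective dimension k is a complex vector subspace
  (\<open>vec.subspace\<close>) of dimension k+1 (\<open>vec.dim\<close>).
\<close>

definition lin_subspaces :: "nat \<Rightarrow> (complex ^ 'n) set set" where
  "lin_subspaces m = {L. vec.subspace L \<and> vec.dim L = m}"


subsection \<open>Quadrics and their intersection\<close>

definition quadric_matrix :: "complex ^ 'n ^ 'n \<Rightarrow> bool" where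
  "quadric_matrix A \<longleftrightarrow> transpose A = A \<and> A \<noteq> 0"

definition qform :: "complex ^ 'n ^ 'n \<Rightarrow> complex ^ 'n \<Rightarrow> complex" where
  "qform A v = (\<Sum>i\<in>UNIV. v $ i * (A *v v) $ i)"

definition quadric :: "complex ^ 'n ^ 'n \<Rightarrow> (complex ^ 'n) set" where
  "quadric A = {v. qform A v = 0}"

text \<open>
  Jacobian criterion: the gradients of the two forms, \<open>2 A v\<close> and \<open>2 B v\<close>, are linearly
  independent at every point, i.e. the intersection is a smooth complete intersection.
\<close>

definition smooth_intersection :: "complex ^ 'n ^ 'n \<Rightarrow> complex ^ 'n ^ 'n \<Rightarrow> bool" where
  "smooth_intersection A B \<longleftrightarrow>
     (\<forall>v. v \<noteq> 0 \<and> v \<in> quadric A \<inter> quadric B \<longrightarrow>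
        (\<forall>a b. a *s (A *v v) + b *s (B *v v) = 0 \<longrightarrow> a = 0 \<and> b = 0))"

text \<open>The linear subspaces of projective dimension d-2 contained in \<open>V\<close>.\<close>

definition FV :: "nat \<Rightarrow> (complex ^ 'n) set \<Rightarrow> (complex ^ 'n) set set" where
  "FV d V = {x \<in> lin_subspaces (d - 1). x \<subseteq> V}"


subsection \<open>Unirational families of subspaces and rulings\<close>

text \<open>
  Polynomial functions in the variables \<open>'v\<close>; each one involves only finitely many variables, also
  when \<open>'v\<close> is infinite.
\<close>

inductive_set poly_funs :: "(('v \<Rightarrow> complex) \<Rightarrow> complex) set" where
  const: "(\<lambda>_. c) \<in> poly_funs"
| var: "(\<lambda>t. t i) \<in> poly_funs"
| add: "p \<in> poly_funs \<Longrightarrow> q \<in> poly_funs \<Longrightarrow> (\<lambda>t. p t + q t) \<in> poly_funs"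
| mult: "p \<in> poly_funs \<Longrightarrow> q \<in> poly_funs \<Longrightarrow> (\<lambda>t. p t * q t) \<in> poly_funs"

text \<open>
  An m-dimensional vector subspace is given by a frame \<open>F 0, \<dots>, F (m - 1)\<close>.  The Grassmannian is
  the quotient of the space of frames by the general linear group, so a set of subspaces is
  Zariski closed iff its preimage in the space of frames is cut out by polynomials in the entries
  of the frame.
\<close>

definition frame_span :: "nat \<Rightarrow> (nat \<Rightarrow> complex ^ 'n) \<Rightarrow> (complex ^ 'n) set" where
  "frame_span m F = vec.span (F ` {..<m})"

definition zariski_closed :: "nat \<Rightarrow> (complex ^ 'n) set set \<Rightarrow> bool" where
  "zariski_closed m Z \<longleftrightarrow> Z \<subseteq> lin_subspaces m \<and>
     (\<exists>P \<subseteq> (poly_funs :: ((nat \<times> 'n \<Rightarrow> complex) \<Rightarrow> complex) set).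
        \<forall>F. frame_span m F \<in> lin_subspaces m \<longrightarrow>
          (frame_span m F \<in> Z \<longleftrightarrow> (\<forall>p\<in>P. p (\<lambda>(i, k). F i $ k) = 0)))"

text \<open>
  A closed family is unirational if some rational map from an affine space to the Grassmannian
  is dominant onto it.  Clearing denominators, such a map is given by a frame with polynomial
  entries; it is defined where the frame is linearly independent.
\<close>

definition rational_image ::
    "nat \<Rightarrow> ((nat \<Rightarrow> complex) \<Rightarrow> nat \<Rightarrow> complex ^ 'n) \<Rightarrow> (complex ^ 'n) set set" where
  "rational_image m \<phi> = range (\<lambda>t. frame_span m (\<phi> t)) \<inter> lin_subspaces m"

definition unirational_family :: "nat \<Rightarrow> (complex ^ 'n) set set \<Rightarrow> bool" where
  "unirational_family m Z \<longleftrightarrow> zariski_closed m Z \<and>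
     (\<exists>\<phi>. (\<forall>i<m. \<forall>k. (\<lambda>t. \<phi> t i $ k) \<in> poly_funs) \<and>
          rational_image m \<phi> \<noteq> {} \<and>
          rational_image m \<phi> \<subseteq> Z \<and>
          (\<forall>Z'. zariski_closed m Z' \<and> rational_image m \<phi> \<subseteq> Z' \<longrightarrow> Z \<subseteq> Z'))"

text \<open>
  A ruling is a maximal unirational family of subspaces of projective dimension d-1 contained in
  the quadric.  (Without maximality every single subspace would be a family.)
\<close>

definition ruling :: "nat \<Rightarrow> (complex ^ 'n) set \<Rightarrow> (complex ^ 'n) set set \<Rightarrow> bool" where
  "ruling d Q R \<longleftrightarrow> unirational_family d R \<and> (\<forall>L\<in>R. L \<subseteq> Q) \<and>
     (\<forall>R'. unirational_family d R' \<and> (\<forall>L\<in>R'. L \<subseteq> Q) \<and> R \<subseteq> R' \<longrightarrow> R' = R)"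


subsection \<open>Closed chains\<close>

definition closed_chain ::
    "nat \<Rightarrow> (complex ^ 'n) set \<Rightarrow> (complex ^ 'n) set set \<Rightarrow> (complex ^ 'n) set set \<Rightarrow>
     nat \<Rightarrow> (nat \<Rightarrow> (complex ^ 'n) set) \<Rightarrow> bool" where
  "closed_chain d V R1 R2 n L \<longleftrightarrow>
     L (2 * n + 1) = L 1 \<and>
     (\<forall>i\<in>{1..n}. L (2 * i - 1) \<in> R1 \<and> L (2 * i) \<in> R2) \<and>
     (\<forall>j\<in>{1..2 * n}. L j \<inter> L (j + 1) \<in> FV d V)"

definition passes_through ::
    "nat \<Rightarrow> (nat \<Rightarrow> (complex ^ 'n) set) \<Rightarrow> (complex ^ 'n) set \<Rightarrow> bool" where
  "passes_through n L x \<longleftrightarrow> (\<exists>j\<in>{1..2 * n}. L j \<inter> L (j + 1) = x)"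

text \<open>
  Let x in F(V) lie in a member L of a ruling.  Then L meets V in the union of x and a residual
  (d-2)-dimensional subspace x', and x = x' exactly when L is tangent to V along x.  In a chain of
  distinct subspaces of length at least 4 the two intersections of L with its neighbours are x
  and x', hence they differ; so no such chain contains a tangent L, although tangent members
  exist in each ruling.  A chain reaching a tangent L turns back there and runs through the
  same subspaces in the opposite order.  A folded chain is a chain of this kind: each member still
  meets V exactly in its two consecutive intersections, and some member is tangent to V.
\<close>

definition folded ::
    "nat \<Rightarrow> (complex ^ 'n) set \<Rightarrow> nat \<Rightarrow> (nat \<Rightarrow> (complex ^ 'n) set) \<Rightarrow> bool" where
  "folded d V n L \<longleftrightarrow>
     L 1 \<inter> V = (L (2 * n) \<inter> L 1) \<union> (L 1 \<inter> L 2) \<and>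
     (\<forall>j\<in>{2..2 * n}. L j \<inter> V = (L (j - 1) \<inter> L j) \<union> (L j \<inter> L (j + 1))) \<and>
     (\<exists>j\<in>{1..2 * n}. L j \<inter> V \<in> FV d V)"

end

theory Submission
  imports Defs "HOL-Computational_Algebra.Fundamental_Theorem_Algebra"
begin

text \<open>
  A maximal isotropic subspace through \<open>x\<close> of a member of the pencil meets \<open>V\<close> in \<open>x\<close> and a residual subspace, so
  the two rulings define involutions \<open>i\<^sub>1\<close>, \<open>i\<^sub>2\<close> of \<open>F(V)\<close>, and a closed chain of length \<open>2n\<close> through \<open>x\<close> means
  \<open>T\<^sup>n x = x\<close> for \<open>T = i\<^sub>2 i\<^sub>1\<close>. On the torsor \<open>F(V)\<close> of the hyperelliptic Jacobian \<open>T\<close> is a translation; this is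
  replaced by linear algebra. For the involution \<open>r\<close> of any ruling of any member of the pencil, \<open>r T r = T\<^sup>-\<^sup>1\<close>, which
  says that a hexagon closes: on the span of three consecutive sides the forms of the pencil are combinations of
  products \<open>e\<^sub>1 p\<^sub>1\<close>, \<open>e\<^sub>2 p\<^sub>2\<close>, \<open>e\<^sub>3 p\<^sub>3\<close> of linear functionals, which cut out the six vertices. So the fixed
  points of \<open>T\<^sup>n\<close> are stable under every \<open>r\<close>. The group of the \<open>r\<close> is transitive on \<open>F(V)\<close>: for
  \<open>x \<noteq> y\<close> the determinant of the pairing of \<open>x\<close> with \<open>y\<close> has a root in the pencil, and the corresponding \<open>r\<close>
  increases the dimension of \<open>x \<inter> y\<close>. A maximal unirational family is stable under products of two
  reflections and irreducible, which identifies it with one class of maximal isotropic subspaces.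
\<close>

section \<open>Linear functionals and pairings\<close>

text \<open>The translation enters only pointwise, as \<open>T (r (T x)) = r x\<close>: a side
  \<open>N\<close> joining \<open>T x\<close> to \<open>r (T x)\<close> can be moved back along the
  orbit to a side through \<open>x\<close> without leaving its ruling. The obstacles are
  coincidences. Singular members of the pencil carry a single class of maximal isotropic subspaces,
  so parity of intersections cannot define the classes; being joined by an even number of
  reflections makes sense for every member, and smoothness keeps the corank at most one. A side may
  be tangent to \<open>V\<close>, so a step is recorded as
  \<open>L \<inter> V = x \<union> x'\<close>, which allows \<open>x = x'\<close>. Three sides of a
  hexagon may span too little, which is shown to force the path to close after three steps. If the
  member carrying \<open>N\<close> is \<open>f\<close> or \<open>g\<close> itself, two
  quadrilaterals replace the hexagon. The root of the determinant is obtained as an eigenvalue. A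
  chain with \<open>n = 1\<close> has both intersections equal and so does not express
  \<open>T x = x\<close>; it is treated apart.\<close>

definition lfun :: "(complex ^ 'n \<Rightarrow> complex) \<Rightarrow> bool" where
  "lfun \<phi> \<longleftrightarrow> (\<forall>u v. \<phi> (u + v) = \<phi> u + \<phi> v) \<and> (\<forall>c v. \<phi> (c *s v) = c * \<phi> v)"

lemma lfun_add: "lfun \<phi> \<Longrightarrow> \<phi> (u + v) = \<phi> u + \<phi> v"
  and lfun_scale: "lfun \<phi> \<Longrightarrow> \<phi> (c *s v) = c * \<phi> v"
  by (auto simp: lfun_def)

lemma lfun_0: "lfun \<phi> \<Longrightarrow> \<phi> 0 = 0"
  using lfun_scale[of \<phi> 0 0] by simp

lemma lfun_minus: "lfun \<phi> \<Longrightarrow> \<phi> (- v) = - \<phi> v"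
  using lfun_scale[of \<phi> "-1" v] by simp

lemma lfun_diff: "lfun \<phi> \<Longrightarrow> \<phi> (u - v) = \<phi> u - \<phi> v"
  using lfun_add[of \<phi> u "-v"] by (simp add: lfun_minus)

lemmas lfun_simps = lfun_add lfun_scale lfun_0 lfun_minus lfun_diff

lemma lfun_comb:
  assumes "lfun \<phi>" "lfun \<psi>"
  shows "lfun (\<lambda>v. \<phi> v + \<psi> v)" "lfun (\<lambda>v. \<phi> v - \<psi> v)" "lfun (\<lambda>v. c * \<phi> v)"
  using assms by (auto simp: lfun_def algebra_simps)

lemma subspace_lfun:
  assumes "vec.subspace U" "lfun \<phi>"
  shows "vec.subspace {v \<in> U. \<phi> v = 0}"
  using assms by (auto simp: vec.subspace_def lfun_simps)

lemma mem_span_insert: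
  assumes "vec.subspace L"
  shows "v \<in> vec.span (insert a L) \<longleftrightarrow> (\<exists>k. v - k *s a \<in> L)"
  unfolding vec.span_breakdown_eq vec.span_eq_iff[THEN iffD2, OF assms] ..

lemma span_insertE:
  assumes "vec.subspace L" "v \<in> vec.span (insert a L)"
  obtains c where "v - c *s a \<in> L"
  using mem_span_insert[OF assms(1), THEN iffD1, OF assms(2)] by (elim exE)

lemma dim_span_insert:
  assumes "vec.subspace L" "a \<notin> L"
  shows "vec.dim (vec.span (insert a L)) = Suc (vec.dim L)"
proof -
  have "a \<notin> vec.span L" using assms vec.span_eq_iff[THEN iffD2, OF assms(1)] by metis
  then show ?thesis by (simp add: vec.dim_insert)
qed

lemma basis_of_subspace:
  fixes W :: "(complex ^ 'n) set"
  assumes "vec.subspace W"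
  obtains B where "B \<subseteq> W" "vec.independent B" "finite B" "vec.span B = W" "card B = vec.dim W"
  using vec.basis_subspace_exists[OF assms] vec.dim_eq_card_independent vec.dim_span by metis

lemma eq_span_insert:
  assumes "vec.subspace x" "vec.subspace L" "vec.dim L = Suc (vec.dim x)" "x \<subseteq> L" "a \<in> L" "a \<notin> x"
  shows "L = vec.span (insert a x)"
proof (rule sym, rule vec.subspace_dim_equal)
  show "vec.span (insert a x) \<subseteq> L" using assms by (intro vec.span_minimal) auto
  show "vec.dim L \<le> vec.dim (vec.span (insert a x))" using dim_span_insert[of x a] assms by simp
qed (use assms in auto)

lemma coordinate_functional:
  fixes L :: "(complex ^ 'n) set"
  assumes "vec.subspace L" "a \<notin> L"
  obtains \<phi> where "lfun \<phi>" "\<And>v. v \<in> L \<Longrightarrow> \<phi> v = 0" "\<phi> a = 1"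
proof -
  obtain B where B: "B \<subseteq> L" "vec.independent B" "finite B" "vec.span B = L" "card B = vec.dim L"
    using basis_of_subspace[OF assms(1)] .
  have "a \<notin> vec.span B"
    using B assms by simp
  then have ind: "vec.independent (insert a B)"
    using B by (simp add: vec.independent_insertI)
  \<comment> \<open>The functional is one coordinate of an endomorphism whose values on the basis
    are multiples of \<open>axis i 1\<close>; any index serves.\<close>
  define i :: 'n where "i = undefined"
  obtain f :: "complex ^ 'n \<Rightarrow> complex ^ 'n" where f: "Vector_Spaces.linear (*s) (*s) f"
    "\<forall>x\<in>insert a B. f x = (if x = a then axis i 1 else 0)"
    using vec.linear_independent_extend[OF ind, of "\<lambda>x. if x = a then axis i 1 else 0"] by blast
  interpret f: Vector_Spaces.linear "(*s)" "(*s)" f by (rule f)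
  have "a \<notin> B" using B assms by blast
  then have "f x = 0" if "x \<in> B" for x using f that by force
  then have "f v = 0" if "v \<in> L" for v
    using f.eq_0_on_span[of B v] B that by blast
  then show ?thesis
    using that[of "\<lambda>v. f v $ i"] f by (auto simp: lfun_def f.add f.scale)
qed

lemma dim_le_dim_kernel:
  assumes "vec.subspace U" "lfun \<phi>"
  shows "vec.dim U \<le> Suc (vec.dim {v \<in> U. \<phi> v = 0})"
proof (cases "\<exists>w\<in>U. \<phi> w \<noteq> 0")
  case True
  then obtain w where w: "w \<in> U" "\<phi> w \<noteq> 0" by blast
  let ?K = "{v \<in> U. \<phi> v = 0}"
  have K: "vec.subspace ?K" using assms by (rule subspace_lfun)
  have "U \<subseteq> vec.span (insert w ?K)"
  proof
    fix v assume "v \<in> U"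
    then have "v - (\<phi> v / \<phi> w) *s w \<in> ?K"
      using w assms by (simp add: vec.subspace_diff vec.subspace_scale lfun_simps)
    then show "v \<in> vec.span (insert w ?K)" using K mem_span_insert by blast
  qed
  then have "vec.dim U \<le> vec.dim (insert w ?K)" using vec.dim_mono by blast
  then show ?thesis using w by (simp add: vec.dim_insert split: if_splits)
next
  case False
  then have "{v \<in> U. \<phi> v = 0} = U" by auto
  then show ?thesis by simp
qed

lemma dim_le_dim_kernels:
  assumes "finite B" "vec.subspace U" "\<And>b. b \<in> B \<Longrightarrow> lfun (\<phi> b)"
  shows "vec.subspace {v \<in> U. \<forall>b\<in>B. \<phi> b v = 0}
    \<and> vec.dim U \<le> vec.dim {v \<in> U. \<forall>b\<in>B. \<phi> b v = 0} + card B"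
  using assms
proof (induction B rule: finite_induct)
  case (insert b B)
  let ?K = "{v \<in> U. \<forall>b\<in>B. \<phi> b v = 0}"
  have eq: "{v \<in> U. \<forall>b\<in>insert b B. \<phi> b v = 0} = {v \<in> ?K. \<phi> b v = 0}" by auto
  show ?case
    unfolding eq using insert subspace_lfun[of ?K "\<phi> b"] dim_le_dim_kernel[of ?K "\<phi> b"] by auto
qed auto

lemma nonzero_in_kernels:
  assumes "finite B" "vec.subspace U" "\<And>b. b \<in> B \<Longrightarrow> lfun (\<phi> b)" "card B < vec.dim U"
  shows "\<exists>v\<in>U. v \<noteq> 0 \<and> (\<forall>b\<in>B. \<phi> b v = 0)"
proof (rule ccontr)
  assume "\<not> ?thesis"
  then have "{v \<in> U. \<forall>b\<in>B. \<phi> b v = 0} \<subseteq> {0}" by blast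
  then have "vec.dim {v \<in> U. \<forall>b\<in>B. \<phi> b v = 0} = 0" by (simp)
  with dim_le_dim_kernels[OF assms(1,2), of \<phi>] assms(3,4) show False by simp
qed

lemma complement_in_subspace:
  fixes W Y :: "(complex ^ 'n) set"
  assumes "vec.subspace W" "vec.subspace Y" "W \<subseteq> Y"
  obtains C where "finite C" "C \<subseteq> Y" "card C + vec.dim W = vec.dim Y" "vec.span (W \<union> C) = Y"
proof -
  obtain B where B: "B \<subseteq> W" "vec.independent B" "finite B" "vec.span B = W" "card B = vec.dim W"
    using basis_of_subspace[OF assms(1)] .
  obtain D where D: "B \<subseteq> D" "D \<subseteq> Y" "vec.independent D" "Y \<subseteq> vec.span D"
    using vec.maximal_independent_subset_extend[of B Y] B assms(3) by auto
  have fin: "finite D" using D(3) vec.finiteI_independent by blast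
  have "card D = vec.dim Y"
    using vec.basis_card_eq_dim[of D Y] D by simp
  moreover have "card D = card (D - B) + card B"
    using D(1) fin by (metis add.commute B(3) card_Diff_subset card_mono le_add_diff_inverse)
  moreover have "vec.span (W \<union> (D - B)) = Y"
  proof
    show "vec.span (W \<union> (D - B)) \<subseteq> Y"
      using assms D(2) by (intro vec.span_minimal) auto
    have "D \<subseteq> W \<union> (D - B)" using B by auto
    then show "Y \<subseteq> vec.span (W \<union> (D - B))" using D(4) vec.span_mono by blast
  qed
  ultimately show ?thesis using that[of "D - B"] fin B D by auto
qed

lemma complement_of_subspace:
  fixes W :: "(complex ^ 'n) set"
  assumes "vec.subspace W"
  obtains C where "finite C" "card C + vec.dim W = CARD('n)" "vec.span (W \<union> C) = UNIV"
  using complement_in_subspace[OF assms vec.subspace_UNIV] by (metis subset_UNIV vec_dim_card)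

section \<open>Symmetric bilinear forms and orthogonality\<close>

type_synonym 'n form = "complex ^ 'n \<Rightarrow> complex ^ 'n \<Rightarrow> complex"

definition sbil :: "'n::finite form \<Rightarrow> bool" where
  "sbil f \<longleftrightarrow> (\<forall>u v. f u v = f v u) \<and> (\<forall>u. lfun (f u))"

lemma sbil_sym: "sbil f \<Longrightarrow> f u v = f v u"
  by (auto simp: sbil_def)

lemma sbil_lfun: "sbil f \<Longrightarrow> lfun (f u)" and sbil_lfun_left: "sbil f \<Longrightarrow> lfun (\<lambda>v. f v u)"
  by (auto simp: sbil_def lfun_def)

lemma sbil_simps:
  assumes "sbil f"
  shows "f u (v + w) = f u v + f u w" "f (v + w) u = f v u + f w u"
    "f u (c *s v) = c * f u v" "f (c *s v) u = c * f v u"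
    "f u 0 = 0" "f 0 u = 0" "f u (- v) = - f u v" "f (- v) u = - f v u"
    "f u (v - w) = f u v - f u w" "f (v - w) u = f v u - f w u"
  using sbil_lfun[OF assms, of u] sbil_lfun_left[OF assms, of u]
  by (auto simp: lfun_simps dest: lfun_add lfun_scale lfun_0 lfun_minus lfun_diff)

lemma sbil_comb:
  assumes "sbil f" "sbil g"
  shows "sbil (\<lambda>u v. s * f u v + t * g u v)"
  using assms by (auto simp: sbil_def lfun_def algebra_simps)

lemma sbil_0_on_span:
  assumes "sbil f" "\<And>w. w \<in> S \<Longrightarrow> f u w = 0" "w \<in> vec.span S"
  shows "f u w = 0"
proof -
  have "vec.subspace {w. f u w = 0}"
    using subspace_lfun[OF vec.subspace_UNIV sbil_lfun[OF assms(1), of u]] by simp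
  then have "vec.span S \<subseteq> {w. f u w = 0}" using assms(2) by (intro vec.span_minimal) auto
  then show ?thesis using assms(3) by blast
qed

lemma dim_perp_ge:
  assumes "vec.subspace U" "vec.subspace W" "sbil f"
  shows "vec.dim U \<le> vec.dim {u \<in> U. \<forall>w\<in>W. f u w = 0} + vec.dim W"
proof -
  obtain B where B: "B \<subseteq> W" "finite B" "vec.span B = W" "card B = vec.dim W"
    using basis_of_subspace[OF assms(2)] .
  have "{u \<in> U. \<forall>w\<in>W. f u w = 0} = {u \<in> U. \<forall>b\<in>B. f u b = 0}"
  proof (intro Collect_cong conj_cong refl iffI ballI)
    fix u w assume u: "\<forall>b\<in>B. f u b = 0" and w: "w \<in> W"
    show "f u w = 0" using sbil_0_on_span[OF assms(3), of B] u w B(3) by blast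
  qed (use B in auto)
  then show ?thesis
    using dim_le_dim_kernels[OF B(2) assms(1), of "\<lambda>b u. f u b"] B(4)
    by (simp add: sbil_lfun_left assms(3))
qed

lemma subspace_perp:
  assumes "vec.subspace U" "sbil f"
  shows "vec.subspace {u \<in> U. \<forall>w\<in>W. f u w = 0}"
  using assms by (auto simp: vec.subspace_def sbil_simps)

text \<open>If the bound failed, a complement \<open>C\<close> of the perp would have fewer than
  \<open>vec.dim W\<close> elements. Some nonzero \<open>w\<close> of \<open>W\<close> would then be
  orthogonal to \<open>C\<close>, hence to everything, which \<open>ker\<close> excludes.\<close>

lemma dim_perp_le:
  fixes f :: "'n::finite form"
  assumes W: "vec.subspace W" and f: "sbil f"
    and ker: "\<And>w. w \<in> W \<Longrightarrow> \<forall>u. f w u = 0 \<Longrightarrow> w = 0"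
  shows "vec.dim {u. \<forall>w\<in>W. f u w = 0} + vec.dim W \<le> CARD('n)"
proof -
  let ?Y = "{u. \<forall>w\<in>W. f u w = 0}"
  have Y: "vec.subspace ?Y" using subspace_perp[OF vec.subspace_UNIV f] by simp
  obtain C where C: "finite C" "card C + vec.dim ?Y = CARD('n)" "vec.span (?Y \<union> C) = UNIV"
    using complement_of_subspace[OF Y] .
  have "\<not> card C < vec.dim W"
  proof
    assume "card C < vec.dim W"
    then obtain w where w: "w \<in> W" "w \<noteq> 0" "\<forall>c\<in>C. f w c = 0"
      using nonzero_in_kernels[OF C(1) W, of "\<lambda>c w. f w c"] f by (auto simp: sbil_lfun_left)
    then have "f w u = 0" if "u \<in> ?Y \<union> C" for u using that sbil_sym[OF f, of w] by auto
    then have "\<forall>u. f w u = 0" using sbil_0_on_span[OF f, of "?Y \<union> C" w] C(3) by blast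
    with ker w show False by blast
  qed
  with C(2) show ?thesis by simp
qed

text \<open>The iterates of \<open>w\<close> under \<open>\<phi>\<close> become dependent, so a
  nonzero polynomial in \<open>\<phi>\<close> kills \<open>w\<close>. Linear factors are split off
  until the quotient no longer kills \<open>w\<close>; its value at \<open>w\<close> is the
  eigenvector.\<close>

lemma exists_eigenvector:
  fixes \<phi> :: "complex ^ 'n \<Rightarrow> complex ^ 'n"
  assumes lin: "Vector_Spaces.linear (*s) (*s) \<phi>" and W: "vec.subspace W"
    and maps: "\<And>v. v \<in> W \<Longrightarrow> \<phi> v \<in> W" and w: "w \<in> W" "w \<noteq> 0"
  obtains c v where "v \<in> W" "v \<noteq> 0" "\<phi> v = c *s v"
proof -
  interpret \<phi>: Vector_Spaces.linear "(*s)" "(*s)" \<phi> by (rule lin)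
  note eigenI = that
  \<comment> \<open>\<open>E p\<close> is \<open>p\<close> evaluated at \<open>\<phi>\<close> and
    applied to \<open>w\<close>, by Horner's scheme.\<close>
  define E where "E p = fold_coeffs (\<lambda>c x. c *s w + \<phi> x) p 0" for p
  have E_0 [simp]: "E 0 = 0" by (simp add: E_def)
  have E_pCons: "E (pCons c p) = c *s w + \<phi> (E p)" for c p
    by (cases "c = 0 \<and> p = 0") (auto simp: E_def \<phi>.zero fold_coeffs_pCons_coeff_not_0_eq fold_coeffs_pCons_not_0_0_eq)
  have E_add: "E (p + q) = E p + E q" for p q
  proof (induction p arbitrary: q)
    case (pCons c p)
    show ?case
      by (cases q) (simp add: E_pCons pCons.IH \<phi>.add vec.scale_left_distrib)
  qed simp
  have E_smult: "E (smult c p) = c *s E p" for c p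
    by (induction p) (auto simp: E_pCons \<phi>.add \<phi>.scale vec.scale_right_distrib)
  have E_in: "E p \<in> W" for p
    by (induction p) (auto simp: E_pCons W w maps vec.subspace_0 vec.subspace_add vec.subspace_scale)
  have E_factor: "E ([:- c, 1:] * q) = \<phi> (E q) - c *s E q" for c q
    using E_add[of "smult (- c) q" "pCons 0 q"] E_smult[of "- c" q] by (simp add: E_pCons)
  have eig: thesis if "p \<noteq> 0" "E p = 0" for p
    using that
  proof (induction "degree p" arbitrary: p rule: less_induct)
    case (less p)
    show ?case
    proof (cases "degree p = 0")
      case True
      then obtain c where "p = [:c:]" by (meson degree_eq_zeroE)
      with less.prems w show thesis by (simp add: E_pCons \<phi>.zero)
    next
      case False
      then obtain z where "poly p z = 0"
        using fundamental_theorem_of_algebra[of p] by (auto simp: constant_degree)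
      then obtain q where q: "p = [:- z, 1:] * q" by (meson dvdE poly_eq_0_iff_dvd)
      with less.prems have "q \<noteq> 0" by auto
      show thesis
      proof (cases "E q = 0")
        case True
        have "degree p = Suc (degree q)"
          using \<open>q \<noteq> 0\<close> unfolding q by (subst degree_mult_eq) auto
        then show thesis using less.hyps[of q] True \<open>q \<noteq> 0\<close> by linarith
      next
        case False
        moreover have "\<phi> (E q) = z *s E q"
          using less.prems(2) E_factor[of z q] unfolding q by simp
        ultimately show thesis using eigenI E_in by blast
      qed
    qed
  qed
  have sub: "vec.subspace {E p | p. p = 0 \<or> degree p < m}" for m
    unfolding vec.subspace_def
  proof (intro conjI ballI allI)
    show "0 \<in> {E p | p. p = 0 \<or> degree p < m}" using E_0[symmetric] by blast
  next
    fix x y assume "x \<in> {E p | p. p = 0 \<or> degree p < m}" "y \<in> {E p | p. p = 0 \<or> degree p < m}"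
    then obtain p q where "x = E p" "p = 0 \<or> degree p < m" "y = E q" "q = 0 \<or> degree q < m" by blast
    moreover from this have "p + q = 0 \<or> degree (p + q) < m"
      by (metis add.left_neutral add.right_neutral degree_add_less)
    moreover have "x + y = E (p + q)" using calculation(1,3) by (simp only: E_add)
    ultimately show "x + y \<in> {E p | p. p = 0 \<or> degree p < m}" by blast
  next
    fix c x assume "x \<in> {E p | p. p = 0 \<or> degree p < m}"
    then obtain p where "x = E p" "p = 0 \<or> degree p < m" by blast
    moreover from this have "smult c p = 0 \<or> degree (smult c p) < m"
      by auto
    moreover have "c *s x = E (smult c p)" using calculation(1) by (simp only: E_smult)
    ultimately show "c *s x \<in> {E p | p. p = 0 \<or> degree p < m}" by blast
  qed
  define S where "S m = {E p | p. p = 0 \<or> degree p < m}" for m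
  have "\<exists>m. E (monom 1 m) \<in> S m"
  proof (rule ccontr)
    assume no: "\<not> ?thesis"
    \<comment> \<open>Without a relation each further power of \<open>\<phi>\<close> enlarges the
      span, past the dimension of the whole space.\<close>
    have "m \<le> vec.dim (S m)" for m
    proof (induction m)
      case (Suc m)
      have "insert (E (monom 1 m)) (S m) \<subseteq> S (Suc m)"
        unfolding S_def by (auto simp: degree_monom_eq intro: less_SucI)
      then have "vec.dim (insert (E (monom 1 m)) (S m)) \<le> vec.dim (S (Suc m))"
        by (rule vec.dim_subset)
      moreover have "E (monom 1 m) \<notin> vec.span (S m)"
        using no sub[of m] by (metis S_def vec.span_eq_iff)
      ultimately show ?case using Suc by (simp add: vec.dim_insert)
    qed simp
    from this[of "Suc CARD('n)"] show False
      by (metis Suc_n_not_le_n dim_subset_UNIV_cart_gen le_trans)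
  qed
  then obtain m p where p: "E (monom 1 m) = E p" "p = 0 \<or> degree p < m"
    unfolding S_def by blast
  have "E (monom 1 m + smult (-1) p) = 0" by (simp only: E_add E_smult p) simp
  moreover have "monom 1 m + smult (-1) p \<noteq> 0"
  proof
    assume "monom 1 m + smult (-1) p = 0"
    then have "coeff (monom 1 m + smult (-1) p) m = 0" by simp
    with p(2) show False by (auto simp: coeff_eq_0)
  qed
  ultimately show thesis by (rule eig[rotated])
qed

text \<open>If the pairing of \<open>W\<close> with \<open>X\<close> by \<open>g\<close> is
  invertible, its inverse composed with the pairing by \<open>f\<close> has an eigenvector, and the
  eigenvalue is the root; otherwise \<open>g\<close> itself has a kernel vector.\<close>

lemma pencil_root:
  fixes W X :: "(complex ^ 'n) set"
  assumes W: "vec.subspace W" and X: "finite X" "card X \<le> vec.dim W" and ne: "vec.dim W > 0"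
    and f: "sbil f" and g: "sbil g"
  obtains s t v where "(s, t) \<noteq> (0, 0)" "v \<in> W" "v \<noteq> 0" "\<And>u. u \<in> X \<Longrightarrow> s * f v u + t * g v u = 0"
proof (cases "\<exists>v\<in>W. v \<noteq> 0 \<and> (\<forall>u\<in>X. g v u = 0)")
  case True
  then show thesis using that[of 0 1] by auto
next
  case False
  have "\<not> card X < vec.dim W"
    using False nonzero_in_kernels[OF X(1) W, of "\<lambda>u v. g v u"] g by (auto simp: sbil_lfun_left)
  then have card: "card X = vec.dim W" using X by simp
  then have "card X \<le> CARD('n)" by (simp add: dim_subset_UNIV_cart_gen)
  \<comment> \<open>The elements of \<open>X\<close> become coordinate indices, so that the values
    of a form on \<open>X\<close> are again a vector of \<open>complex ^ 'n\<close> and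
    \<open>H \<circ> G f\<close> is an endomorphism.\<close>
  then obtain h :: "_ \<Rightarrow> 'n" where h: "inj_on h X"
    using card_le_inj[OF X(1), of "UNIV :: 'n set"] finite by blast
  define G where "G k v = (\<chi> i. if i \<in> h ` X then k v (the_inv_into X h i) else 0)"
    for k :: "'n::finite form" and v
  have lin: "Vector_Spaces.linear (*s) (*s) (G k)" if "sbil k" for k
    by unfold_locales (auto simp: G_def vec_eq_iff sbil_simps[OF that])
  have G_eq: "G k v = G k' v' \<longleftrightarrow> (\<forall>u\<in>X. k v u = k' v' u)" for k k' v v'
    using h by (auto simp: G_def vec_eq_iff the_inv_into_f_f)
  interpret G: Vector_Spaces.linear "(*s)" "(*s)" "G g" by (rule lin[OF g])
  interpret F: Vector_Spaces.linear "(*s)" "(*s)" "G f" by (rule lin[OF f])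
  have inj: "inj_on (G g) W"
    unfolding G.inj_on_iff_eq_0[OF W]
  proof (intro ballI impI)
    fix v assume "v \<in> W" "G g v = 0"
    then have "G g v = G g 0" by (simp add: G.zero)
    then have "\<forall>u\<in>X. g v u = 0" unfolding G_eq by (simp add: sbil_simps[OF g])
    then show "v = 0" using False \<open>v \<in> W\<close> by blast
  qed
  let ?T = "{x :: complex ^ 'n. \<forall>i. i \<notin> h ` X \<longrightarrow> x $ i = 0}"
  have "vec.dim (G g ` W) = vec.dim W"
    using vec.dim_image_eq[OF lin[OF g], of W] inj W by (metis vec.span_eq_iff)
  moreover have "vec.dim ?T = card X"
    using dim_substandard_cart[of "h ` X"] h by (simp add: card_image)
  moreover have "vec.subspace ?T" by (auto simp: vec.subspace_def)
  moreover have "vec.subspace (G g ` W)" using W by (rule G.subspace_image)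
  moreover have "G g ` W \<subseteq> ?T" by (auto simp: G_def)
  ultimately have img: "G g ` W = ?T" using card by (intro vec.subspace_dim_equal) auto
  obtain H where H: "H ` UNIV \<subseteq> W" "Vector_Spaces.linear (*s) (*s) H" "\<forall>v\<in>W. H (G g v) = v"
    using vec.linear_exists_left_inverse_on[OF lin[OF g] W inj] by blast
  obtain w where w: "w \<in> W" "w \<noteq> 0"
    using ne by (metis gr_implies_not0 subsetI vec.dim_eq_0 singletonI)
  have "Vector_Spaces.linear (*s) (*s) (H \<circ> G f)"
    using lin[OF f] H(2) by (rule Vector_Spaces.linear_compose)
  then obtain c v where v: "v \<in> W" "v \<noteq> 0" "(H \<circ> G f) v = c *s v"
    by (rule exists_eigenvector[OF _ W _ w]) (use H in auto)
  have "G f v \<in> ?T" by (auto simp: G_def)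
  then obtain v' where v': "v' \<in> W" "G f v = G g v'" using img by blast
  then have "v' = c *s v" using H v by auto
  then have "\<forall>u\<in>X. f v u = c * g v u" using v' by (simp add: G_eq sbil_simps[OF g])
  then show thesis using that[of 1 "- c" v] v by auto
qed

section \<open>Classes of maximal isotropic subspaces\<close>

text \<open>The orthogonal reflection in the hyperplane perpendicular to \<open>m\<close>. For
  \<open>a m m = 0\<close> division by zero makes it the identity, hence still linear.\<close>

definition refl_along :: "(complex ^ 'n \<Rightarrow> complex ^ 'n \<Rightarrow> complex) \<Rightarrow> complex ^ 'n \<Rightarrow> complex ^ 'n \<Rightarrow> complex ^ 'n" where
  "refl_along a m v = v - (2 * a v m / a m m) *s m"

definition lagr :: "'n::finite form \<Rightarrow> nat \<Rightarrow> (complex ^ 'n) set \<Rightarrow> bool" where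
  "lagr a d L \<longleftrightarrow> vec.subspace L \<and> vec.dim L = d \<and> (\<forall>u\<in>L. \<forall>v\<in>L. a u v = 0)"

lemma lagrD:
  assumes "lagr a d L"
  shows "vec.subspace L" "vec.dim L = d" "u \<in> L \<Longrightarrow> v \<in> L \<Longrightarrow> a u v = 0"
  using assms by (auto simp: lagr_def)

lemma lagr_eqI: "lagr a d L \<Longrightarrow> lagr a d L' \<Longrightarrow> L \<subseteq> L' \<Longrightarrow> L = L'"
  by (intro vec.subspace_dim_equal) (simp_all add: lagrD(1,2))

lemma isotropic_polarization:
  assumes "sbil a" "vec.subspace L" "\<And>v. v \<in> L \<Longrightarrow> a v v = 0" "u \<in> L" "v \<in> L"
  shows "a u v = 0"
proof -
  have "a (u + v) (u + v) = 0" using assms(2-5) by (simp add: vec.subspace_add)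
  then have "2 * a u v = 0"
    using assms(3-5) sbil_sym[OF assms(1), of v u] by (simp add: sbil_simps[OF assms(1)])
  then show ?thesis by simp
qed

text \<open>For a nonsingular form a class is one of the two families of maximal isotropic
  subspaces. Even products of reflections can be deformed to the identity along polynomial paths,
  which ties the classes to unirational families.\<close>

inductive same_ruling :: "'n::finite form \<Rightarrow> (complex ^ 'n) set \<Rightarrow> (complex ^ 'n) set \<Rightarrow> bool"
  for a where
  trivial: "same_ruling a L L"
| double_reflection: "same_ruling a L L' \<Longrightarrow> a m m \<noteq> 0 \<Longrightarrow> a m' m' \<noteq> 0 \<Longrightarrow>
    same_ruling a L (refl_along a m ` refl_along a m' ` L')"

lemma same_ruling_trans: "same_ruling a L' L'' \<Longrightarrow> same_ruling a L L' \<Longrightarrow> same_ruling a L L''"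
  by (induction rule: same_ruling.induct) (auto intro: same_ruling.double_reflection)

text \<open>Here \<open>corank\<close> says that the kernel is spanned by one vector
  \<open>k\<close>, possibly zero; the cones of a smooth pencil are included.\<close>

locale quadratic_form =
  fixes a :: "'n::finite form" and d :: nat
  assumes bil: "sbil a" and card_n: "CARD('n) = 2 * d"
    and corank: "\<exists>k. \<forall>w. (\<forall>u. a w u = 0) \<longrightarrow> (\<exists>c. w = c *s k)"
begin

lemmas asim = sbil_simps[OF bil]
lemmas asym = sbil_sym[OF bil]

lemma d_pos: "d \<ge> 1"
  using card_n by (metis Suc_leI card_gt_0_iff finite mult_0_right neq0_conv UNIV_not_empty One_nat_def)

text \<open>A part \<open>L'\<close> of \<open>L\<close> of codimension at most one avoids the
  kernel, and \<open>L\<close> lies in its perp. So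
  \<open>vec.dim L + vec.dim L' \<le> 2 * d\<close>, and the bound follows by integrality.\<close>

lemma isotropic_dim_le:
  assumes L: "vec.subspace L" and iso: "\<And>u v. u \<in> L \<Longrightarrow> v \<in> L \<Longrightarrow> a u v = 0"
  shows "vec.dim L \<le> d"
proof -
  obtain k where k: "\<And>w. (\<forall>u. a w u = 0) \<Longrightarrow> \<exists>c. w = c *s k" using corank by blast
  obtain L' where L': "vec.subspace L'" "L' \<subseteq> L" "vec.dim L \<le> Suc (vec.dim L')"
    "\<And>w. w \<in> L' \<Longrightarrow> \<forall>u. a w u = 0 \<Longrightarrow> w = 0"
  proof (cases "k = 0")
    case True
    then show thesis using that[of L] L k by fastforce
  next
    case False
    then obtain \<phi> where \<phi>: "lfun \<phi>" "\<phi> k = 1"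
      using coordinate_functional[of "{0}" k] by auto
    show thesis
    proof (rule that)
      show "vec.subspace {v \<in> L. \<phi> v = 0}" "vec.dim L \<le> Suc (vec.dim {v \<in> L. \<phi> v = 0})"
        using L \<phi> by (simp_all add: subspace_lfun dim_le_dim_kernel)
      fix w assume w: "w \<in> {v \<in> L. \<phi> v = 0}" "\<forall>u. a w u = 0"
      with k obtain c where "w = c *s k" by blast
      with w \<phi> show "w = 0" by (simp add: lfun_simps)
    qed auto
  qed
  have "L \<subseteq> {u. \<forall>w\<in>L'. a u w = 0}" using L'(2) iso by blast
  then have "vec.dim L \<le> vec.dim {u. \<forall>w\<in>L'. a u w = 0}" by (rule vec.dim_subset)
  moreover have "vec.dim {u. \<forall>w\<in>L'. a u w = 0} + vec.dim L' \<le> 2 * d"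
    using dim_perp_le[OF L'(1) bil L'(4)] card_n by simp
  ultimately show ?thesis using L'(3) by simp
qed

text \<open>The perp of \<open>K\<close> has dimension greater than \<open>d\<close>, too large to
  be isotropic.\<close>

lemma exists_anisotropic_perp:
  assumes "vec.subspace K" "vec.dim K < d"
  obtains m where "a m m \<noteq> 0" "\<And>w. w \<in> K \<Longrightarrow> a w m = 0"
proof -
  let ?P = "{u. \<forall>w\<in>K. a u w = 0}"
  have "CARD('n) \<le> vec.dim ?P + vec.dim K"
    using dim_perp_ge[OF vec.subspace_UNIV assms(1) bil] by (simp add: card_cart_basis)
  then have "\<not> vec.dim ?P \<le> d" using assms(2) card_n by simp
  moreover have P: "vec.subspace ?P" using subspace_perp[OF vec.subspace_UNIV bil] by simp
  ultimately have "\<not> (\<forall>m\<in>?P. a m m = 0)"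
    using isotropic_dim_le[OF P] isotropic_polarization[OF bil P] by blast
  then show thesis using that asym by auto
qed

lemma refl_along_linear: "Vector_Spaces.linear (*s) (*s) (refl_along a m)"
  by unfold_locales
    (auto simp: refl_along_def asim vec_eq_iff algebra_simps add_divide_distrib)

lemma refl_along_fix: "a v m = 0 \<Longrightarrow> refl_along a m v = v"
  by (simp add: refl_along_def)

lemma refl_along_fix_image:
  assumes "w \<in> L" "a m w = 0"
  shows "w \<in> refl_along a m ` L"
proof -
  have "refl_along a m w = w" using assms(2) asym by (intro refl_along_fix) simp
  then show ?thesis using assms(1) by (metis image_eqI)
qed

lemma refl_along_self:
  assumes "a m m \<noteq> 0"
  shows "refl_along a m (refl_along a m v) = v"
  using assms by (simp add: refl_along_def asim vec_eq_iff field_simps)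

lemma refl_along_isometry:
  assumes "a m m \<noteq> 0"
  shows "a (refl_along a m u) (refl_along a m v) = a u v"
  using assms asym[of m v] asym[of m u] by (simp add: refl_along_def asim field_simps)

lemma refl_along_image_self: "a m m \<noteq> 0 \<Longrightarrow> refl_along a m ` refl_along a m ` L = L"
  by (simp add: image_image refl_along_self)

lemma refl_along_inj: "a m m \<noteq> 0 \<Longrightarrow> inj (refl_along a m)"
  by (metis injI refl_along_self)

lemma lagr_refl_along:
  assumes "lagr a d L" "a m m \<noteq> 0"
  shows "lagr a d (refl_along a m ` L)"
proof -
  interpret Vector_Spaces.linear "(*s)" "(*s)" "refl_along a m" by (rule refl_along_linear)
  have "vec.dim (refl_along a m ` L) = vec.dim L"
    using vec.dim_image_eq[OF refl_along_linear] refl_along_inj[OF assms(2)]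
    by (meson inj_on_subset subset_UNIV)
  then show ?thesis
    using assms by (auto simp: lagr_def subspace_image refl_along_isometry)
qed

lemma same_ruling_lagr: "same_ruling a L L' \<Longrightarrow> lagr a d L \<Longrightarrow> lagr a d L'"
  by (induction rule: same_ruling.induct) (auto intro: lagr_refl_along)

lemma same_ruling_sym: "same_ruling a L L' \<Longrightarrow> same_ruling a L' L"
proof (induction rule: same_ruling.induct)
  case (double_reflection L L' m m')
  have "same_ruling a (refl_along a m ` refl_along a m' ` L')
    (refl_along a m' ` refl_along a m ` (refl_along a m ` refl_along a m' ` L'))"
    using double_reflection.hyps by (intro same_ruling.intros)
  then have "same_ruling a (refl_along a m ` refl_along a m' ` L') L'"
    using double_reflection.hyps by (simp add: refl_along_image_self)
  then show ?case using double_reflection.IH same_ruling_trans by blast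
qed (rule same_ruling.trivial)

lemma lagr_maximal:
  assumes L: "lagr a d L" and v: "a v v = 0" "v \<notin> L"
  shows "\<exists>l\<in>L. a l v \<noteq> 0"
proof (rule ccontr)
  assume "\<not> ?thesis"
  then have 0: "\<And>l. l \<in> L \<Longrightarrow> a l v = 0" by blast
  let ?M = "vec.span (insert v L)"
  have q: "a u u = 0" if "u \<in> ?M" for u
  proof -
    obtain c where c: "u - c *s v \<in> L" using span_insertE[OF lagrD(1)[OF L] \<open>u \<in> ?M\<close>] .
    have "a (u - c *s v) (u - c *s v) = 0" "a (u - c *s v) v = 0"
      using lagrD(3)[OF L c c] 0[OF c] by simp_all
    then show ?thesis using v asym[of v u] by (simp add: asim)
  qed
  have "vec.dim ?M \<le> d"
    using isotropic_polarization[OF bil vec.subspace_span q] by (rule isotropic_dim_le[OF vec.subspace_span])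
  then show False using dim_span_insert[OF lagrD(1)[OF L] v(2)] lagrD(2)[OF L] by simp
qed

text \<open>The reflection along \<open>l - v\<close> exchanges \<open>l\<close> and \<open>v\<close>, where \<open>l\<close> is chosen with \<open>a l v = 1\<close>.\<close>
lemma refl_along_moves_into:
  assumes L: "lagr a d L" and v: "a v v = 0" "v \<notin> L"
  obtains m where "a m m \<noteq> 0" "v \<in> refl_along a m ` L"
    "\<And>w. w \<in> L \<Longrightarrow> a w v = 0 \<Longrightarrow> w \<in> refl_along a m ` L"
proof -
  obtain l0 where l0: "l0 \<in> L" "a l0 v \<noteq> 0" using lagr_maximal[OF assms] by blast
  define l where "l = (1 / a l0 v) *s l0"
  have "l \<in> L" using l0 lagrD(1)[OF L] by (simp add: l_def vec.subspace_scale)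
  then have l: "l \<in> L" "a l v = 1" "a l l = 0"
    using l0 lagrD(3)[OF L, of l l] by (simp_all add: l_def asim)
  define m where "m = l - v"
  have mm: "a m m = -2" "a l m = -1" using l v asym[of v l] by (simp_all add: m_def asim)
  have "refl_along a m l = v" by (simp add: refl_along_def mm) (simp add: m_def)
  moreover have "refl_along a m w = w" if "w \<in> L" "a w v = 0" for w
    using that lagrD(3)[OF L that(1) l(1)] by (intro refl_along_fix) (simp add: m_def asim)
  ultimately show thesis using that[of m] mm l(1) by (metis image_eqI neg_equal_0_iff_equal zero_neq_numeral)
qed

text \<open>One reflection brings a new vector of \<open>x\<close> into the subspace and keeps the
  old intersection. A second one, along a vector perpendicular to the enlarged intersection,
  restores the parity without disturbing it; such a vector exists because
  \<open>vec.dim x < d\<close>.\<close>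

lemma lagr_class_through:
  assumes x: "vec.subspace x" "\<And>u v. u \<in> x \<Longrightarrow> v \<in> x \<Longrightarrow> a u v = 0" "vec.dim x < d"
    and "lagr a d L"
  shows "\<exists>L'. same_ruling a L L' \<and> x \<subseteq> L'"
  using assms(4)
proof (induction "vec.dim x - vec.dim (L \<inter> x)" arbitrary: L rule: less_induct)
  case (less L)
  note L = lagrD[OF less.prems]
  show ?case
  proof (cases "x \<subseteq> L")
    case True
    then show ?thesis using same_ruling.trivial by blast
  next
    case False
    then obtain v where v: "v \<in> x" "v \<notin> L" by blast
    obtain m where m: "a m m \<noteq> 0" "v \<in> refl_along a m ` L"
      "\<And>w. w \<in> L \<Longrightarrow> a w v = 0 \<Longrightarrow> w \<in> refl_along a m ` L"
      using refl_along_moves_into[OF less.prems _ v(2)] x(2) v(1) by blast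
    have K: "vec.subspace (L \<inter> x)" using L(1) x(1) by (rule vec.subspace_inter)
    let ?K = "vec.span (insert v (L \<inter> x))"
    have Kx: "?K \<subseteq> x" using v x(1) by (intro vec.span_minimal) auto
    then have "vec.dim ?K < d" using x(3) vec.dim_subset[OF Kx] by linarith
    then obtain m' where m': "a m' m' \<noteq> 0" "\<And>w. w \<in> ?K \<Longrightarrow> a w m' = 0"
      using exists_anisotropic_perp[of ?K] by auto
    let ?L = "refl_along a m' ` refl_along a m ` L"
    have lag: "lagr a d ?L" using less.prems m m' by (intro lagr_refl_along)
    have "insert v (L \<inter> x) \<subseteq> ?L"
    proof
      fix w assume w: "w \<in> insert v (L \<inter> x)"
      then have "refl_along a m' w = w" using m'(2) by (intro refl_along_fix) (auto intro: vec.span_base)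
      moreover have "w \<in> refl_along a m ` L" using w m x(2) v(1) by auto
      ultimately show "w \<in> ?L" by (metis image_eqI)
    qed
    then have "?K \<subseteq> ?L \<inter> x"
      using Kx lagrD(1)[OF lag] by (simp add: vec.span_minimal)
    then have "vec.dim ?K \<le> vec.dim (?L \<inter> x)" by (rule vec.dim_subset)
    moreover have "vec.dim ?K = Suc (vec.dim (L \<inter> x))" using dim_span_insert[OF K] v by blast
    moreover have "vec.dim ?K \<le> vec.dim x" using Kx by (rule vec.dim_subset)
    ultimately have "vec.dim x - vec.dim (?L \<inter> x) < vec.dim x - vec.dim (L \<inter> x)" by linarith
    then obtain L' where "same_ruling a ?L L'" "x \<subseteq> L'" using less.hyps[OF _ lag] by blast
    moreover have "same_ruling a L ?L" using m m' by (intro same_ruling.intros)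
    ultimately show ?thesis using same_ruling_trans by blast
  qed
qed

lemma dim_lagr_Int_refl_along:
  assumes L: "lagr a d L"
  shows "vec.dim L \<le> Suc (vec.dim (L \<inter> refl_along a m ` L))"
proof -
  have "{l \<in> L. a m l = 0} \<subseteq> L \<inter> refl_along a m ` L"
    using refl_along_fix_image by blast
  then have "vec.dim {l \<in> L. a m l = 0} \<le> vec.dim (L \<inter> refl_along a m ` L)"
    by (rule vec.dim_subset)
  then show ?thesis
    using dim_le_dim_kernel[OF lagrD(1)[OF L] sbil_lfun[OF bil, of m]] by simp
qed

text \<open>Each of two reflections brings in one vector of \<open>L'\<close> and keeps the previous
  intersection, so the second lands on \<open>L'\<close>.\<close>

lemma same_ruling_codim_2:
  assumes L: "lagr a d L" and L': "lagr a d L'" and dim: "vec.dim (L \<inter> L') + 2 = d"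
  shows "same_ruling a L L'"
proof -
  note l = lagrD[OF L] and l' = lagrD[OF L']
  have K: "vec.subspace (L \<inter> L')" using l(1) l'(1) by (rule vec.subspace_inter)
  have "\<not> L' \<subseteq> L"
  proof
    assume "L' \<subseteq> L"
    then have "L \<inter> L' = L'" by blast
    then show False using dim l' by simp
  qed
  then obtain v where v: "v \<in> L'" "v \<notin> L" by blast
  obtain m where m: "a m m \<noteq> 0" "v \<in> refl_along a m ` L"
      "\<And>w. w \<in> L \<Longrightarrow> a w v = 0 \<Longrightarrow> w \<in> refl_along a m ` L"
    using refl_along_moves_into[OF L _ v(2)] l'(3)[OF v(1) v(1)] by blast
  let ?L1 = "refl_along a m ` L" and ?K = "vec.span (insert v (L \<inter> L'))"
  have L1: "lagr a d ?L1" using lagr_refl_along[OF L m(1)] .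
  have dK: "vec.dim ?K + 1 = d" using dim_span_insert[OF K, of v] v dim by simp
  have KL': "?K \<subseteq> L'" using v l'(1) by (intro vec.span_minimal) auto
  have KL1: "?K \<subseteq> ?L1" using m v l'(3) lagrD(1)[OF L1] by (intro vec.span_minimal) auto
  \<comment> \<open>A single reflection changes \<open>L\<close> in codimension at most one, so it
    cannot reach \<open>L'\<close> already.\<close>
  have "?L1 \<noteq> L'" using dim_lagr_Int_refl_along[OF L, of m] dim l(2) by auto
  then have "\<not> L' \<subseteq> ?L1" using lagr_eqI[OF L' L1] by auto
  then obtain w where w: "w \<in> L'" "w \<notin> ?L1" by blast
  obtain m2 where m2: "a m2 m2 \<noteq> 0" "w \<in> refl_along a m2 ` ?L1"
      "\<And>u. u \<in> ?L1 \<Longrightarrow> a u w = 0 \<Longrightarrow> u \<in> refl_along a m2 ` ?L1"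
    using refl_along_moves_into[OF L1 _ w(2)] l'(3)[OF w(1) w(1)] by blast
  let ?L2 = "refl_along a m2 ` ?L1"
  have L2: "lagr a d ?L2" using lagr_refl_along[OF L1 m2(1)] .
  have "insert w ?K \<subseteq> ?L2" using m2 KL1 KL' l'(3) w(1) by blast
  then have sub: "vec.span (insert w ?K) \<subseteq> ?L2" using lagrD(1)[OF L2] by (intro vec.span_minimal)
  have sub': "vec.span (insert w ?K) \<subseteq> L'" using KL' w l'(1) by (intro vec.span_minimal) auto
  have "vec.dim (vec.span (insert w ?K)) = d"
    using dim_span_insert[of ?K w] dK KL1 w(2) by auto
  then have "vec.span (insert w ?K) = ?L2" "vec.span (insert w ?K) = L'"
    using vec.subspace_dim_equal[OF vec.subspace_span lagrD(1)[OF L2] sub]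
      vec.subspace_dim_equal[OF vec.subspace_span l'(1) sub'] l'(2) lagrD(2)[OF L2] by simp_all
  then have "L' = ?L2" by simp
  then show ?thesis using same_ruling.double_reflection[OF same_ruling.trivial[of a L] m2(1) m(1)] by simp
qed

text \<open>\<open>L\<close> is its own perp, and the anisotropic \<open>m\<close> is not in
  it.\<close>

lemma lagr_perp:
  assumes "lagr a d L" "a m m \<noteq> 0" "\<And>w. \<forall>u. a w u = 0 \<Longrightarrow> w = 0"
  shows "\<exists>l\<in>L. a m l \<noteq> 0"
proof (rule ccontr)
  assume "\<not> ?thesis"
  then have "m \<in> {u. \<forall>w\<in>L. a u w = 0}" by blast
  moreover have "L = {u. \<forall>w\<in>L. a u w = 0}"
  proof (rule vec.subspace_dim_equal)
    show "vec.subspace {u. \<forall>w\<in>L. a u w = 0}" using subspace_perp[OF vec.subspace_UNIV bil] by simp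
    show "vec.dim {u. \<forall>w\<in>L. a u w = 0} \<le> vec.dim L"
      using dim_perp_le[OF lagrD(1)[OF assms(1)] bil] assms(3) card_n lagrD(2)[OF assms(1)] by auto
  qed (use lagrD[OF assms(1)] in auto)
  ultimately show False using assms(2) lagrD(3)[OF assms(1)] by blast
qed

text \<open>Writing \<open>y\<close> for \<open>L \<inter> refl_along a m ` L\<close>, the isotropic vectors of the perp of \<open>y\<close> lie in \<open>L\<close> or in its mirror
  image; hence the subspace of \<open>K\<close> perpendicular to \<open>y\<close> is one of the two intersections.\<close>
lemma odd_dim_Int_refl_along:
  assumes nd: "\<And>w. \<forall>u. a w u = 0 \<Longrightarrow> w = 0"
    and L: "lagr a d L" and K: "lagr a d K" and m: "a m m \<noteq> 0"
  shows "odd (vec.dim (K \<inter> L) + vec.dim (K \<inter> refl_along a m ` L))"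
proof -
  define y where "y = {l \<in> L. a m l = 0}"
  define M where "M = refl_along a m ` L"
  have M: "lagr a d M" using L m unfolding M_def by (rule lagr_refl_along)
  note l = lagrD[OF L] and k = lagrD[OF K] and mm = lagrD[OF M]
  have y: "vec.subspace y" using subspace_lfun[OF l(1) sbil_lfun[OF bil]] by (simp add: y_def)
  have yM: "y \<subseteq> M"
    using refl_along_fix_image by (auto simp: y_def M_def)
  have LM: "L \<inter> M = y"
  proof
    show "L \<inter> M \<subseteq> y"
    proof
      fix u assume u: "u \<in> L \<inter> M"
      then obtain l0 where l0: "l0 \<in> L" "u = refl_along a m l0" by (auto simp: M_def)
      have "(2 * a l0 m / a m m) *s m = l0 - u" using l0 by (simp add: refl_along_def)
      then have "(2 * a l0 m / a m m) *s m \<in> L" using l0 u l(1) by (simp add: vec.subspace_diff)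
      then have "a ((2 * a l0 m / a m m) *s m) ((2 * a l0 m / a m m) *s m) = 0" using l(3) by blast
      then have "a l0 m = 0" using m by (simp add: asim)
      then show "u \<in> y" using l0 asym by (simp add: y_def refl_along_fix)
    qed
    show "y \<subseteq> L \<inter> M" using yM by (auto simp: y_def)
  qed
  have "y \<noteq> L" using lagr_perp[OF L m nd] by (auto simp: y_def)
  have dy: "vec.dim y + 1 = d"
  proof -
    have "d \<le> Suc (vec.dim y)"
      using dim_le_dim_kernel[OF l(1) sbil_lfun[OF bil, of m]] l(2) by (simp add: y_def)
    moreover have "vec.dim y < d"
      using vec.subspace_dim_equal[OF y l(1)] \<open>y \<noteq> L\<close> l(2) y_def by force
    ultimately show ?thesis by simp
  qed
  have mL: "m \<notin> L" using m l(3) by blast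
  have perp: "{u. \<forall>w\<in>y. a u w = 0} = vec.span (insert m L)"
  proof (rule sym, rule vec.subspace_dim_equal)
    show sub: "vec.subspace {u. \<forall>w\<in>y. a u w = 0}" using subspace_perp[OF vec.subspace_UNIV bil] by simp
    show "vec.span (insert m L) \<subseteq> {u. \<forall>w\<in>y. a u w = 0}"
      using l(3) by (intro vec.span_minimal[OF _ sub]) (auto simp: y_def)
    show "vec.dim {u. \<forall>w\<in>y. a u w = 0} \<le> vec.dim (vec.span (insert m L))"
      using dim_perp_le[OF y bil] nd card_n dy dim_span_insert[OF l(1) mL] l(2) by fastforce
  qed auto
  define E where "E = {u \<in> K. \<forall>w\<in>y. a u w = 0}"
  have E: "vec.subspace E" unfolding E_def using k(1) bil by (rule subspace_perp)
  have EU: "E = (K \<inter> L) \<union> (K \<inter> M)"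
  proof
    show "E \<subseteq> (K \<inter> L) \<union> (K \<inter> M)"
    proof
      fix u assume u: "u \<in> E"
      then have "u \<in> vec.span (insert m L)" using perp by (auto simp: E_def)
      then obtain c where c: "u - c *s m \<in> L" using span_insertE[OF l(1)] by metis
      define v where "v = u - c *s m"
      have "a u u = 0" using u k(3) by (auto simp: E_def)
      moreover have "a v v = 0" using c l(3) by (simp add: v_def)
      moreover have "u = v + c *s m" by (simp add: v_def)
      \<comment> \<open>Expanding \<open>a u u = 0\<close> leaves two values of \<open>c\<close>:
        zero, which puts \<open>u\<close> in \<open>L\<close>, and the one that makes
        \<open>u\<close> the mirror image of \<open>v\<close>.\<close>
      ultimately have "c * (2 * a v m + c * a m m) = 0" using asym[of m v] by (simp add: asim algebra_simps)
      then have "c = 0 \<or> c * a m m = - (2 * a v m)" by (metis add.inverse_unique mult_eq_0_iff)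
      then consider "c = 0" | "c = - (2 * a v m / a m m)"
        using m by (auto simp: field_simps)
      then have "u \<in> L \<union> M"
      proof cases
        case 1
        then show ?thesis using c by simp
      next
        case 2
        have "u = refl_along a m v"
          unfolding refl_along_def using \<open>u = v + c *s m\<close> 2 by (simp add: vec.scale_minus_left)
        then show ?thesis using c by (auto simp: M_def v_def)
      qed
      then show "u \<in> (K \<inter> L) \<union> (K \<inter> M)" using u by (auto simp: E_def)
    qed
    show "(K \<inter> L) \<union> (K \<inter> M) \<subseteq> E"
      using l(3) mm(3) yM by (auto simp: E_def y_def)
  qed
  have Ky: "vec.subspace (K \<inter> y)" using k(1) y by (rule vec.subspace_inter)
  obtain D where D: "finite D" "D \<subseteq> y" "card D + vec.dim (K \<inter> y) = vec.dim y" "vec.span ((K \<inter> y) \<union> D) = y"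
    using complement_in_subspace[OF Ky y] by auto
  \<comment> \<open>\<open>K\<close> is isotropic, so only the part \<open>D\<close> of
    \<open>y\<close> imposes conditions on it; counting them gives
    \<open>vec.dim (K \<inter> y) + 1 \<le> vec.dim E\<close>.\<close>
  have "{u \<in> K. \<forall>w\<in>D. a u w = 0} \<subseteq> E"
  proof
    fix u assume u: "u \<in> {u \<in> K. \<forall>w\<in>D. a u w = 0}"
    then have "a u w = 0" if "w \<in> (K \<inter> y) \<union> D" for w using that k(3) by blast
    then have "a u w = 0" if "w \<in> y" for w using sbil_0_on_span[OF bil, of "(K \<inter> y) \<union> D" u] D(4) that by blast
    then show "u \<in> E" using u by (auto simp: E_def)
  qed
  then have "vec.dim {u \<in> K. \<forall>w\<in>D. a u w = 0} \<le> vec.dim E" by (rule vec.dim_subset)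
  then have dE: "vec.dim (K \<inter> y) + 1 \<le> vec.dim E"
    using dim_le_dim_kernels[OF D(1) k(1), of "\<lambda>w u. a u w"] D(3) dy k(2) sbil_lfun_left[OF bil] by fastforce
  have hyper: "vec.dim (K \<inter> N) \<le> vec.dim (K \<inter> y) + 1" if N: "lagr a d N" "y \<subseteq> N" for N
  proof (cases "K \<inter> N \<subseteq> y")
    case True
    then have "K \<inter> N \<subseteq> K \<inter> y" by blast
    then have "vec.dim (K \<inter> N) \<le> vec.dim (K \<inter> y)" by (rule vec.dim_subset)
    then show ?thesis by simp
  next
    case False
    then obtain w where w: "w \<in> K" "w \<in> N" "w \<notin> y" by blast
    have "N = vec.span (insert w y)"
      using y dy lagrD(1,2)[OF N(1)] w N(2) by (intro eq_span_insert) auto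
    have "K \<inter> N \<subseteq> vec.span (insert w (K \<inter> y))"
    proof
      fix u assume u: "u \<in> K \<inter> N"
      then have "u \<in> vec.span (insert w y)" using \<open>N = _\<close> by blast
      then obtain c where "u - c *s w \<in> y" by (rule span_insertE[OF y])
      moreover have "u - c *s w \<in> K" using u w(1) k(1) by (simp add: vec.subspace_diff vec.subspace_scale)
      ultimately show "u \<in> vec.span (insert w (K \<inter> y))" using mem_span_insert[OF Ky, of u w] by blast
    qed
    then have "vec.dim (K \<inter> N) \<le> vec.dim (insert w (K \<inter> y))" by (rule vec.dim_mono)
    then show ?thesis by (simp add: vec.dim_insert split: if_splits)
  qed
  have KL: "vec.subspace (K \<inter> L)" and KM: "vec.subspace (K \<inter> M)"
    using k(1) l(1) mm(1) by (auto intro: vec.subspace_inter)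
  have "K \<inter> L \<subseteq> K \<inter> M \<or> K \<inter> M \<subseteq> K \<inter> L"
  proof (rule ccontr)
    assume "\<not> ?thesis"
    then obtain u v where uv: "u \<in> K \<inter> L" "u \<notin> K \<inter> M" "v \<in> K \<inter> M" "v \<notin> K \<inter> L" by blast
    then have "u + v \<in> (K \<inter> L) \<union> (K \<inter> M)" using E EU by (metis UnCI vec.subspace_add)
    then show False
      using uv KL KM vec.subspace_diff[of "K \<inter> L" "u + v" u] vec.subspace_diff[of "K \<inter> M" "u + v" v] by auto
  qed
  then consider "E = K \<inter> M" "K \<inter> L = K \<inter> y" | "E = K \<inter> L" "K \<inter> M = K \<inter> y"
    using EU LM by blast
  then show ?thesis
  proof cases
    case 1
    then have "vec.dim (K \<inter> M) = vec.dim (K \<inter> y) + 1" using hyper[OF M yM] dE by simp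
    then show ?thesis using 1 by (simp add: M_def)
  next
    case 2
    then have "vec.dim (K \<inter> L) = vec.dim (K \<inter> y) + 1" using hyper[OF L] dE by (simp add: y_def)
    then show ?thesis using 2 by (simp add: M_def)
  qed
qed

text \<open>Each reflection flips the parity of the intersection with \<open>K\<close>, and a class
  uses them in pairs.\<close>

lemma same_ruling_even:
  assumes nd: "\<And>w. \<forall>u. a w u = 0 \<Longrightarrow> w = 0"
  shows "same_ruling a L L' \<Longrightarrow> lagr a d L \<Longrightarrow> lagr a d K \<Longrightarrow>
    even (vec.dim (K \<inter> L) + vec.dim (K \<inter> L'))"
proof (induction rule: same_ruling.induct)
  case (double_reflection L L' m m')
  have L': "lagr a d L'" using double_reflection same_ruling_lagr by blast
  have "odd (vec.dim (K \<inter> L') + vec.dim (K \<inter> refl_along a m' ` L'))"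
    using double_reflection L' by (intro odd_dim_Int_refl_along[OF nd])
  moreover have "odd (vec.dim (K \<inter> refl_along a m' ` L') + vec.dim (K \<inter> refl_along a m ` refl_along a m' ` L'))"
    using double_reflection L' by (intro odd_dim_Int_refl_along[OF nd] lagr_refl_along)
  moreover have "even (vec.dim (K \<inter> L) + vec.dim (K \<inter> L'))" using double_reflection by blast
  ultimately show ?case by auto
qed simp

lemma kernel_in_lagr:
  assumes "lagr a d L" "\<forall>u. a k u = 0"
  shows "k \<in> L"
  using lagr_maximal[OF assms(1), of k] assms(2) asym by metis

lemma lagr_eq_span_kernel:
  assumes L: "lagr a d L" and k: "\<forall>u. a k u = 0" "k \<notin> x" and x: "vec.subspace x" "vec.dim x + 1 = d" "x \<subseteq> L"
  shows "L = vec.span (insert k x)"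
  using x lagrD(1,2)[OF L] kernel_in_lagr[OF L k(1)] k(2) by (intro eq_span_insert) auto

text \<open>Over a singular form both subspaces contain the kernel vector, which spans them together
  with \<open>x\<close>. Over a nonsingular form \<open>vec.dim (L \<inter> L')\<close> has the
  parity of \<open>d\<close>, which rules out \<open>d - 1\<close>.\<close>

lemma same_ruling_unique:
  assumes same: "same_ruling a L L'" and L: "lagr a d L"
    and x: "vec.subspace x" "vec.dim x + 1 = d" "x \<subseteq> L" "x \<subseteq> L'"
    and ker: "\<And>w. w \<in> x \<Longrightarrow> \<forall>u. a w u = 0 \<Longrightarrow> w = 0"
  shows "L = L'"
proof (cases "\<exists>k. k \<noteq> 0 \<and> (\<forall>u. a k u = 0)")
  case True
  then obtain k where "k \<noteq> 0" "\<forall>u. a k u = 0" by blast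
  with ker show ?thesis
    using lagr_eq_span_kernel[OF L _ _ x(1,2)] lagr_eq_span_kernel[OF same_ruling_lagr[OF same L] _ _ x(1,2)] x
    by metis
next
  case False
  then have ev: "even (d + vec.dim (L \<inter> L'))"
    using same_ruling_even[OF _ same L L] lagrD(2)[OF L] by (metis Int_absorb)
  have L': "lagr a d L'" using same_ruling_lagr[OF same L] .
  have "vec.dim x \<le> vec.dim (L \<inter> L')" using x by (intro vec.dim_subset) auto
  moreover have "vec.dim (L \<inter> L') \<le> d" using vec.dim_subset[of "L \<inter> L'" L] lagrD(2)[OF L] by simp
  moreover have "vec.dim (L \<inter> L') \<noteq> vec.dim x"
  proof
    assume "vec.dim (L \<inter> L') = vec.dim x"
    then have "d + vec.dim (L \<inter> L') = 2 * vec.dim x + 1" using x(2) by simp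
    with ev show False by simp
  qed
  ultimately have "vec.dim (L \<inter> L') = d" using x(2) by simp
  then have "L \<inter> L' = L"
    using vec.subspace_dim_equal[OF vec.subspace_inter[OF lagrD(1)[OF L] lagrD(1)[OF L']] lagrD(1)[OF L]]
      lagrD(2)[OF L] by simp
  then show ?thesis using lagr_eqI[OF L L'] by blast
qed

text \<open>Let \<open>x\<close> be a hyperplane of \<open>L'\<close> avoiding the kernel. Any
  maximal isotropic subspace through \<open>x\<close> contains \<open>k\<close> too, so the member
  of the class of \<open>L\<close> through \<open>x\<close> is \<open>L'\<close>: a cone carries a
  single class.\<close>

lemma same_ruling_degenerate:
  assumes L: "lagr a d L" and L': "lagr a d L'" and k: "k \<noteq> 0" "\<forall>u. a k u = 0"
  shows "same_ruling a L L'"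
proof -
  note l' = lagrD[OF L']
  obtain \<phi> where \<phi>: "lfun \<phi>" "\<phi> k = 1" using coordinate_functional[of "{0}" k] k by auto
  define x where "x = {v \<in> L'. \<phi> v = 0}"
  have x: "vec.subspace x" "x \<subseteq> L'" using subspace_lfun[OF l'(1) \<phi>(1)] by (auto simp: x_def)
  have kx: "k \<notin> x" using \<phi> by (simp add: x_def)
  have "d \<le> Suc (vec.dim x)" using dim_le_dim_kernel[OF l'(1) \<phi>(1)] l'(2) by (simp add: x_def)
  moreover have "vec.dim x < d"
    using vec.subspace_dim_equal[OF x(1) l'(1) x(2)] kx kernel_in_lagr[OF L' k(2)] l'(2) by force
  ultimately have dx: "vec.dim x + 1 = d" by simp
  obtain L'' where L'': "same_ruling a L L''" "x \<subseteq> L''"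
    using lagr_class_through[OF x(1) _ \<open>vec.dim x < d\<close> L] x(2) l'(3) by blast
  have "L'' = L'"
    using lagr_eq_span_kernel[OF L' k(2) kx x(1) dx x(2)]
      lagr_eq_span_kernel[OF same_ruling_lagr[OF L''(1) L] k(2) kx x(1) dx L''(2)] by simp
  with L'' show ?thesis by simp
qed

lemma same_rulingI:
  assumes "lagr a d L" "lagr a d L'"
    and "(\<And>w. \<forall>u. a w u = 0 \<Longrightarrow> w = 0) \<Longrightarrow> vec.dim (L \<inter> L') + 2 = d"
  shows "same_ruling a L L'"
  using assms same_ruling_codim_2 same_ruling_degenerate by metis

end

section \<open>Pencils of quadrics\<close>

lemma subspace_subset_Un:
  assumes "vec.subspace S" "vec.subspace A" "vec.subspace B" "S \<subseteq> A \<union> B"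
  shows "S \<subseteq> A \<or> S \<subseteq> B"
proof (rule ccontr)
  assume "\<not> ?thesis"
  then obtain u v where uv: "u \<in> S" "u \<notin> A" "v \<in> S" "v \<notin> B" by blast
  then have "u + v \<in> A \<union> B" using assms(1,4) vec.subspace_add by blast
  then show False
    using uv assms vec.subspace_diff[of A "u + v" v] vec.subspace_diff[of B "u + v" u] by auto
qed

text \<open>A subspace inside a union of two lies in one of them, so the union determines the
  unordered pair. This reads residual subspaces off \<open>L \<inter> V\<close>, even at
  tangency.\<close>

lemma equidimensional_Un_eq:
  assumes "vec.subspace A" "vec.subspace B" "vec.subspace C" "vec.subspace D"
    and "vec.dim A = k" "vec.dim B = k" "vec.dim C = k" "vec.dim D = k"
    and eq: "A \<union> B = C \<union> D"
  shows "(A = C \<and> B = D) \<or> (A = D \<and> B = C)"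
proof -
  have "A = C \<or> A = D" "B = C \<or> B = D" "C = A \<or> C = B" "D = A \<or> D = B"
    using subspace_subset_Un[of A C D] subspace_subset_Un[of B C D]
      subspace_subset_Un[of C A B] subspace_subset_Un[of D A B] assms
    by (metis Un_upper1 Un_upper2 order_refl vec.subspace_dim_equal)+
  then show ?thesis by metis
qed

lemma quadratic_root:
  fixes a b c :: complex
  assumes "a \<noteq> 0"
  obtains z where "a * z\<^sup>2 + b * z + c = 0"
proof -
  have "\<not> constant (poly [:c, b, a:])" using assms by (simp add: constant_degree)
  then obtain z where "poly [:c, b, a:] z = 0" using fundamental_theorem_of_algebra by blast
  then show ?thesis using that[of z] by (simp add: algebra_simps power2_eq_square)
qed

text \<open>Write \<open>v = l + \<phi> v *s w\<close> with \<open>\<phi> w = 1\<close> and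
  \<open>\<phi> l = 0\<close>. The term \<open>f l l\<close> vanishes and the others contain the
  factor \<open>\<phi> v\<close>; their quotient is \<open>\<psi>\<close>.\<close>

lemma factor_through_hyperplane:
  assumes f: "sbil f" and U: "vec.subspace U" and \<phi>: "lfun \<phi>"
    and 0: "\<And>v. v \<in> U \<Longrightarrow> \<phi> v = 0 \<Longrightarrow> f v v = 0"
  obtains \<psi> where "lfun \<psi>" "\<And>v. v \<in> U \<Longrightarrow> f v v = \<phi> v * \<psi> v"
proof (cases "\<exists>w\<in>U. \<phi> w \<noteq> 0")
  case False
  then show ?thesis using that[of "\<lambda>_. 0"] 0 by (auto simp: lfun_def)
next
  case True
  then obtain w0 where w0: "w0 \<in> U" "\<phi> w0 \<noteq> 0" by blast
  define w where "w = (1 / \<phi> w0) *s w0"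
  have w: "w \<in> U" "\<phi> w = 1" using w0 U \<phi> by (simp_all add: w_def vec.subspace_scale lfun_simps)
  show ?thesis
  proof (rule that)
    show "lfun (\<lambda>v. 2 * f w v - f w w * \<phi> v)"
      using \<phi> sbil_lfun[OF f] by (intro lfun_comb)
    fix v assume v: "v \<in> U"
    define l where "l = v - \<phi> v *s w"
    have l: "l \<in> U" "\<phi> l = 0"
      using v w U \<phi> by (simp_all add: l_def vec.subspace_diff vec.subspace_scale lfun_simps)
    have "f l l = 0" using 0[OF l] .
    then show "f v v = \<phi> v * (2 * f w v - f w w * \<phi> v)"
      using sbil_sym[OF f, of w v] by (simp add: l_def sbil_simps[OF f] algebra_simps)
  qed
qed

lemma span_insert_kernel:
  assumes L: "vec.subspace L" and \<phi>: "lfun \<phi>" "\<And>v. v \<in> L \<Longrightarrow> \<phi> v = 0" "\<phi> a = 1"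
    and v: "v \<in> vec.span (insert a L)"
  shows "v - \<phi> v *s a \<in> L"
proof -
  obtain c where c: "v - c *s a \<in> L" using span_insertE[OF L v] .
  then have "c = \<phi> v" using \<phi>(2)[OF c] \<phi> by (simp add: lfun_simps)
  with c show ?thesis by simp
qed

text \<open>\<open>smooth\<close> is the Jacobian criterion for the polar forms. It survives a
  change of basis of the pencil, so any member can take the place of \<open>f\<close>.\<close>

locale pencil =
  fixes f g :: "'n::finite form" and d :: nat
  assumes bil_f: "sbil f" and bil_g: "sbil g" and card_n: "CARD('n) = 2 * d"
    and smooth: "\<And>v s t. v \<noteq> 0 \<Longrightarrow> f v v = 0 \<Longrightarrow> g v v = 0 \<Longrightarrow>
      (\<And>u. s * f v u + t * g v u = 0) \<Longrightarrow> s = 0 \<and> t = 0"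

definition base_locus :: "'n::finite form \<Rightarrow> 'n form \<Rightarrow> (complex ^ 'n) set" where
  "base_locus f g = {v. f v v = 0 \<and> g v v = 0}"

text \<open>A predicate version of \<open>FV\<close> whose dimension condition avoids subtraction on
  natural numbers; for \<open>d = 1\<close> it can hold only of the zero space.\<close>

definition fv :: "nat \<Rightarrow> (complex ^ 'n) set \<Rightarrow> (complex ^ 'n) set \<Rightarrow> bool" where
  "fv d V x \<longleftrightarrow> vec.subspace x \<and> vec.dim x + 1 = d \<and> x \<subseteq> V"

lemma fvD:
  assumes "fv d V x"
  shows "vec.subspace x" "vec.dim x + 1 = d" "x \<subseteq> V"
  using assms by (auto simp: fv_def)

lemma fv_eqI:
  assumes "fv d V x" "fv d V y" "x \<subseteq> y"
  shows "x = y"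
  using vec.subspace_dim_equal[OF fvD(1)[OF assms(1)] fvD(1)[OF assms(2)] assms(3)]
    fvD(2)[OF assms(1)] fvD(2)[OF assms(2)] by simp

lemma lagr_eq_span_insert:
  assumes "lagr a d L" "fv d V x" "x \<subseteq> L" "w \<in> L" "w \<notin> x"
  shows "L = vec.span (insert w x)"
  using assms by (intro eq_span_insert) (auto simp: lagr_def fv_def)

lemma fv_Un_eq:
  assumes "fv d V A" "fv d V B" "fv d V C" "fv d V D" "A \<union> B = C \<union> D"
  shows "(A = C \<and> B = D) \<or> (A = D \<and> B = C)"
  using equidimensional_Un_eq[of A B C D "d - 1"] assms by (auto simp: fv_def)

lemma fv_residual_eq:
  assumes "fv d V A" "fv d V B" "fv d V C" "A \<union> B = A \<union> C"
  shows "B = C"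
  using fv_Un_eq[of d V A B A C] assms by blast

lemma pencil_transform:
  assumes "pencil f g d" and det: "\<alpha> * \<delta> - \<beta> * \<gamma> \<noteq> 0"
  shows "pencil (\<lambda>u v. \<alpha> * f u v + \<beta> * g u v) (\<lambda>u v. \<gamma> * f u v + \<delta> * g u v) d"
    and "base_locus (\<lambda>u v. \<alpha> * f u v + \<beta> * g u v) (\<lambda>u v. \<gamma> * f u v + \<delta> * g u v) = base_locus f g"
proof -
  interpret pencil f g d by fact
  have inv: "p = 0 \<and> q = 0" if "\<alpha> * p + \<beta> * q = 0" "\<gamma> * p + \<delta> * q = 0" for p q
  proof -
    have "(\<alpha> * \<delta> - \<beta> * \<gamma>) * p = \<delta> * (\<alpha> * p + \<beta> * q) - \<beta> * (\<gamma> * p + \<delta> * q)"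
      "(\<alpha> * \<delta> - \<beta> * \<gamma>) * q = \<alpha> * (\<gamma> * p + \<delta> * q) - \<gamma> * (\<alpha> * p + \<beta> * q)"
      by (simp_all add: algebra_simps)
    then have "(\<alpha> * \<delta> - \<beta> * \<gamma>) * p = 0" "(\<alpha> * \<delta> - \<beta> * \<gamma>) * q = 0" unfolding that by simp_all
    with det show ?thesis unfolding mult_eq_0_iff by blast
  qed
  then have "\<alpha> * p + \<beta> * q = 0 \<and> \<gamma> * p + \<delta> * q = 0 \<longleftrightarrow> p = 0 \<and> q = 0" for p q
    by (metis add.right_neutral mult_zero_right)
  then show "base_locus (\<lambda>u v. \<alpha> * f u v + \<beta> * g u v) (\<lambda>u v. \<gamma> * f u v + \<delta> * g u v) = base_locus f g"
    unfolding base_locus_def by presburger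
  show "pencil (\<lambda>u v. \<alpha> * f u v + \<beta> * g u v) (\<lambda>u v. \<gamma> * f u v + \<delta> * g u v) d"
  proof
    fix v s t
    assume v: "v \<noteq> 0" "\<alpha> * f v v + \<beta> * g v v = 0" "\<gamma> * f v v + \<delta> * g v v = 0"
      and 0: "\<And>u. s * (\<alpha> * f v u + \<beta> * g v u) + t * (\<gamma> * f v u + \<delta> * g v u) = 0"
    have "f v v = 0" "g v v = 0" using inv v by blast+
    moreover have "(s * \<alpha> + t * \<gamma>) * f v u + (s * \<beta> + t * \<delta>) * g v u = 0" for u
      using 0[of u] by (simp add: algebra_simps)
    ultimately have z: "s * \<alpha> + t * \<gamma> = 0" "s * \<beta> + t * \<delta> = 0"
      using smooth[OF v(1), of "s * \<alpha> + t * \<gamma>" "s * \<beta> + t * \<delta>"] by blast+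
    have "(\<alpha> * \<delta> - \<beta> * \<gamma>) * s = \<delta> * (s * \<alpha> + t * \<gamma>) - \<gamma> * (s * \<beta> + t * \<delta>)"
      "(\<alpha> * \<delta> - \<beta> * \<gamma>) * t = \<alpha> * (s * \<beta> + t * \<delta>) - \<beta> * (s * \<alpha> + t * \<gamma>)"
      by (simp_all add: algebra_simps)
    then have "(\<alpha> * \<delta> - \<beta> * \<gamma>) * s = 0" "(\<alpha> * \<delta> - \<beta> * \<gamma>) * t = 0" unfolding z by simp_all
    with det show "s = 0 \<and> t = 0" unfolding mult_eq_0_iff by blast
  qed (use bil_f bil_g card_n in \<open>auto intro: sbil_comb\<close>)
qed

context pencil
begin

abbreviation "V \<equiv> base_locus f g"

text \<open>A nonzero kernel vector of \<open>f\<close> isotropic for \<open>g\<close> would be a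
  singular point of \<open>V\<close>. A kernel of dimension two would contain one, as binary
  quadratic forms have complex zeros.\<close>

lemma corank_f: "\<exists>k. \<forall>w. (\<forall>u. f w u = 0) \<longrightarrow> (\<exists>c. w = c *s k)"
proof (cases "\<exists>k. k \<noteq> 0 \<and> (\<forall>u. f k u = 0)")
  case False
  then show ?thesis by (metis vec.scale_zero_left)
next
  case True
  then obtain k where k: "k \<noteq> 0" "\<forall>u. f k u = 0" by blast
  have no: "g v v \<noteq> 0" if "v \<noteq> 0" "\<forall>u. f v u = 0" for v
    using smooth[OF that(1), of 1 0] that(2) by auto
  have "\<exists>c. w = c *s k" if w: "\<forall>u. f w u = 0" for w
  proof -
    obtain z where z: "g k k * z\<^sup>2 + (2 * g w k) * z + g w w = 0"
      using quadratic_root[OF no[OF k]] .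
    let ?v = "w + z *s k"
    have "g ?v ?v = 0"
      using z sbil_sym[OF bil_g, of k w] by (simp add: sbil_simps[OF bil_g] algebra_simps power2_eq_square)
    moreover have "\<forall>u. f ?v u = 0" using w k by (simp add: sbil_simps[OF bil_f])
    ultimately have "?v = 0" using no by blast
    then have "w = (- z) *s k" by (simp add: eq_neg_iff_add_eq_0)
    then show ?thesis by blast
  qed
  then show ?thesis by blast
qed

sublocale f: quadratic_form f d
  using bil_f card_n corank_f by unfold_locales

lemma isotropic_base:
  assumes "vec.subspace W" "W \<subseteq> V" "u \<in> W" "v \<in> W"
  shows "f u v = 0" "g u v = 0"
  using isotropic_polarization[OF bil_f assms(1) _ assms(3,4)]
    isotropic_polarization[OF bil_g assms(1) _ assms(3,4)] assms(2)
  by (auto simp: base_locus_def)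

text \<open>Otherwise some member of the pencil has a nonzero \<open>v\<close> of \<open>W\<close>
  perpendicular to a complement of \<open>H\<close>, hence to everything, and \<open>v\<close> is a
  singular point of \<open>V\<close>. Taking \<open>H = W\<close> bounds the dimension of subspaces
  on \<open>V\<close>.\<close>

lemma pairing_nondegenerate:
  assumes W: "vec.subspace W" "W \<subseteq> V" "vec.dim W > 0" and H: "vec.subspace H"
    and perp: "\<And>v u. v \<in> W \<Longrightarrow> u \<in> H \<Longrightarrow> f v u = 0 \<and> g v u = 0"
  shows "vec.dim W + vec.dim H < 2 * d"
proof (rule ccontr)
  assume large: "\<not> vec.dim W + vec.dim H < 2 * d"
  obtain C where C: "finite C" "card C + vec.dim H = CARD('n)" "vec.span (H \<union> C) = UNIV"
    using complement_of_subspace[OF H] .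
  have "card C \<le> vec.dim W" using large C(2) card_n by simp
  then obtain s t :: complex and v where v: "(s, t) \<noteq> (0, 0)" "v \<in> W" "v \<noteq> 0" "\<And>u. u \<in> C \<Longrightarrow> s * f v u + t * g v u = 0"
    using pencil_root[OF W(1) C(1) _ W(3) bil_f bil_g] by metis
  have "s * f v w + t * g v w = 0" if "w \<in> H \<union> C" for w using that v(4) perp[OF v(2), of w] by auto
  then have "s * f v u + t * g v u = 0" for u
    using sbil_0_on_span[OF sbil_comb[OF bil_f bil_g], of "H \<union> C" s v t u] C(3) by blast
  moreover have "f v v = 0" "g v v = 0" using v(2) W(2) by (auto simp: base_locus_def)
  ultimately show False using smooth[OF v(3), of s t] v(1) by auto
qed

lemma dim_base_less:
  assumes "vec.subspace W" "W \<subseteq> V"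
  shows "vec.dim W < d"
proof (cases "vec.dim W > 0")
  case True
  then show ?thesis
    using pairing_nondegenerate[OF assms True assms(1)] isotropic_base[OF assms] by simp
qed (use f.d_pos in linarith)

lemma fvI:
  assumes "vec.subspace x" "d \<le> Suc (vec.dim x)" "x \<subseteq> V"
  shows "fv d V x"
  using assms dim_base_less[OF assms(1,3)] by (simp add: fv_def)

lemma fv_kernel:
  assumes "fv d V x" "w \<in> x" "\<forall>u. f w u = 0"
  shows "w = 0"
  using smooth[of w 1 0] assms by (auto simp: fv_def base_locus_def)

lemma same_ruling_fv_unique:
  assumes "same_ruling f L L'" "lagr f d L" "fv d V x" "x \<subseteq> L" "x \<subseteq> L'"
  shows "L = L'"
  using f.same_ruling_unique[OF assms(1,2) fvD(1,2)[OF assms(3)] assms(4,5)] fv_kernel[OF assms(3)] by blast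

lemma same_ruling_fv_exists:
  assumes "lagr f d L" "fv d V x"
  shows "\<exists>L'. same_ruling f L L' \<and> x \<subseteq> L'"
proof (rule f.lagr_class_through[OF fvD(1)[OF assms(2)] _ _ assms(1)])
  show "vec.dim x < d" using fvD(2)[OF assms(2)] by simp
qed (use isotropic_base[OF fvD(1,3)[OF assms(2)]] in blast)

lemma lagr_not_base: "lagr f d L \<Longrightarrow> \<not> L \<subseteq> V"
  using dim_base_less lagrD(1,2) by blast

lemma lagr_base_iff: "lagr f d L \<Longrightarrow> v \<in> L \<Longrightarrow> v \<in> V \<longleftrightarrow> g v v = 0"
  by (simp add: lagrD(3) base_locus_def)

text \<open>On \<open>L\<close> the base locus is the zero set of \<open>g\<close>, which vanishes
  on the hyperplane \<open>x\<close>. The second linear factor \<open>\<psi>\<close> cuts out the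
  residual subspace; it is \<open>x\<close> again when \<open>L\<close> is tangent.\<close>

lemma residual_exists:
  assumes L: "lagr f d L" and x: "fv d V x" "x \<subseteq> L"
  shows "\<exists>x'. fv d V x' \<and> L \<inter> V = x \<union> x'"
proof -
  note l = lagrD[OF L]
  have "\<not> L \<subseteq> x" using vec.dim_subset[of L x] l(2) fvD(2)[OF x(1)] by auto
  then obtain a where a: "a \<in> L" "a \<notin> x" by blast
  obtain \<phi> where \<phi>: "lfun \<phi>" "\<And>v. v \<in> x \<Longrightarrow> \<phi> v = 0" "\<phi> a = 1"
    using coordinate_functional[OF fvD(1)[OF x(1)] a(2)] by blast
  have "L = vec.span (insert a x)"
    by (rule lagr_eq_span_insert[OF L x a])
  then have mem: "v \<in> x" if "v \<in> L" "\<phi> v = 0" for v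
    using that span_insert_kernel[OF fvD(1)[OF x(1)] \<phi>, of v] by simp
  have "g v v = 0" if "v \<in> L" "\<phi> v = 0" for v
    using mem[OF that] fvD(3)[OF x(1)] by (auto simp: base_locus_def)
  then obtain \<psi> where \<psi>: "lfun \<psi>" "\<And>v. v \<in> L \<Longrightarrow> g v v = \<phi> v * \<psi> v"
    using factor_through_hyperplane[OF bil_g l(1) \<phi>(1)] by blast
  let ?x' = "{v \<in> L. \<psi> v = 0}"
  have eq: "L \<inter> V = x \<union> ?x'"
    using lagr_base_iff[OF L] \<psi>(2) \<phi>(2) mem x(2) by auto
  have "fv d V ?x'"
    using subspace_lfun[OF l(1) \<psi>(1)] dim_le_dim_kernel[OF l(1) \<psi>(1)] l(2) eq by (intro fvI) auto
  with eq show ?thesis by blast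
qed

text \<open>On the perp of \<open>x\<close> the form factors through two hyperplanes, so at most two maximal isotropic subspaces contain \<open>x\<close>.\<close>
lemma lagr_through_fv:
  assumes x: "fv d V x" and L: "lagr f d L1" "lagr f d L2" "lagr f d L3"
    and sub: "x \<subseteq> L1" "x \<subseteq> L2" "x \<subseteq> L3" and ne: "L1 \<noteq> L2" "L1 \<noteq> L3"
  shows "L2 = L3"
proof -
  let ?P = "{u. \<forall>w\<in>x. f u w = 0}"
  have P: "vec.subspace ?P" using subspace_perp[OF vec.subspace_UNIV bil_f] by simp
  have dP: "vec.dim ?P \<le> Suc d"
    using dim_perp_le[OF fvD(1)[OF x] bil_f] fv_kernel[OF x] card_n fvD(2)[OF x] by fastforce
  have LP: "L \<subseteq> ?P" if "lagr f d L" "x \<subseteq> L" for L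
    using that lagrD(3) by blast
  have "\<not> L2 \<subseteq> L1"
    using lagr_eqI[OF L(2,1)] ne(1) by auto
  then obtain a where a: "a \<in> L2" "a \<notin> L1" by blast
  have PH: "?P = vec.span (insert a L1)"
    using dim_span_insert[OF lagrD(1)[OF L(1)] a(2)] dP lagrD(2)[OF L(1)] LP[OF L(1) sub(1)] LP[OF L(2) sub(2)] a(1) P
    by (intro sym[OF vec.subspace_dim_equal] vec.span_minimal) auto
  obtain \<phi> where \<phi>: "lfun \<phi>" "\<And>v. v \<in> L1 \<Longrightarrow> \<phi> v = 0" "\<phi> a = 1"
    using coordinate_functional[OF lagrD(1)[OF L(1)] a(2)] by blast
  have mem: "v \<in> L1" if v: "v \<in> ?P" "\<phi> v = 0" for v
    using span_insert_kernel[OF lagrD(1)[OF L(1)] \<phi>, of v] v PH by simp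
  obtain \<psi> where \<psi>: "lfun \<psi>" "\<And>v. v \<in> ?P \<Longrightarrow> f v v = \<phi> v * \<psi> v"
    using factor_through_hyperplane[OF bil_f P \<phi>(1)] mem lagrD(3)[OF L(1)] by blast
  have in_or: "L \<subseteq> {v \<in> ?P. \<psi> v = 0}" if "lagr f d L" "x \<subseteq> L" "L1 \<noteq> L" for L
  proof -
    have "L \<subseteq> L1 \<union> {v \<in> ?P. \<psi> v = 0}"
    proof
      fix v assume v: "v \<in> L"
      then have "\<phi> v * \<psi> v = 0" "v \<in> ?P" using \<psi>(2) LP[OF that(1,2)] lagrD(3)[OF that(1) v v] by auto
      then show "v \<in> L1 \<union> {v \<in> ?P. \<psi> v = 0}" using mem by auto
    qed
    moreover have "\<not> L \<subseteq> L1"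
      using lagr_eqI[OF that(1) L(1)] that(3) by auto
    ultimately show ?thesis
      using subspace_subset_Un[OF lagrD(1)[OF that(1)] lagrD(1)[OF L(1)] subspace_lfun[OF P \<psi>(1)]] by blast
  qed
  let ?M = "{v \<in> ?P. \<psi> v = 0}"
  show ?thesis
  proof (cases "\<exists>w\<in>?P. \<psi> w \<noteq> 0")
    case True
    then have "?M \<noteq> ?P" by blast
    then have "vec.dim ?M < vec.dim ?P"
      using vec.subspace_dim_equal[OF subspace_lfun[OF P \<psi>(1)] P] by (metis (no_types, lifting) Collect_restrict linorder_not_le mem_Collect_eq subsetI)
    then have "vec.dim ?M \<le> d" using dP by simp
    then have "L2 = ?M" "L3 = ?M"
      using in_or[OF L(2) sub(2) ne(1)] in_or[OF L(3) sub(3) ne(2)] lagrD[OF L(2)] lagrD[OF L(3)] subspace_lfun[OF P \<psi>(1)]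
      by (simp_all add: vec.subspace_dim_equal)
    then show ?thesis by simp
  next
    case False
    then have "f v v = 0" if "v \<in> ?P" for v
    proof -
      have "\<psi> v = 0" using False that by blast
      then show ?thesis using \<psi>(2)[OF that] by simp
    qed
    then have "vec.dim ?P \<le> d"
      using f.isotropic_dim_le[OF P] isotropic_polarization[OF bil_f P] by blast
    then show ?thesis using PH dim_span_insert[OF lagrD(1)[OF L(1)] a(2)] lagrD(2)[OF L(1)] by simp
  qed
qed

end

section \<open>Quadrilaterals and hexagons\<close>

lemma kernel2:
  assumes "vec.subspace U" "lfun \<alpha>" "lfun \<beta>"
  shows "vec.subspace {v \<in> U. \<alpha> v = 0 \<and> \<beta> v = 0}"
    and "vec.dim U \<le> vec.dim {v \<in> U. \<alpha> v = 0 \<and> \<beta> v = 0} + 2"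
proof -
  let ?K = "{v \<in> U. \<alpha> v = 0}"
  have eq: "{v \<in> U. \<alpha> v = 0 \<and> \<beta> v = 0} = {v \<in> ?K. \<beta> v = 0}" by auto
  have K: "vec.subspace ?K" using assms by (rule_tac subspace_lfun)
  show "vec.subspace {v \<in> U. \<alpha> v = 0 \<and> \<beta> v = 0}"
    unfolding eq using K assms by (rule_tac subspace_lfun)
  show "vec.dim U \<le> vec.dim {v \<in> U. \<alpha> v = 0 \<and> \<beta> v = 0} + 2"
    unfolding eq using dim_le_dim_kernel[OF K assms(3)] dim_le_dim_kernel[OF assms(1,2)] by simp
qed

lemma kernel3:
  assumes "vec.subspace U" "lfun \<alpha>" "lfun \<beta>" "lfun \<gamma>"
  shows "vec.subspace {v \<in> U. \<alpha> v = 0 \<and> \<beta> v = 0 \<and> \<gamma> v = 0}"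
    and "vec.dim U \<le> vec.dim {v \<in> U. \<alpha> v = 0 \<and> \<beta> v = 0 \<and> \<gamma> v = 0} + 3"
proof -
  let ?K = "{v \<in> U. \<alpha> v = 0}"
  have eq: "{v \<in> U. \<alpha> v = 0 \<and> \<beta> v = 0 \<and> \<gamma> v = 0} = {v \<in> ?K. \<beta> v = 0 \<and> \<gamma> v = 0}" by auto
  have K: "vec.subspace ?K" using assms by (rule_tac subspace_lfun)
  show "vec.subspace {v \<in> U. \<alpha> v = 0 \<and> \<beta> v = 0 \<and> \<gamma> v = 0}"
    unfolding eq by (rule kernel2(1)[OF K assms(3,4)])
  show "vec.dim U \<le> vec.dim {v \<in> U. \<alpha> v = 0 \<and> \<beta> v = 0 \<and> \<gamma> v = 0} + 3"
    unfolding eq using kernel2(2)[OF K assms(3,4)] dim_le_dim_kernel[OF assms(1,2)] by simp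
qed

context quadratic_form
begin

lemma lagr_kernel2:
  assumes U: "vec.subspace U" "d + 2 \<le> vec.dim U" and lf: "lfun \<alpha>" "lfun \<beta>"
    and 0: "\<And>v. v \<in> U \<Longrightarrow> \<alpha> v = 0 \<Longrightarrow> \<beta> v = 0 \<Longrightarrow> a v v = 0"
  shows "lagr a d {v \<in> U. \<alpha> v = 0 \<and> \<beta> v = 0}"
proof -
  let ?K = "{v \<in> U. \<alpha> v = 0 \<and> \<beta> v = 0}"
  have K: "vec.subspace ?K" using U(1) lf by (rule kernel2)
  have iso: "\<And>u v. u \<in> ?K \<Longrightarrow> v \<in> ?K \<Longrightarrow> a u v = 0"
    using isotropic_polarization[OF bil K] 0 by blast
  show ?thesis
    using K iso isotropic_dim_le[OF K iso] kernel2(2)[OF U(1) lf] U(2) unfolding lagr_def by auto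
qed

lemma lagr_kernel1:
  assumes U: "vec.subspace U" "d + 1 \<le> vec.dim U" and lf: "lfun \<alpha>"
    and 0: "\<And>v. v \<in> U \<Longrightarrow> \<alpha> v = 0 \<Longrightarrow> a v v = 0"
  shows "lagr a d {v \<in> U. \<alpha> v = 0}"
proof -
  let ?K = "{v \<in> U. \<alpha> v = 0}"
  have K: "vec.subspace ?K" using U(1) lf by (rule subspace_lfun)
  have iso: "\<And>u v. u \<in> ?K \<Longrightarrow> v \<in> ?K \<Longrightarrow> a u v = 0"
    using isotropic_polarization[OF bil K] 0 by blast
  show ?thesis
    using K iso isotropic_dim_le[OF K iso] dim_le_dim_kernel[OF U(1) lf] U(2) unfolding lagr_def by auto
qed

lemma polarization_eq: "2 * a u v = a (u + v) (u + v) - a u u - a v v"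
  using asym[of v u] by (simp add: asim)

text \<open>Meeting in codimension one gives the wrong parity for a common class. If the two
  subspaces coincided, \<open>H\<close> would lie in the perp of a subspace of dimension
  \<open>d\<close>, which has dimension at most \<open>d\<close>.\<close>

lemma not_same_ruling_kernels:
  assumes nd: "\<And>w. \<forall>u. a w u = 0 \<Longrightarrow> w = 0"
    and H: "vec.subspace H" "vec.dim H = d + 1" and lf: "lfun \<alpha>" "lfun \<beta>"
    and eq: "\<And>v. v \<in> H \<Longrightarrow> a v v = \<alpha> v * \<beta> v"
  shows "\<not> same_ruling a {v \<in> H. \<alpha> v = 0} {v \<in> H. \<beta> v = 0}" (is "\<not> same_ruling a ?L ?L'")
proof
  assume same: "same_ruling a ?L ?L'"
  have L: "lagr a d ?L" "lagr a d ?L'" using H lf eq by (auto intro!: lagr_kernel1)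
  have ev: "even (d + vec.dim (?L \<inter> ?L'))"
    using same_ruling_even[OF nd same L(1) L(1)] lagrD(2)[OF L(1)] by simp
  have "?L \<inter> ?L' = {v \<in> ?L. \<beta> v = 0}" by auto
  then have "d \<le> Suc (vec.dim (?L \<inter> ?L'))"
    using dim_le_dim_kernel[OF lagrD(1)[OF L(1)] lf(2)] lagrD(2)[OF L(1)] by simp
  moreover have "vec.dim (?L \<inter> ?L') \<le> d" using vec.dim_subset[of "?L \<inter> ?L'" ?L] lagrD(2)[OF L(1)] by simp
  moreover have "d \<noteq> Suc (vec.dim (?L \<inter> ?L'))"
  proof
    assume "d = Suc (vec.dim (?L \<inter> ?L'))"
    then have "d + vec.dim (?L \<inter> ?L') = 2 * vec.dim (?L \<inter> ?L') + 1" by simp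
    with ev show False by simp
  qed
  ultimately have "vec.dim (?L \<inter> ?L') = d" by simp
  then have "?L \<inter> ?L' = ?L"
    using vec.subspace_dim_equal[OF vec.subspace_inter[OF lagrD(1)[OF L(1)] lagrD(1)[OF L(2)]] lagrD(1)[OF L(1)]]
      lagrD(2)[OF L(1)] by simp
  then have \<beta>: "\<beta> v = 0" if "v \<in> ?L" for v using that by blast
  have "H \<subseteq> {u. \<forall>w\<in>?L. a u w = 0}"
  proof safe
    fix u v assume u: "u \<in> H" and v: "v \<in> H" "\<alpha> v = 0"
    have "\<beta> v = 0" using v \<beta> by blast
    then have "2 * a u v = 0"
      unfolding polarization_eq using eq[OF u] eq[OF v(1)] eq[of "u + v"] u v H(1) lf
      by (simp add: vec.subspace_add lfun_simps)
    then show "a u v = 0" by simp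
  qed
  then have "vec.dim H \<le> vec.dim {u. \<forall>w\<in>?L. a u w = 0}" by (rule vec.dim_subset)
  then show False
    using dim_perp_le[OF lagrD(1)[OF L(1)] bil nd] card_n H(2) lagrD(2)[OF L(1)] by simp
qed

text \<open>All of \<open>U\<close> is perpendicular to the common zeros of the four functionals,
  which bounds these by dimension \<open>d - 2\<close> if the form is nonsingular; so the subspaces
  meet in codimension two. The factor \<open>k\<close> admits the minus sign occurring in
  \<open>g\<close>.\<close>

lemma same_ruling_kernels:
  assumes U: "vec.subspace U" "vec.dim U = d + 2"
    and lf: "lfun \<alpha>" "lfun \<beta>" "lfun \<gamma>" "lfun \<delta>"
    and eq: "\<And>v. v \<in> U \<Longrightarrow> a v v = \<alpha> v * \<beta> v + k * (\<gamma> v * \<delta> v)"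
  shows "same_ruling a {v \<in> U. \<alpha> v = 0 \<and> \<gamma> v = 0} {v \<in> U. \<beta> v = 0 \<and> \<delta> v = 0}" (is "same_ruling a ?L ?L'")
proof (rule same_rulingI)
  show L: "lagr a d ?L" "lagr a d ?L'"
    using U lf eq by (auto intro!: lagr_kernel2)
  assume nd: "\<And>w. \<forall>u. a w u = 0 \<Longrightarrow> w = 0"
  have LL: "vec.subspace (?L \<inter> ?L')" using lagrD(1)[OF L(1)] lagrD(1)[OF L(2)] by (rule vec.subspace_inter)
  have "?L \<inter> ?L' = {v \<in> ?L. \<beta> v = 0 \<and> \<delta> v = 0}" by auto
  then have "d \<le> vec.dim (?L \<inter> ?L') + 2"
    using kernel2(2)[OF lagrD(1)[OF L(1)] lf(2,4)] lagrD(2)[OF L(1)] by simp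
  moreover have "U \<subseteq> {u. \<forall>w\<in>?L \<inter> ?L'. a u w = 0}"
  proof safe
    fix u v assume u: "u \<in> U" and v: "v \<in> U" "\<alpha> v = 0" "\<beta> v = 0" "\<gamma> v = 0" "\<delta> v = 0"
    have "2 * a u v = 0"
      unfolding polarization_eq using eq[OF u] eq[OF v(1)] eq[of "u + v"] u v U(1) lf
      by (simp add: vec.subspace_add lfun_simps)
    then show "a u v = 0" by simp
  qed
  then have "vec.dim U \<le> vec.dim {u. \<forall>w\<in>?L \<inter> ?L'. a u w = 0}" by (rule vec.dim_subset)
  then have "d + 2 + vec.dim (?L \<inter> ?L') \<le> 2 * d"
    using dim_perp_le[OF LL bil nd] card_n U(2) by simp
  ultimately show "vec.dim (?L \<inter> ?L') + 2 = d" by simp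
qed

end

lemma kernel_span_insert:
  assumes "vec.subspace L" "lfun \<phi>" "\<And>v. v \<in> L \<Longrightarrow> \<phi> v = 0" "\<phi> a = 1"
  shows "{v \<in> vec.span (insert a L). \<phi> v = 0} = L"
proof safe
  fix v assume "v \<in> vec.span (insert a L)" "\<phi> v = 0"
  then show "v \<in> L" using span_insert_kernel[OF assms, of v] by simp
qed (use assms(3) in \<open>auto intro: vec.span_base\<close>)

context pencil
begin

lemma pencil_swap: "pencil g f d" "base_locus g f = V"
proof -
  have "pencil f g d" by unfold_locales
  from pencil_transform[OF this, of 0 0 1 1] show "pencil g f d" "base_locus g f = V"
    by (simp_all)
qed

lemma pencil_sum: "pencil (\<lambda>u v. f u v + g u v) f d" "base_locus (\<lambda>u v. f u v + g u v) f = V"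
proof -
  have "pencil f g d" by unfold_locales
  from pencil_transform[OF this, of 1 0 1 1]
  show "pencil (\<lambda>u v. f u v + g u v) f d" "base_locus (\<lambda>u v. f u v + g u v) f = V"
    by simp_all
qed

sublocale g: quadratic_form g d
proof -
  interpret s: pencil g f d by (rule pencil_swap)
  show "quadratic_form g d" by unfold_locales
qed

lemma fv_kernel3:
  assumes U: "vec.subspace U" "d + 2 \<le> vec.dim U" and lf: "lfun \<alpha>" "lfun \<beta>" "lfun \<gamma>"
    and 0: "\<And>v. v \<in> U \<Longrightarrow> \<alpha> v = 0 \<Longrightarrow> \<beta> v = 0 \<Longrightarrow> \<gamma> v = 0 \<Longrightarrow> v \<in> V"
  shows "fv d V {v \<in> U. \<alpha> v = 0 \<and> \<beta> v = 0 \<and> \<gamma> v = 0}"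
  using kernel3[OF U(1) lf] U(2) 0 by (intro fvI) auto

lemma fv_kernel2:
  assumes U: "vec.subspace U" "d + 1 \<le> vec.dim U" and lf: "lfun \<alpha>" "lfun \<beta>"
    and 0: "\<And>v. v \<in> U \<Longrightarrow> \<alpha> v = 0 \<Longrightarrow> \<beta> v = 0 \<Longrightarrow> v \<in> V"
  shows "fv d V {v \<in> U. \<alpha> v = 0 \<and> \<beta> v = 0}"
  using kernel2[OF U(1) lf] U(2) 0 by (intro fvI) auto

lemma fv_kernel1:
  assumes U: "vec.subspace U" "d \<le> vec.dim U" and lf: "lfun \<alpha>"
    and 0: "\<And>v. v \<in> U \<Longrightarrow> \<alpha> v = 0 \<Longrightarrow> v \<in> V"
  shows "fv d V {v \<in> U. \<alpha> v = 0}"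
  using subspace_lfun[OF U(1) lf] dim_le_dim_kernel[OF U(1) lf] U(2) 0 by (intro fvI) auto

text \<open>When \<open>L1\<close>, \<open>L2\<close>, \<open>L3\<close> join \<open>x0\<close> to
  \<open>x3\<close>, this is the relation \<open>(r3 r2 r1)^2 = 1\<close> at \<open>x0\<close> for
  the involutions of a ruling of \<open>f\<close>, of \<open>h\<close> and of \<open>g\<close>, in
  this order.\<close>

definition hexagon_closes :: "'n form \<Rightarrow> (complex ^ 'n) set \<Rightarrow> (complex ^ 'n) set \<Rightarrow>
    (complex ^ 'n) set \<Rightarrow> (complex ^ 'n) set \<Rightarrow> (complex ^ 'n) set \<Rightarrow> bool" where
  "hexagon_closes h L1 L2 L3 x0 x3 \<longleftrightarrow> (\<exists>x4 x5 L4 L5 L6. fv d V x4 \<and> fv d V x5 \<and>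
    same_ruling f L1 L4 \<and> L4 \<inter> V = x3 \<union> x4 \<and> same_ruling h L2 L5 \<and> L5 \<inter> V = x4 \<union> x5 \<and>
    same_ruling g L3 L6 \<and> L6 \<inter> V = x5 \<union> x0)"

text \<open>The subspaces of \<open>F(V)\<close> and of the three quadrics cut out by the coordinate functionals form a cube;
  the hexagon is the path around it that avoids two opposite vertices.\<close>
lemma cube:
  assumes U: "vec.subspace U" "vec.dim U = d + 2"
    and lf: "lfun e1" "lfun e2" "lfun e3" "lfun p1" "lfun p2" "lfun p3"
    and f_eq: "\<And>v. v \<in> U \<Longrightarrow> f v v = e2 v * p2 v + e3 v * p3 v"
    and g_eq: "\<And>v. v \<in> U \<Longrightarrow> g v v = e1 v * p1 v - e2 v * p2 v"
    and L: "L1 = {v \<in> U. p2 v = 0 \<and> p3 v = 0}" "L2 = {v \<in> U. e1 v = 0 \<and> p3 v = 0}"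
      "L3 = {v \<in> U. e1 v = 0 \<and> e2 v = 0}"
    and x: "x0 = {v \<in> U. p1 v = 0 \<and> p2 v = 0 \<and> p3 v = 0}" "x3 = {v \<in> U. e1 v = 0 \<and> e2 v = 0 \<and> e3 v = 0}"
  shows "hexagon_closes (\<lambda>u v. f u v + g u v) L1 L2 L3 x0 x3"
proof -
  interpret h: pencil "\<lambda>u v. f u v + g u v" f d by (rule pencil_sum)
  have V_iff: "v \<in> V \<longleftrightarrow> e2 v * p2 v + e3 v * p3 v = 0 \<and> e1 v * p1 v = e2 v * p2 v" if "v \<in> U" for v
    using f_eq[OF that] g_eq[OF that] by (simp add: base_locus_def)
  have dU: "d + 2 \<le> vec.dim U" using U(2) by simp
  define x4 where "x4 = {v \<in> U. p1 v = 0 \<and> e2 v = 0 \<and> e3 v = 0}"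
  define x5 where "x5 = {v \<in> U. p1 v = 0 \<and> p2 v = 0 \<and> e3 v = 0}"
  define L4 where "L4 = {v \<in> U. e2 v = 0 \<and> e3 v = 0}"
  define L5 where "L5 = {v \<in> U. p1 v = 0 \<and> e3 v = 0}"
  define L6 where "L6 = {v \<in> U. p1 v = 0 \<and> p2 v = 0}"
  have "fv d V x4" "fv d V x5"
    unfolding x4_def x5_def using V_iff by (auto intro!: fv_kernel3[OF U(1) dU] lf)
  moreover have "L4 \<inter> V = x3 \<union> x4" "L5 \<inter> V = x4 \<union> x5" "L6 \<inter> V = x5 \<union> x0"
    unfolding L4_def L5_def L6_def x4_def x5_def x using V_iff by auto
  moreover have "same_ruling f L1 L4"
    unfolding L L4_def by (rule f.same_ruling_kernels[OF U, where k = 1]) (use lf f_eq in auto)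
  \<comment> \<open>The terms \<open>e2 p2\<close> cancel in the sum, which is
    \<open>e1 p1 + e3 p3\<close> on \<open>U\<close>.\<close>
  moreover have "same_ruling (\<lambda>u v. f u v + g u v) L2 L5"
    unfolding L L5_def by (rule h.f.same_ruling_kernels[OF U, where k = 1]) (use lf f_eq g_eq in auto)
  moreover have "same_ruling g L3 L6"
    unfolding L L6_def by (rule g.same_ruling_kernels[OF U, where k = "-1"]) (use lf g_eq in auto)
  ultimately show ?thesis unfolding hexagon_closes_def by blast
qed

lemma lagr_Int_eq:
  assumes L: "lagr f d L1" "lagr g d L2" and x: "fv d V x1" "x1 \<subseteq> L1" "x1 \<subseteq> L2"
  shows "L1 \<inter> L2 = x1"
proof -
  have "L1 \<inter> L2 \<subseteq> V" using L by (auto simp: base_locus_def lagr_def)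
  moreover have "vec.subspace (L1 \<inter> L2)" using L by (auto simp: lagr_def vec.subspace_inter)
  moreover have "d \<le> Suc (vec.dim (L1 \<inter> L2))"
    using vec.dim_subset[of x1 "L1 \<inter> L2"] x fvD(2)[OF x(1)] by simp
  ultimately have "fv d V (L1 \<inter> L2)" by (intro fvI)
  then show ?thesis using fv_eqI[OF x(1)] x by blast
qed

text \<open>Adjacent sides share a subspace of dimension \<open>d - 1\<close>, so both are
  hyperplanes in their span \<open>H\<close>. Hence each form splits on \<open>H\<close> into two
  linear factors, and the outer vertices are common zeros of factors.\<close>

lemma two_sides:
  assumes L: "lagr f d L1" "lagr g d L2"
    and x: "fv d V x0" "fv d V x1" "fv d V x2"
    and LV: "L1 \<inter> V = x0 \<union> x1" "L2 \<inter> V = x1 \<union> x2"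
    and a: "a \<in> L1" "a \<notin> L2"
  obtains H e1 e2 p1 p2 where "H = vec.span (insert a L2)" "vec.dim H = d + 1"
    "lfun e1" "lfun e2" "\<And>v. v \<in> H \<Longrightarrow> f v v = p2 v * e2 v"
    "lfun p1" "\<And>v. v \<in> H \<Longrightarrow> g v v = e1 v * p1 v" "lfun p2"
    "L1 = {v \<in> H. p2 v = 0}" "L2 = {v \<in> H. e1 v = 0}"
    "x0 = {v \<in> H. p1 v = 0 \<and> p2 v = 0}" "x2 = {v \<in> H. e1 v = 0 \<and> e2 v = 0}"
proof -
  note l1 = lagrD[OF L(1)] and l2 = lagrD[OF L(2)]
  have x1L: "L1 \<inter> L2 = x1" using lagr_Int_eq[OF L x(2)] LV by blast
  have "\<not> L2 \<subseteq> L1"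
    using x1L vec.dim_subset[of L2 x1] l2(2) fvD(2)[OF x(2)] by auto
  then obtain c where c: "c \<in> L2" "c \<notin> L1" by blast
  define H where "H = vec.span (insert a L2)"
  have H: "vec.subspace H" unfolding H_def by (rule vec.subspace_span)
  have dH: "vec.dim H = d + 1" unfolding H_def using dim_span_insert[OF l2(1) a(2)] l2(2) by simp
  then have dH': "d + 1 \<le> vec.dim H" by simp
  have sub: "L2 \<subseteq> H" "a \<in> H" unfolding H_def by (auto intro: vec.span_base)
  have "L1 = vec.span (insert a x1)"
    using a x1L by (intro lagr_eq_span_insert[OF L(1) x(2)]) auto
  then have L1H: "L1 \<subseteq> H" using sub x1L by (auto intro!: vec.span_minimal[OF _ H])
  have Hc: "H = vec.span (insert c L1)"
    using dH l1(1,2) H L1H c sub by (intro eq_span_insert) auto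
  obtain e1 where e1: "lfun e1" "\<And>v. v \<in> L2 \<Longrightarrow> e1 v = 0" "e1 a = 1"
    using coordinate_functional[OF l2(1) a(2)] by blast
  obtain p2 where p2: "lfun p2" "\<And>v. v \<in> L1 \<Longrightarrow> p2 v = 0" "p2 c = 1"
    using coordinate_functional[OF l1(1) c(2)] by blast
  have L1_eq: "L1 = {v \<in> H. p2 v = 0}"
    unfolding Hc by (rule sym[OF kernel_span_insert[OF l1(1) p2]])
  have L2_eq: "L2 = {v \<in> H. e1 v = 0}"
    unfolding H_def by (rule sym[OF kernel_span_insert[OF l2(1) e1]])
  obtain e2 where e2: "lfun e2" "\<And>v. v \<in> H \<Longrightarrow> f v v = p2 v * e2 v"
    using factor_through_hyperplane[OF bil_f H p2(1)] l1(3) L1_eq by blast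
  obtain p1 where p1: "lfun p1" "\<And>v. v \<in> H \<Longrightarrow> g v v = e1 v * p1 v"
    using factor_through_hyperplane[OF bil_g H e1(1)] l2(3) L2_eq by blast
  have V_iff: "v \<in> V \<longleftrightarrow> p2 v * e2 v = 0 \<and> e1 v * p1 v = 0" if "v \<in> H" for v
    using e2(2)[OF that] p1(2)[OF that] by (auto simp: base_locus_def)
  have K: "fv d V {v \<in> H. p1 v = 0 \<and> p2 v = 0}" "fv d V {v \<in> H. e1 v = 0 \<and> e2 v = 0}"
    using V_iff by (auto intro!: fv_kernel2[OF H dH'] e1(1) e2(1) p1(1) p2(1))
  have "x1 \<union> x0 = x1 \<union> {v \<in> H. p1 v = 0 \<and> p2 v = 0}"
    using LV(1) x1L V_iff unfolding L1_eq L2_eq by auto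
  then have x0_eq: "x0 = {v \<in> H. p1 v = 0 \<and> p2 v = 0}" using fv_residual_eq x K by blast
  have "x1 \<union> x2 = x1 \<union> {v \<in> H. e1 v = 0 \<and> e2 v = 0}"
    using LV(2) x1L V_iff unfolding L1_eq L2_eq by auto
  then have x2_eq: "x2 = {v \<in> H. e1 v = 0 \<and> e2 v = 0}" using fv_residual_eq x K by blast
  show thesis
    by (rule that[OF H_def dH e1(1) e2 p1 p2(1) L1_eq L2_eq x0_eq x2_eq])
qed

text \<open>The aim is the coordinates of \<open>cube\<close>, with \<open>p3 = \<phi>\<close>. The
  three sides span \<open>U\<close> of dimension \<open>d + 2\<close>; the splitting of
  \<open>f\<close> on \<open>H\<close> is extended to \<open>U\<close> so that the same product
  \<open>e2 p2\<close> can be separated from both forms.\<close>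

lemma hexagon_generic:
  assumes h: "h = (\<lambda>u v. f u v + g u v)"
    and L: "lagr f d L1" "lagr h d L2" "lagr g d L3"
    and x: "fv d V x0" "fv d V x1" "fv d V x2" "fv d V x3"
    and LV: "L1 \<inter> V = x0 \<union> x1" "L2 \<inter> V = x1 \<union> x2" "L3 \<inter> V = x2 \<union> x3"
    and a: "a \<in> L1" "a \<notin> L2" and b: "b \<in> L3" "b \<notin> vec.span (insert a L2)"
  shows "hexagon_closes h L1 L2 L3 x0 x3"
proof -
  interpret h: pencil h f d unfolding h by (rule pencil_sum)
  have hV: "h.V = V" unfolding h by (rule pencil_sum)
  interpret h': pencil f h d by (rule h.pencil_swap)
  have hV': "h'.V = V" using h.pencil_swap hV by simp
  note l2 = lagrD[OF L(2)] and l3 = lagrD[OF L(3)]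
  have x1L: "L1 \<inter> L2 = x1" using h'.lagr_Int_eq[OF L(1,2)] x(2) LV unfolding hV' by blast
  have x2L: "x2 \<subseteq> L2" "x2 \<subseteq> L3" using LV by auto
  obtain H \<epsilon> \<eta> \<pi> \<xi> where H: "H = vec.span (insert a L2)" and dH: "vec.dim H = d + 1"
    and \<epsilon>: "lfun \<epsilon>" and \<eta>: "lfun \<eta>" "\<And>v. v \<in> H \<Longrightarrow> f v v = \<xi> v * \<eta> v" and "lfun \<pi>" "\<And>v. v \<in> H \<Longrightarrow> h v v = \<epsilon> v * \<pi> v"
    and \<xi>: "lfun \<xi>"
    and L1_H: "L1 = {v \<in> H. \<xi> v = 0}" and L2_H: "L2 = {v \<in> H. \<epsilon> v = 0}"
    and "x0 = {v \<in> H. \<pi> v = 0 \<and> \<xi> v = 0}" and x2_H: "x2 = {v \<in> H. \<epsilon> v = 0 \<and> \<eta> v = 0}"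
    by (rule h'.two_sides[OF L(1,2), unfolded hV', OF x(1-3) LV(1,2) a]) (rule that)
  have subH: "vec.subspace H" unfolding H by (rule vec.subspace_span)
  have bH: "b \<notin> H" using b(2) H by simp
  define U where "U = vec.span (insert b H)"
  have U: "vec.subspace U" unfolding U_def by (rule vec.subspace_span)
  have dU: "vec.dim U = d + 2" unfolding U_def using dim_span_insert[OF subH bH] dH by simp
  have dU': "d + 2 \<le> vec.dim U" using dU by simp
  have bU: "b \<in> U" unfolding U_def by (auto intro: vec.span_base)
  obtain \<phi> where \<phi>: "lfun \<phi>" "\<And>v. v \<in> H \<Longrightarrow> \<phi> v = 0" "\<phi> b = 1"
    using coordinate_functional[OF subH bH] by blast
  have H_eq: "H = {v \<in> U. \<phi> v = 0}"
    unfolding U_def by (rule sym[OF kernel_span_insert[OF subH \<phi>]])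
  \<comment> \<open>A multiple of \<open>\<phi>\<close> changes nothing on \<open>H\<close> and
    makes each functional vanish at \<open>b\<close>.\<close>
  define e1 where "e1 v = \<epsilon> v - \<epsilon> b * \<phi> v" for v
  define e2 where "e2 v = \<eta> v - \<eta> b * \<phi> v" for v
  define q where "q v = \<xi> v - \<xi> b * \<phi> v" for v
  have lf: "lfun e1" "lfun e2" "lfun q"
    unfolding e1_def e2_def q_def using \<epsilon> \<eta> \<xi> \<phi> by (auto intro!: lfun_comb)
  have on_b: "e1 b = 0" "e2 b = 0" "q b = 0" using \<phi>(3) by (simp_all add: e1_def e2_def q_def)
  have on_H: "e1 v = \<epsilon> v" "e2 v = \<eta> v" "q v = \<xi> v" if "v \<in> H" for v
    using \<phi>(2)[OF that] by (simp_all add: e1_def e2_def q_def)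
  have g_L2: "g v v = - (q v * e2 v)" if "v \<in> L2" for v
  proof -
    have "v \<in> H" using that L2_H by blast
    then show ?thesis
      using l2(3)[OF that that] \<eta>(2) on_H by (simp add: h eq_neg_iff_add_eq_0 add.commute)
  qed
  have "\<not> L2 \<subseteq> x2" using vec.dim_subset[of L2 x2] l2(2) fvD(2)[OF x(3)] by auto
  then obtain c where c: "c \<in> L2" "e2 c \<noteq> 0" using x2_H L2_H on_H by auto
  \<comment> \<open>On \<open>L2\<close> both \<open>g b\<close> and \<open>e2\<close> vanish on the
    hyperplane \<open>x2\<close>, so they are proportional; \<open>\<kappa>\<close> is the
    ratio.\<close>
  define \<kappa> where "\<kappa> = g b c / e2 c"
  have g_lb: "g b l = \<kappa> * e2 l" if l: "l \<in> L2" for l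
  proof -
    have "l - (e2 l / e2 c) *s c \<in> L2" using l c l2(1) by (simp add: vec.subspace_diff vec.subspace_scale)
    moreover have "e2 (l - (e2 l / e2 c) *s c) = 0" using c(2) lf(2) by (simp add: lfun_simps)
    ultimately have "l - (e2 l / e2 c) *s c \<in> x2" using x2_H L2_H on_H by auto
    then have "g b (l - (e2 l / e2 c) *s c) = 0" using b x2L l3(3) by blast
    then show ?thesis using c by (simp add: g.asim \<kappa>_def)
  qed
  \<comment> \<open>The correction absorbs the cross term \<open>2 * \<phi> v * g b l\<close>, so
    that \<open>g + e2 p2\<close> vanishes on \<open>U\<close> wherever \<open>e1\<close>
    does.\<close>
  define p2 where "p2 v = q v - 2 * \<kappa> * \<phi> v" for v
  have lf_p2: "lfun p2" unfolding p2_def using lf \<phi> by (intro lfun_comb)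
  have p2_H: "p2 v = \<xi> v" if "v \<in> H" for v using on_H[OF that] \<phi>(2)[OF that] by (simp add: p2_def)
  define k where "k u v = (e2 u * p2 v + e2 v * p2 u) / 2" for u v
  have k: "sbil k"
    using lf(2) lf_p2 by (auto simp: sbil_def lfun_def k_def field_simps)
  have k_eq: "k v v = e2 v * p2 v" for v by (simp add: k_def)
  \<comment> \<open>On \<open>H\<close> the product \<open>e2 p2\<close> is the splitting of
    \<open>f\<close>, so on \<open>U\<close> the difference is divisible by \<open>\<phi>\<close>,
    with quotient \<open>e3\<close>.\<close>
  have "1 * f v v + (-1) * k v v = 0" if "v \<in> U" "\<phi> v = 0" for v
    using that \<eta>(2) on_H p2_H H_eq by (auto simp: k_eq)
  then obtain e3 where e3: "lfun e3" "\<And>v. v \<in> U \<Longrightarrow> 1 * f v v + (-1) * k v v = \<phi> v * e3 v"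
    using factor_through_hyperplane[OF sbil_comb[OF bil_f k] U \<phi>(1)] by blast
  have "1 * g v v + 1 * k v v = 0" if v: "v \<in> U" "e1 v = 0" for v
  proof -
    define l where "l = v - \<phi> v *s b"
    have lH: "l \<in> H" using span_insert_kernel[OF subH \<phi>] v(1) by (simp add: l_def U_def)
    have "e1 l = 0" using v(2) lf(1) on_b by (simp add: l_def lfun_simps)
    then have l: "l \<in> L2" using lH L2_H on_H by simp
    have v_eq: "v = l + \<phi> v *s b" by (simp add: l_def)
    have "g v v = g l l + 2 * \<phi> v * g b l"
      using l3(3)[OF b(1) b(1)] g.asym[of l b] by (subst (1 2) v_eq) (simp add: g.asim algebra_simps)
    moreover have "e2 v = e2 l" "q v = q l" using lf on_b by (simp_all add: l_def lfun_simps)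
    ultimately show ?thesis using g_L2[OF l] g_lb[OF l] by (simp add: k_eq p2_def algebra_simps)
  qed
  then obtain p1 where p1: "lfun p1" "\<And>v. v \<in> U \<Longrightarrow> 1 * g v v + 1 * k v v = e1 v * p1 v"
    using factor_through_hyperplane[OF sbil_comb[OF bil_g k] U lf(1)] by blast
  have f_eq: "f v v = e2 v * p2 v + e3 v * \<phi> v" and g_eq: "g v v = e1 v * p1 v - e2 v * p2 v" if "v \<in> U" for v
    using e3(2)[OF that] p1(2)[OF that] by (simp_all add: k_eq algebra_simps)
  have V_iff: "v \<in> V \<longleftrightarrow> e2 v * p2 v + e3 v * \<phi> v = 0 \<and> e1 v * p1 v = e2 v * p2 v" if "v \<in> U" for v
    using f_eq[OF that] g_eq[OF that] by (simp add: base_locus_def)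
  note lfs = lf(1,2) e3(1) p1(1) lf_p2 \<phi>(1)
  have L1_eq: "L1 = {v \<in> U. p2 v = 0 \<and> \<phi> v = 0}" using L1_H p2_H H_eq by auto
  have L2_eq: "L2 = {v \<in> U. e1 v = 0 \<and> \<phi> v = 0}" using L2_H on_H H_eq by auto
  have x2_eq: "x2 = {v \<in> U. e1 v = 0 \<and> \<phi> v = 0 \<and> e2 v = 0}" using x2_H on_H H_eq by auto
  have b_x2: "b \<notin> x2" using bH x2_H by blast
  have L3_eq: "L3 = {v \<in> U. e1 v = 0 \<and> e2 v = 0}"
  proof (rule lagr_eqI[OF L(3)])
    show lag: "lagr g d {v \<in> U. e1 v = 0 \<and> e2 v = 0}"
      using g_eq by (intro g.lagr_kernel2[OF U dU' lf(1,2)]) simp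
    show "L3 \<subseteq> {v \<in> U. e1 v = 0 \<and> e2 v = 0}"
      unfolding lagr_eq_span_insert[OF L(3) x(3) x2L(2) b(1) b_x2] using bU on_b x2_eq
      by (intro vec.span_minimal[OF _ lagrD(1)[OF lag]]) auto
  qed
  have x0_eq: "x0 = {v \<in> U. p1 v = 0 \<and> p2 v = 0 \<and> \<phi> v = 0}"
  proof -
    have "fv d V {v \<in> U. p1 v = 0 \<and> p2 v = 0 \<and> \<phi> v = 0}"
      using V_iff lfs by (intro fv_kernel3[OF U dU']) auto
    moreover have "x1 = {v \<in> U. e1 v = 0 \<and> p2 v = 0 \<and> \<phi> v = 0}"
      using x1L unfolding L1_eq L2_eq by auto
    then have "L1 \<inter> V = x1 \<union> {v \<in> U. p1 v = 0 \<and> p2 v = 0 \<and> \<phi> v = 0}"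
      unfolding L1_eq using V_iff by auto
    then have "x1 \<union> x0 = x1 \<union> {v \<in> U. p1 v = 0 \<and> p2 v = 0 \<and> \<phi> v = 0}"
      using LV(1) by (simp add: Un_commute)
    ultimately show ?thesis using fv_residual_eq x by blast
  qed
  have x3_eq: "x3 = {v \<in> U. e1 v = 0 \<and> e2 v = 0 \<and> e3 v = 0}"
  proof -
    have "fv d V {v \<in> U. e1 v = 0 \<and> e2 v = 0 \<and> e3 v = 0}"
      using V_iff lfs by (intro fv_kernel3[OF U dU']) auto
    moreover have "L3 \<inter> V = x2 \<union> {v \<in> U. e1 v = 0 \<and> e2 v = 0 \<and> e3 v = 0}"
      unfolding L3_eq x2_eq using V_iff by auto
    then have "x2 \<union> x3 = x2 \<union> {v \<in> U. e1 v = 0 \<and> e2 v = 0 \<and> e3 v = 0}"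
      using LV(3) by simp
    ultimately show ?thesis using fv_residual_eq x by blast
  qed
  show ?thesis
    unfolding h by (rule cube[OF U dU lfs f_eq g_eq L1_eq L2_eq L3_eq x0_eq x3_eq])
qed

text \<open>On \<open>L3\<close> the form \<open>g\<close> vanishes, so \<open>f = h\<close> there
  and their splittings give the same pair \<open>x2\<close>, \<open>x3\<close>. Either
  \<open>p1\<close> and \<open>p2\<close> both cut out \<open>x3\<close>, which then lies in
  \<open>x0\<close>, or \<open>p2\<close> cuts out \<open>x2\<close>, which smoothness forbids for
  \<open>d > 1\<close>.\<close>

lemma hexagon_flat:
  assumes h: "h = (\<lambda>u v. f u v + g u v)"
    and L: "lagr f d L1" "lagr h d L2" "lagr g d L3"
    and x: "fv d V x0" "fv d V x1" "fv d V x2" "fv d V x3"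
    and LV: "L1 \<inter> V = x0 \<union> x1" "L2 \<inter> V = x1 \<union> x2" "L3 \<inter> V = x2 \<union> x3"
    and a: "a \<in> L1" "a \<notin> L2" and flat: "L3 \<subseteq> vec.span (insert a L2)"
  shows "x3 = x0"
proof -
  interpret h: pencil h f d unfolding h by (rule pencil_sum)
  have hV: "h.V = V" unfolding h by (rule pencil_sum)
  interpret h': pencil f h d by (rule h.pencil_swap)
  have hV': "h'.V = V" using h.pencil_swap hV by simp
  note l2 = lagrD[OF L(2)] and l3 = lagrD[OF L(3)]
  have x2L: "x2 \<subseteq> L2" "x2 \<subseteq> L3" using LV by auto
  obtain H e1 e2 p1 p2 where H: "H = vec.span (insert a L2)" and dH: "vec.dim H = d + 1"
    and e1: "lfun e1" and e2: "lfun e2" "\<And>v. v \<in> H \<Longrightarrow> f v v = p2 v * e2 v"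
    and p1: "lfun p1" "\<And>v. v \<in> H \<Longrightarrow> h v v = e1 v * p1 v" and p2: "lfun p2"
    and "L1 = {v \<in> H. p2 v = 0}" and L2_eq: "L2 = {v \<in> H. e1 v = 0}"
    and x0_eq: "x0 = {v \<in> H. p1 v = 0 \<and> p2 v = 0}" and x2_eq: "x2 = {v \<in> H. e1 v = 0 \<and> e2 v = 0}"
    by (rule h'.two_sides[OF L(1,2), unfolded hV', OF x(1-3) LV(1,2) a]) (rule that)
  have subH: "vec.subspace H" unfolding H by (rule vec.subspace_span)
  have sub: "L3 \<subseteq> H" using flat H by simp
  have V_iff: "v \<in> V \<longleftrightarrow> p2 v * e2 v = 0 \<and> e1 v * p1 v = 0" if "v \<in> H" for v
    using e2(2)[OF that] p1(2)[OF that] by (auto simp: base_locus_def h)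
  have eq_L3: "p2 v * e2 v = e1 v * p1 v" if "v \<in> L3" for v
    using e2(2)[of v] p1(2)[of v] sub that l3(3)[OF that that] by (auto simp: h)
  have d_le: "d \<le> vec.dim L3" using l3(2) by simp
  have V_L3: "v \<in> V \<longleftrightarrow> p2 v * e2 v = 0" "v \<in> V \<longleftrightarrow> e1 v * p1 v = 0" if "v \<in> L3" for v
    using V_iff[of v] eq_L3[OF that] sub that by auto
  let ?K = "\<lambda>\<phi>. {v \<in> L3. \<phi> v = 0}"
  have K: "fv d V (?K p2)" "fv d V (?K e2)" "fv d V (?K e1)" "fv d V (?K p1)"
    using V_L3 by (auto intro!: fv_kernel1[OF l3(1) d_le] e1 e2(1) p1(1) p2)
  have "x2 \<subseteq> ?K e1" using x2L x2_eq by auto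
  then have Ke1: "?K e1 = x2" using fv_eqI[OF x(3) K(3)] by simp
  have LV3: "L3 \<inter> V = ?K e1 \<union> ?K p1" "L3 \<inter> V = ?K p2 \<union> ?K e2"
    using V_L3 by auto
  have "x2 \<union> ?K p1 = x2 \<union> x3" using LV3(1) LV(3) unfolding Ke1 by simp
  then have Kp1: "?K p1 = x3" by (rule fv_residual_eq[OF x(3) K(4) x(4)])
  from LV3(2) LV(3) have "?K p2 \<union> ?K e2 = x2 \<union> x3" by simp
  from fv_Un_eq[OF K(1,2) x(3,4) this]
  consider "?K p2 = x3" | "?K p2 = x2" by blast
  then show ?thesis
  proof cases
    case 1
    then have "x3 \<subseteq> x0" using Kp1 sub unfolding x0_eq by blast
    then show ?thesis using fv_eqI x by blast
  next
    \<comment> \<open>Now \<open>e1\<close>, \<open>e2\<close> and \<open>p2\<close> vanish on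
      \<open>x2\<close>, so \<open>f\<close> pairs \<open>x2\<close> trivially with
      \<open>H\<close>. If \<open>p1\<close> vanishes there too, so does \<open>g\<close>, against
      \<open>pairing_nondegenerate\<close>; otherwise \<open>e1\<close> vanishes on
      \<open>L3\<close> and \<open>L3\<close> would lie on \<open>V\<close>. For
      \<open>d = 1\<close> all vertices are the zero space.\<close>
    case 2
    show ?thesis
    proof (cases "vec.dim x2 > 0")
      case False
      then have "vec.dim x3 = 0" using fvD(2)[OF x(3)] fvD(2)[OF x(4)] by linarith
      then have "x3 \<subseteq> x0" using vec.subspace_0[OF fvD(1)[OF x(1)]] by auto
      then show ?thesis using fv_eqI x by blast
    next
      case True
      have zero: "p2 v = 0" "e2 v = 0" "e1 v = 0" "v \<in> H" "v \<in> L3" if "v \<in> x2" for v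
        using that 2 x2_eq x2L by blast+
      have f0: "f v u = 0" if "v \<in> x2" "u \<in> H" for v u
      proof -
        have "2 * f v u = 0"
          unfolding f.polarization_eq using that zero[OF that(1)] e2 p2 subH
          by (simp add: vec.subspace_add lfun_simps)
        then show ?thesis by simp
      qed
      have h_eq: "2 * h v u = e1 u * p1 v" if "v \<in> x2" "u \<in> H" for v u
        unfolding h.f.polarization_eq using that zero[OF that(1)] p1 e1 subH
        by (simp add: vec.subspace_add lfun_simps algebra_simps)
      have False
      proof (cases "\<exists>v\<in>x2. p1 v \<noteq> 0")
        case True
        then obtain v where v: "v \<in> x2" "p1 v \<noteq> 0" by blast
        have "e1 u = 0" if u: "u \<in> L3" for u
        proof -
          have "g v u = 0" using l3(3) zero(5)[OF v(1)] u by blast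
          then have "h v u = 0" using f0[OF v(1), of u] u sub by (auto simp: h)
          then show ?thesis using h_eq[OF v(1), of u] u sub v(2) by auto
        qed
        then have "L3 \<subseteq> L2" using sub L2_eq by blast
        then have "L3 \<subseteq> V"
          using l2(3) l3(3) unfolding base_locus_def h by fastforce
        then show False using dim_base_less[OF l3(1)] l3(2) by simp
      next
        case False
        have "g v u = 0" if "v \<in> x2" "u \<in> H" for v u
          using f0[OF that] h_eq[OF that] False that(1) by (simp add: h)
        then show False
          using pairing_nondegenerate[OF fvD(1,3)[OF x(3)] True subH] f0 dH fvD(2)[OF x(3)] by simp
      qed
      then show ?thesis ..
    qed
  qed
qed

lemma hexagon:
  assumes h: "h = (\<lambda>u v. f u v + g u v)"
    and L: "lagr f d L1" "lagr h d L2" "lagr g d L3"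
    and x: "fv d V x0" "fv d V x1" "fv d V x2" "fv d V x3"
    and LV: "L1 \<inter> V = x0 \<union> x1" "L2 \<inter> V = x1 \<union> x2" "L3 \<inter> V = x2 \<union> x3"
  shows "hexagon_closes h L1 L2 L3 x0 x3"
proof -
  have "\<not> L1 \<subseteq> L2"
  proof
    assume "L1 \<subseteq> L2"
    then have "L1 \<subseteq> V"
      using lagrD(3)[OF L(1)] lagrD(3)[OF L(2)] unfolding base_locus_def h by fastforce
    then show False using lagr_not_base L(1) by blast
  qed
  then obtain a where a: "a \<in> L1" "a \<notin> L2" by blast
  show ?thesis
  proof (cases "L3 \<subseteq> vec.span (insert a L2)")
    case False
    then obtain b where b: "b \<in> L3" "b \<notin> vec.span (insert a L2)" by blast
    show ?thesis by (rule hexagon_generic[OF h L x LV a b])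
  next
    case True
    have "x3 = x0" by (rule hexagon_flat[OF h L x LV a True])
    \<comment> \<open>The first three sides already close up, and the hexagon runs through them
      twice.\<close>
    have "L1 \<inter> V = x3 \<union> x1" "L3 \<inter> V = x2 \<union> x0" unfolding \<open>x3 = x0\<close> LV by simp_all
    then show ?thesis
      unfolding hexagon_closes_def using x(2,3) LV(2)
      by (intro exI[of _ x1] exI[of _ x2] exI[of _ L1] exI[of _ L2] exI[of _ L3] conjI same_ruling.trivial)
  qed
qed

text \<open>The missing sides are cut out on \<open>H\<close> by the second factors of the two
  forms; the two factors of a nonsingular form belong to opposite rulings. This serves the case
  where a turning ruling belongs to \<open>f\<close> or \<open>g\<close>.\<close>

lemma quadrilateral:
  assumes L: "lagr f d L1" "lagr g d L2"
    and x: "fv d V x0" "fv d V x1" "fv d V x2"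
    and LV: "L1 \<inter> V = x0 \<union> x1" "L2 \<inter> V = x1 \<union> x2"
  obtains x3 L3 L4 where "fv d V x3" "lagr f d L3" "lagr g d L4"
    "L3 \<inter> V = x2 \<union> x3" "L4 \<inter> V = x3 \<union> x0"
    "(\<And>w. \<forall>u. f w u = 0 \<Longrightarrow> w = 0) \<Longrightarrow> \<not> same_ruling f L1 L3"
    "(\<And>w. \<forall>u. g w u = 0 \<Longrightarrow> w = 0) \<Longrightarrow> \<not> same_ruling g L2 L4"
proof -
  have "\<not> L1 \<subseteq> L2"
    using lagr_Int_eq[OF L x(2)] LV vec.dim_subset[of L1 x1] lagrD(2)[OF L(1)] fvD(2)[OF x(2)] by auto
  then obtain a where a: "a \<in> L1" "a \<notin> L2" by blast
  obtain H e1 e2 p1 p2 where H: "H = vec.span (insert a L2)" and dH: "vec.dim H = d + 1"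
    and e1: "lfun e1" and e2: "lfun e2" "\<And>v. v \<in> H \<Longrightarrow> f v v = p2 v * e2 v"
    and p1: "lfun p1" "\<And>v. v \<in> H \<Longrightarrow> g v v = e1 v * p1 v" and p2: "lfun p2"
    and L1_eq: "L1 = {v \<in> H. p2 v = 0}" and L2_eq: "L2 = {v \<in> H. e1 v = 0}"
    and x0_eq: "x0 = {v \<in> H. p1 v = 0 \<and> p2 v = 0}" and x2_eq: "x2 = {v \<in> H. e1 v = 0 \<and> e2 v = 0}"
    by (rule two_sides[OF L x LV a]) (rule that)
  have subH: "vec.subspace H" unfolding H by (rule vec.subspace_span)
  have dH': "d + 1 \<le> vec.dim H" using dH by simp
  have V_iff: "v \<in> V \<longleftrightarrow> p2 v * e2 v = 0 \<and> e1 v * p1 v = 0" if "v \<in> H" for v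
    using e2(2)[OF that] p1(2)[OF that] by (auto simp: base_locus_def)
  show thesis
  proof (rule that)
    show "fv d V {v \<in> H. p1 v = 0 \<and> e2 v = 0}"
      using V_iff by (intro fv_kernel2[OF subH dH' p1(1) e2(1)]) auto
    show "lagr f d {v \<in> H. e2 v = 0}" using e2 by (intro f.lagr_kernel1[OF subH dH']) auto
    show "lagr g d {v \<in> H. p1 v = 0}" using p1 by (intro g.lagr_kernel1[OF subH dH']) auto
    show "{v \<in> H. e2 v = 0} \<inter> V = x2 \<union> {v \<in> H. p1 v = 0 \<and> e2 v = 0}"
      "{v \<in> H. p1 v = 0} \<inter> V = {v \<in> H. p1 v = 0 \<and> e2 v = 0} \<union> x0"
      unfolding x0_eq x2_eq using V_iff by auto
    show "\<not> same_ruling f L1 {v \<in> H. e2 v = 0}" if nd: "\<And>w. \<forall>u. f w u = 0 \<Longrightarrow> w = 0"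
      unfolding L1_eq using f.not_same_ruling_kernels[OF nd subH dH p2 e2] by blast
    show "\<not> same_ruling g L2 {v \<in> H. p1 v = 0}" if nd: "\<And>w. \<forall>u. g w u = 0 \<Longrightarrow> w = 0"
      unfolding L2_eq using g.not_same_ruling_kernels[OF nd subH dH e1 p1] by blast
  qed
qed

end

section \<open>Rulings as involutions of \<open>F(V)\<close>\<close>

definition is_ruling :: "'n::finite form \<Rightarrow> nat \<Rightarrow> (complex ^ 'n) set set \<Rightarrow> bool" where
  "is_ruling a d R \<longleftrightarrow> (\<exists>L. lagr a d L \<and> R = {L'. same_ruling a L L'})"

text \<open>The graph of the involution attached to \<open>R\<close>; a fixed point
  \<open>x = x'\<close> means that the member through \<open>x\<close> is tangent to
  \<open>V\<close>.\<close>

definition ruling_step :: "nat \<Rightarrow> (complex ^ 'n) set \<Rightarrow> (complex ^ 'n) set set \<Rightarrow> (complex ^ 'n) set \<Rightarrow> (complex ^ 'n) set \<Rightarrow> bool" where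
  "ruling_step d V R x x' \<longleftrightarrow> fv d V x \<and> fv d V x' \<and> (\<exists>L\<in>R. L \<inter> V = x \<union> x')"

lemma ruling_step_sym: "ruling_step d V R x x' \<Longrightarrow> ruling_step d V R x' x"
  by (auto simp: ruling_step_def Un_commute)

lemma ruling_step_fv:
  assumes "ruling_step d V R x x'"
  shows "fv d V x" "fv d V x'"
  using assms by (auto simp: ruling_step_def)

lemma same_ruling_scale:
  assumes "k \<noteq> 0"
  shows "same_ruling (\<lambda>u v. k * a u v) = same_ruling a"
proof (intro ext iffI)
  have r: "refl_along (\<lambda>u v. k * a u v) = refl_along a"
    using assms by (auto simp: refl_along_def fun_eq_iff field_simps)
  fix L L'
  show "same_ruling a L L'" if "same_ruling (\<lambda>u v. k * a u v) L L'"
    using that by (induction rule: same_ruling.induct) (auto simp: r intro: same_ruling.intros)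
  show "same_ruling (\<lambda>u v. k * a u v) L L'" if "same_ruling a L L'"
    using that
  proof (induction rule: same_ruling.induct)
    case (double_reflection L L' m m')
    then show ?case
      using same_ruling.double_reflection[of "\<lambda>u v. k * a u v" L L' m m'] assms by (simp add: r)
  qed (rule same_ruling.trivial)
qed

lemma lagr_scale: "k \<noteq> 0 \<Longrightarrow> lagr (\<lambda>u v. k * a u v) d L \<longleftrightarrow> lagr a d L"
  by (auto simp: lagr_def)

context pencil
begin

lemma is_ruling_lagr: "is_ruling f d R \<Longrightarrow> L \<in> R \<Longrightarrow> lagr f d L"
  by (auto simp: is_ruling_def intro: f.same_ruling_lagr)

lemma is_ruling_same: "is_ruling f d R \<Longrightarrow> L \<in> R \<Longrightarrow> L' \<in> R \<longleftrightarrow> same_ruling f L L'"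
  unfolding is_ruling_def by (metis f.same_ruling_sym mem_Collect_eq same_ruling_trans)

lemma is_ruling_exists:
  assumes "is_ruling f d R" "fv d V x"
  obtains L where "L \<in> R" "x \<subseteq> L"
  using assms same_ruling_fv_exists unfolding is_ruling_def by blast

lemma is_ruling_unique:
  assumes R: "is_ruling f d R" and x: "fv d V x" and L: "L \<in> R" "L' \<in> R" "x \<subseteq> L" "x \<subseteq> L'"
  shows "L = L'"
  using same_ruling_fv_unique[OF _ is_ruling_lagr[OF R L(1)] x L(3,4)] is_ruling_same[OF R L(1)] L(2) by blast

lemma ruling_step_exists:
  assumes R: "is_ruling f d R" and x: "fv d V x"
  obtains x' where "ruling_step d V R x x'"
proof -
  obtain L where L: "L \<in> R" "x \<subseteq> L" using is_ruling_exists[OF R x] .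
  then obtain x' where "fv d V x'" "L \<inter> V = x \<union> x'"
    using residual_exists[OF is_ruling_lagr[OF R L(1)] x L(2)] by blast
  then show ?thesis using that x L unfolding ruling_step_def by blast
qed

lemma ruling_step_unique:
  assumes R: "is_ruling f d R" and "ruling_step d V R x x'" "ruling_step d V R x x''"
  shows "x' = x''"
proof -
  obtain L L' where L: "L \<in> R" "L \<inter> V = x \<union> x'" "L' \<in> R" "L' \<inter> V = x \<union> x''"
    using assms by (auto simp: ruling_step_def)
  have x: "fv d V x" "fv d V x'" "fv d V x''" using assms by (auto simp: ruling_step_def)
  have "L = L'" using is_ruling_unique[OF R x(1) L(1,3)] L by blast
  then show ?thesis using fv_residual_eq[OF x] L by auto
qed

lemma member_pencil:
  assumes "(s, t) \<noteq> (0, 0)"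
  obtains c' where "pencil (\<lambda>u v. s * f u v + t * g u v) c' d"
    "base_locus (\<lambda>u v. s * f u v + t * g u v) c' = V"
proof (cases "s = 0")
  case True
  have "pencil f g d" by unfold_locales
  from pencil_transform[OF this, of s 0 t 1] True assms that show thesis by auto
next
  case False
  have "pencil f g d" by unfold_locales
  from pencil_transform[OF this, of s 1 t 0] False that show thesis by auto
qed

text \<open>At most two maximal isotropic subspaces contain \<open>x\<close>, and one of them
  belongs to \<open>R\<close>.\<close>

lemma second_ruling:
  assumes R: "is_ruling f d R" and x: "fv d V x" and L: "lagr f d L" "L \<notin> R" "x \<subseteq> L"
    and L': "lagr f d L'" "x \<subseteq> L'" "L' \<noteq> L"
  shows "L' \<in> R"
proof -
  obtain M where M: "M \<in> R" "x \<subseteq> M" using is_ruling_exists[OF R x] .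
  then have "L \<noteq> M" using L by blast
  then have "L' = M"
    using lagr_through_fv[OF x L(1) L'(1) is_ruling_lagr[OF R M(1)] L(3) L'(2) M(2)] L'(3) by blast
  with M show ?thesis by simp
qed

lemma nondegenerate_if_not_in_ruling:
  assumes R: "is_ruling f d R" and L: "lagr f d L" "L \<notin> R" and w: "\<forall>u. f w u = 0"
  shows "w = 0"
proof (rule ccontr)
  assume "w \<noteq> 0"
  obtain M where "lagr f d M" "R = {L'. same_ruling f M L'}" using R by (auto simp: is_ruling_def)
  then show False using f.same_ruling_degenerate[of M L w] L \<open>w \<noteq> 0\<close> w by auto
qed

lemma in_ruling_if_degenerate:
  assumes "is_ruling f d R" "lagr f d L" "w \<noteq> 0" "\<forall>u. f w u = 0"
  shows "L \<in> R"
  using nondegenerate_if_not_in_ruling[OF assms(1,2)] assms(3,4) by blast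

lemma in_ruling_if_opposite:
  assumes R: "is_ruling f d R" and N: "lagr f d N" "N \<notin> R" and x: "fv d V x"
    and L: "lagr f d L" "x \<subseteq> L" "\<not> same_ruling f N L"
  shows "L \<in> R"
proof -
  obtain M where M: "same_ruling f N M" "x \<subseteq> M" using same_ruling_fv_exists[OF N(1) x] by blast
  have "M \<notin> R" using is_ruling_same[OF R, of M N] M(1) N(2) f.same_ruling_sym by blast
  then show ?thesis
    using second_ruling[OF R x f.same_ruling_lagr[OF M(1) N(1)] _ M(2) L(1,2)] M(1) L(3) by blast
qed

text \<open>Two changes of ruling lead back to \<open>R\<close>. The last two hypotheses are
  conditional in the way \<open>quadrilateral\<close> provides them; on a cone every maximal
  isotropic subspace lies in \<open>R\<close>.\<close>

lemma in_ruling_if_opposite':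
  assumes "is_ruling f d R" "M \<in> R" "lagr f d L4" "lagr f d L" "fv d V x" "x \<subseteq> L"
    and "(\<And>w. \<forall>u. f w u = 0 \<Longrightarrow> w = 0) \<Longrightarrow> \<not> same_ruling f M L4"
    and "(\<And>w. \<forall>u. f w u = 0 \<Longrightarrow> w = 0) \<Longrightarrow> \<not> same_ruling f L4 L"
  shows "L \<in> R"
proof (cases "\<exists>w. w \<noteq> 0 \<and> (\<forall>u. f w u = 0)")
  case True
  then show ?thesis using in_ruling_if_degenerate assms by blast
next
  case False
  then have nd: "\<And>w. \<forall>u. f w u = 0 \<Longrightarrow> w = 0" by blast
  have "L4 \<notin> R" using assms(7)[OF nd] is_ruling_same[OF assms(1,2)] by blast
  then show ?thesis
    using in_ruling_if_opposite[OF assms(1,3) _ assms(5,4,6) assms(8)[OF nd]] by blast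
qed

text \<open>With \<open>T\<close> the step of \<open>R1\<close> followed by that of
  \<open>R2\<close>, \<open>T x0 = x2\<close>, and \<open>N\<close> joining \<open>x2\<close> to
  \<open>x3 = r x2\<close>, this says \<open>T (r (T x0)) = r x0\<close>: the side \<open>N\<close>
  moves back to a side \<open>N0\<close> through \<open>x0\<close>.\<close>

definition transports :: "(complex ^ 'n) set set \<Rightarrow> (complex ^ 'n) set set \<Rightarrow>
    'n form \<Rightarrow> (complex ^ 'n) set \<Rightarrow> (complex ^ 'n) set \<Rightarrow> (complex ^ 'n) set \<Rightarrow> bool" where
  "transports R1 R2 c N x0 x3 \<longleftrightarrow> (\<exists>N0 x4 x5. same_ruling c N N0 \<and> N0 \<inter> V = x5 \<union> x0 \<and>
    ruling_step d V R1 x3 x4 \<and> ruling_step d V R2 x4 x5)"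

text \<open>If \<open>N\<close> belongs to \<open>R1\<close>, the path goes back from
  \<open>x3\<close> through \<open>x2\<close> to \<open>x1\<close>. Otherwise the quadrilateral on
  \<open>L1\<close>, \<open>L2\<close> has \<open>N\<close> as third side, and a second one, on its
  fourth side and \<open>N0\<close>, returns to the rulings \<open>R1\<close> and
  \<open>R2\<close>.\<close>

lemma transports_first:
  assumes R: "is_ruling f d R1" "is_ruling g d R2"
    and st: "ruling_step d V R1 x0 x1" "ruling_step d V R2 x1 x2"
    and N: "lagr f d N" "N \<inter> V = x2 \<union> x3" and x3: "fv d V x3"
  shows "transports R1 R2 f N x0 x3"
proof -
  interpret s: pencil g f d by (rule pencil_swap)
  have sV: "s.V = V" by (rule pencil_swap)
  note x = ruling_step_fv[OF st(1)] ruling_step_fv(2)[OF st(2)]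
  obtain L1 where L1: "L1 \<in> R1" "L1 \<inter> V = x0 \<union> x1" using st by (auto simp: ruling_step_def)
  obtain L2 where L2: "L2 \<in> R2" "L2 \<inter> V = x1 \<union> x2" using st by (auto simp: ruling_step_def)
  have lag: "lagr f d L1" "lagr g d L2"
    using is_ruling_lagr[OF R(1) L1(1)] s.is_ruling_lagr[OF R(2) L2(1)] by auto
  show ?thesis
  proof (cases "N \<in> R1")
    case True
    then have "ruling_step d V R1 x2 x3" using N x x3 by (auto simp: ruling_step_def)
    moreover have "same_ruling f N L1" using is_ruling_same[OF R(1) True] L1 by simp
    ultimately show ?thesis
      unfolding transports_def using L1 st ruling_step_sym by (metis Un_commute)
  next
    case False
    obtain y L3 L4 where Q: "fv d V y" "lagr f d L3" "lagr g d L4" "L3 \<inter> V = x2 \<union> y" "L4 \<inter> V = y \<union> x0"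
      "(\<And>w. \<forall>u. f w u = 0 \<Longrightarrow> w = 0) \<Longrightarrow> \<not> same_ruling f L1 L3"
      "(\<And>w. \<forall>u. g w u = 0 \<Longrightarrow> w = 0) \<Longrightarrow> \<not> same_ruling g L2 L4"
      using quadrilateral[OF lag x L1(2) L2(2)] by blast
    have "L3 \<notin> R1"
      using Q(6) nondegenerate_if_not_in_ruling[OF R(1) N(1) False] is_ruling_same[OF R(1) L1(1)] by blast
    \<comment> \<open>Through \<open>x2\<close> there is only one maximal isotropic subspace outside
      \<open>R1\<close>.\<close>
    then have "L3 = N"
      using second_ruling[OF R(1) x(3) N(1) False _ Q(2)] N(2) Q(4) by blast
    then have "y = x3" using fv_residual_eq[OF x(3) Q(1) x3] Q(4) N(2) by simp
    obtain N0 where N0: "same_ruling f N N0" "x0 \<subseteq> N0" using same_ruling_fv_exists[OF N(1) x(1)] by blast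
    have lagN0: "lagr f d N0" using f.same_ruling_lagr[OF N0(1) N(1)] .
    obtain x5 where x5: "fv d V x5" "N0 \<inter> V = x0 \<union> x5" using residual_exists[OF lagN0 x(1) N0(2)] by blast
    obtain z L5 L6 where Q': "fv d V z" "lagr g d L5" "lagr f d L6" "L5 \<inter> V = x5 \<union> z" "L6 \<inter> V = z \<union> x3"
      "(\<And>w. \<forall>u. g w u = 0 \<Longrightarrow> w = 0) \<Longrightarrow> \<not> same_ruling g L4 L5"
      "(\<And>w. \<forall>u. f w u = 0 \<Longrightarrow> w = 0) \<Longrightarrow> \<not> same_ruling f N0 L6"
      using s.quadrilateral[OF Q(3) lagN0, unfolded sV, OF x3 x(1) x5(1)] Q(5) x5(2) \<open>y = x3\<close> by blast
    have "\<not> same_ruling f N L6"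
      using Q'(7) nondegenerate_if_not_in_ruling[OF R(1) N(1) False] N0(1) f.same_ruling_sym same_ruling_trans by blast
    then have "L6 \<in> R1" using in_ruling_if_opposite[OF R(1) N(1) False x3 Q'(3)] Q'(5) by blast
    moreover have "L5 \<in> R2"
      using s.in_ruling_if_opposite'[OF R(2) L2(1) Q(3) Q'(2), unfolded sV, OF x5(1)] Q'(4,6) Q(7) by blast
    ultimately have "ruling_step d V R1 x3 z" "ruling_step d V R2 z x5"
      using Q'(1,4,5) x3 x5(1) by (auto simp: ruling_step_def)
    then show ?thesis unfolding transports_def using N0 x5 by blast
  qed
qed

text \<open>\<open>transports_first\<close> is applied to the exchanged pencil, the reversed path
  from \<open>x2\<close> to \<open>x0\<close> and the member of the class of \<open>N\<close>
  through \<open>x0\<close>. It returns a member through \<open>x2\<close>, which uniqueness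
  identifies with \<open>N\<close>.\<close>

lemma transports_second:
  assumes R: "is_ruling f d R1" "is_ruling g d R2"
    and st: "ruling_step d V R1 x0 x1" "ruling_step d V R2 x1 x2"
    and N: "lagr g d N" "N \<inter> V = x2 \<union> x3" and x3: "fv d V x3"
  shows "transports R1 R2 g N x0 x3"
proof -
  interpret s: pencil g f d by (rule pencil_swap)
  have sV: "s.V = V" by (rule pencil_swap)
  note x0 = ruling_step_fv(1)[OF st(1)] and x2 = ruling_step_fv(2)[OF st(2)]
  obtain N0 where N0: "same_ruling g N N0" "x0 \<subseteq> N0"
    using s.same_ruling_fv_exists[OF N(1), unfolded sV, OF x0] by blast
  have lagN0: "lagr g d N0" using g.same_ruling_lagr[OF N0(1) N(1)] .
  obtain x5 where x5: "fv d V x5" "N0 \<inter> V = x0 \<union> x5"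
    using s.residual_exists[OF lagN0, unfolded sV, OF x0 N0(2)] by blast
  obtain M x4 y where M: "same_ruling g N0 M" "M \<inter> V = y \<union> x2"
    "ruling_step d V R2 x5 x4" "ruling_step d V R1 x4 y"
    using s.transports_first[OF R(2,1), unfolded sV, OF ruling_step_sym[OF st(2)] ruling_step_sym[OF st(1)] lagN0 x5(2,1)]
    unfolding s.transports_def sV by blast
  have "N = M"
    using s.same_ruling_fv_unique[OF same_ruling_trans[OF M(1) N0(1)] N(1), unfolded sV, OF x2] M(2) N(2) by blast
  then have "y = x3"
    using fv_residual_eq[OF x2 ruling_step_fv(2)[OF M(4)] x3] M(2) N(2) by (metis Un_commute)
  then show ?thesis
    unfolding transports_def using N0(1) x5(2) ruling_step_sym[OF M(3)] ruling_step_sym[OF M(4)]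
    by (metis Un_commute)
qed

lemma transports_member:
  assumes R: "is_ruling f d R1" "is_ruling g d R2"
    and st: "ruling_step d V R1 x0 x1" "ruling_step d V R2 x1 x2"
    and c: "(s, t) \<noteq> (0, 0)" "c = (\<lambda>u v. s * f u v + t * g u v)"
    and N: "lagr c d N" "N \<inter> V = x2 \<union> x3" and x3: "fv d V x3"
  shows "transports R1 R2 c N x0 x3"
proof -
  interpret sw: pencil g f d by (rule pencil_swap)
  consider "t = 0" "s \<noteq> 0" | "s = 0" "t \<noteq> 0" | "s \<noteq> 0" "t \<noteq> 0" using c(1) by auto
  then show ?thesis
  proof cases
    case 1
    then have c': "c = (\<lambda>u v. s * f u v)" using c by simp
    have "transports R1 R2 f N x0 x3"
      using N(1) 1 unfolding c' by (intro transports_first[OF R st _ N(2) x3]) (simp add: lagr_scale)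
    then show ?thesis unfolding c' transports_def using same_ruling_scale[OF 1(2), of f] by simp
  next
    case 2
    then have c': "c = (\<lambda>u v. t * g u v)" using c by simp
    have "transports R1 R2 g N x0 x3"
      using N(1) 2 unfolding c' by (intro transports_second[OF R st _ N(2) x3]) (simp add: lagr_scale)
    then show ?thesis unfolding c' transports_def using same_ruling_scale[OF 2(2), of g] by simp
  next
    case 3
    \<comment> \<open>The scaling gives \<open>t g = f' + c\<close>: the form of the middle side is
      the sum of the other two, as \<open>hexagon\<close> requires.\<close>
    define f' where "f' = (\<lambda>u v. - s * f u v + 0 * g u v)"
    have pf: "pencil f g d" by unfold_locales
    have "- s * t - 0 * s \<noteq> 0" using 3 by simp
    note tr = pencil_transform[OF pf this]
    interpret p: pencil f' c d unfolding f'_def c(2) by (rule tr)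
    have pV: "p.V = V" unfolding f'_def c(2) by (rule tr)
    have f'_eq: "f' = (\<lambda>u v. - s * f u v)" by (simp add: f'_def)
    have sc: "- s \<noteq> 0" using 3 by simp
    have h_eq: "(\<lambda>u v. t * g u v) = (\<lambda>u v. f' u v + c u v)" by (simp add: f'_def c(2))
    note x = ruling_step_fv[OF st(1)] ruling_step_fv(2)[OF st(2)]
    obtain L1 where L1: "L1 \<in> R1" "L1 \<inter> V = x0 \<union> x1" using st by (auto simp: ruling_step_def)
    obtain L2 where L2: "L2 \<in> R2" "L2 \<inter> V = x1 \<union> x2" using st by (auto simp: ruling_step_def)
    have "lagr f' d L1" "lagr (\<lambda>u v. t * g u v) d L2"
      unfolding f'_eq lagr_scale[OF sc] lagr_scale[OF 3(2)]
      using is_ruling_lagr[OF R(1) L1(1)] sw.is_ruling_lagr[OF R(2) L2(1)] by auto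
    from p.hexagon[OF h_eq this N(1), unfolded pV, OF x x3 L1(2) L2(2) N(2)]
    obtain x4 x5 L4 L5 L6 where hx: "fv d V x4" "fv d V x5" "same_ruling f' L1 L4" "L4 \<inter> V = x3 \<union> x4"
      "same_ruling (\<lambda>u v. t * g u v) L2 L5" "L5 \<inter> V = x4 \<union> x5" "same_ruling c N L6" "L6 \<inter> V = x5 \<union> x0"
      unfolding p.hexagon_closes_def pV by blast
    have "L4 \<in> R1" "L5 \<in> R2"
      using hx(3,5) unfolding f'_eq same_ruling_scale[OF sc] same_ruling_scale[OF 3(2)]
      using is_ruling_same[OF R(1) L1(1)] sw.is_ruling_same[OF R(2) L2(1)] by auto
    then have "ruling_step d V R1 x3 x4" "ruling_step d V R2 x4 x5"
      using hx x3 by (auto simp: ruling_step_def)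
    then show ?thesis unfolding transports_def using hx by blast
  qed
qed

end

section \<open>Turning around the pencil\<close>

lemma complement_direct:
  fixes z y :: "(complex ^ 'n) set"
  assumes "vec.subspace z" "vec.subspace y" "z \<subseteq> y"
  obtains W where "vec.subspace W" "W \<subseteq> y" "z \<inter> W \<subseteq> {0}" "vec.dim W + vec.dim z = vec.dim y"
proof -
  obtain C where C: "finite C" "C \<subseteq> y" "card C + vec.dim z = vec.dim y" "vec.span (z \<union> C) = y"
    using complement_in_subspace[OF assms] .
  let ?W = "vec.span C"
  have W: "vec.subspace ?W" by (rule vec.subspace_span)
  have "{u + v |u v. u \<in> z \<and> v \<in> ?W} = y"
    using C(4) unfolding vec.span_Un vec.span_eq_iff[THEN iffD2, OF assms(1)] by blast
  then have "vec.dim y + vec.dim (z \<inter> ?W) = vec.dim z + vec.dim ?W"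
    using vec.dim_sums_Int[OF assms(1) W] by simp
  moreover have "vec.dim ?W \<le> card C" using C(1) by (simp add: vec.dim_le_card vec.span_superset)
  ultimately have "vec.dim (z \<inter> ?W) = 0" "vec.dim ?W + vec.dim z = vec.dim y" using C(3) by linarith+
  moreover have "?W \<subseteq> y" using C(2) assms(2) by (intro vec.span_minimal)
  ultimately show ?thesis using that[of ?W] W by simp
qed

context pencil
begin

text \<open>For distinct \<open>x\<close> and \<open>y\<close> in \<open>F(V)\<close> the pairing of \<open>x\<close> with \<open>y\<close> is degenerate for some member of the pencil; the residual of
  \<open>x\<close> in the isotropic space spanned by \<open>x\<close> and a degenerate vector is closer to \<open>y\<close>.\<close>
lemma step_towards:
  assumes x: "fv d V x" and y: "fv d V y" and ne: "x \<noteq> y"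
  obtains s t N x' where "(s, t) \<noteq> (0, 0)" "lagr (\<lambda>u v. s * f u v + t * g u v) d N"
    "N \<inter> V = x \<union> x'" "fv d V x'" "vec.dim (x \<inter> y) < vec.dim (x' \<inter> y)"
proof -
  note xs = fvD[OF x] and ys = fvD[OF y]
  define z where "z = x \<inter> y"
  have z: "vec.subspace z" unfolding z_def using xs(1) ys(1) by (rule vec.subspace_inter)
  obtain W where W: "vec.subspace W" "W \<subseteq> y" "z \<inter> W \<subseteq> {0}" "vec.dim W + vec.dim z = vec.dim y"
    using complement_direct[OF z ys(1)] by (auto simp: z_def)
  obtain D where D: "finite D" "D \<subseteq> x" "card D + vec.dim z = vec.dim x" "vec.span (z \<union> D) = x"
    using complement_in_subspace[OF z xs(1)] by (auto simp: z_def)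
  have "vec.dim z \<noteq> vec.dim y"
  proof
    assume "vec.dim z = vec.dim y"
    then have "z = y" using vec.subspace_dim_equal[OF z ys(1)] by (simp add: z_def)
    then have "y \<subseteq> x" by (auto simp: z_def)
    then show False using fv_eqI[OF y x] ne by simp
  qed
  then have "vec.dim W > 0" using W(4) by simp
  moreover have "card D \<le> vec.dim W" using W(4) D(3) xs(2) ys(2) by simp
  \<comment> \<open>\<open>D\<close> imposes as many conditions as \<open>W\<close> has dimensions,
    so the pairing has a root. Orthogonality of \<open>v\<close> to \<open>z\<close> is automatic,
    both lying in \<open>y\<close>.\<close>
  ultimately obtain s t :: complex and v where v: "(s, t) \<noteq> (0, 0)" "v \<in> W" "v \<noteq> 0"
    "\<And>u. u \<in> D \<Longrightarrow> s * f v u + t * g v u = 0"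
    using pencil_root[OF W(1) D(1) _ _ bil_f bil_g] by metis
  define c where "c = (\<lambda>u v. s * f u v + t * g u v)"
  have c: "sbil c" unfolding c_def using bil_f bil_g by (rule sbil_comb)
  have vy: "v \<in> y" and vx: "v \<notin> x" using v W by (auto simp: z_def)
  have vV: "c v v = 0" using vy ys(3) by (auto simp: base_locus_def c_def)
  have "c v u = 0" if "u \<in> z" for u
    using isotropic_base[OF ys(1,3) vy] that by (simp add: c_def z_def)
  then have "c v u = 0" if "u \<in> z \<union> D" for u using that v(4) by (auto simp: c_def)
  then have cx: "\<And>u. u \<in> x \<Longrightarrow> c v u = 0" using sbil_0_on_span[OF c, of "z \<union> D" v] D(4) by blast
  let ?N = "vec.span (insert v x)"
  have lag: "lagr c d ?N"
    unfolding lagr_def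
  proof (intro conjI ballI)
    show "vec.dim ?N = d" using dim_span_insert[OF xs(1) vx] xs(2) by simp
    fix u w assume "u \<in> ?N" "w \<in> ?N"
    then obtain k l where kl: "u - k *s v \<in> x" "w - l *s v \<in> x"
      using span_insertE[OF xs(1)] by metis
    define p q where "p = u - k *s v" and "q = w - l *s v"
    have "p \<in> x" "q \<in> x" using kl by (simp_all add: p_def q_def)
    then have "c p q = 0" using isotropic_base[OF xs(1,3)] by (simp add: c_def)
    moreover have "u = p + k *s v" "w = q + l *s v" by (simp_all add: p_def q_def)
    ultimately show "c u w = 0"
      using cx[OF \<open>p \<in> x\<close>] cx[OF \<open>q \<in> x\<close>] vV sbil_sym[OF c, of p v] by (simp add: sbil_simps[OF c])
  qed simp
  obtain c' where p: "pencil c c' d" "base_locus c c' = V"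
    using member_pencil[OF v(1)] unfolding c_def by blast
  interpret p: pencil c c' d by (rule p)
  have xN: "x \<subseteq> ?N" by (auto intro: vec.span_base)
  obtain x' where x': "fv d V x'" "?N \<inter> V = x \<union> x'"
    using p.residual_exists[OF lag, unfolded p(2), OF x xN] by blast
  \<comment> \<open>This subspace lies in \<open>?N\<close> and on \<open>V\<close>, hence in
    \<open>x \<union> x'\<close>. It contains \<open>v\<close>, which is outside \<open>x\<close>,
    so it lies in \<open>x'\<close> and enlarges the intersection with \<open>y\<close>.\<close>
  let ?Y = "vec.span (insert v z)"
  have Yy: "?Y \<subseteq> y" using vy ys(1) by (intro vec.span_minimal) (auto simp: z_def)
  moreover have "?Y \<subseteq> ?N" by (intro vec.span_mono) (auto simp: z_def)
  ultimately have "?Y \<subseteq> x \<union> x'" using x'(2) ys(3) by blast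
  moreover have "v \<in> ?Y" by (auto intro: vec.span_base)
  ultimately have "?Y \<subseteq> x'"
    using subspace_subset_Un[OF vec.subspace_span xs(1) fvD(1)[OF x'(1)]] vx by blast
  with Yy have "vec.dim ?Y \<le> vec.dim (x' \<inter> y)" by (intro vec.dim_subset) auto
  moreover have "vec.dim ?Y = Suc (vec.dim z)" using dim_span_insert[OF z] vx by (auto simp: z_def)
  ultimately have "vec.dim (x \<inter> y) < vec.dim (x' \<inter> y)" by (simp add: z_def)
  with v(1) lag x'(2,1) show thesis unfolding c_def by (rule that)
qed

definition residual :: "(complex ^ 'n) set set \<Rightarrow> (complex ^ 'n) set \<Rightarrow> (complex ^ 'n) set" where
  "residual R x = (THE x'. ruling_step d V R x x')"

lemma residual_eq:
  assumes "is_ruling f d R" "ruling_step d V R x x'"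
  shows "residual R x = x'"
  unfolding residual_def using ruling_step_unique[OF assms(1) _ assms(2)] by (rule the_equality[of "ruling_step d V R x", OF assms(2)])

lemma ruling_step_residual:
  assumes "is_ruling f d R" "fv d V x"
  shows "ruling_step d V R x (residual R x)"
  using ruling_step_exists[OF assms] residual_eq[OF assms(1)] by metis

end

locale ruled_pencil = pencil f g d
  for f g :: "'n::finite form" and d :: nat +
  fixes R1 R2 :: "(complex ^ 'n) set set"
  assumes R1: "is_ruling f d R1" and R2: "is_ruling g d R2"
begin

sublocale swap: pencil g f d
  rewrites "base_locus g f = V"
  by (rule pencil_swap)+

definition turn :: "(complex ^ 'n) set \<Rightarrow> (complex ^ 'n) set" where
  "turn x = swap.residual R2 (residual R1 x)"

lemma turn_steps:
  assumes "fv d V x"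
  shows "ruling_step d V R1 x (residual R1 x)" "ruling_step d V R2 (residual R1 x) (turn x)"
proof -
  show 1: "ruling_step d V R1 x (residual R1 x)" using ruling_step_residual[OF R1 assms] .
  show "ruling_step d V R2 (residual R1 x) (turn x)"
    unfolding turn_def using swap.ruling_step_residual[OF R2 ruling_step_fv(2)[OF 1]] .
qed

lemma turn_eq: "ruling_step d V R1 x x' \<Longrightarrow> ruling_step d V R2 x' x'' \<Longrightarrow> turn x = x''"
  unfolding turn_def using residual_eq[OF R1] swap.residual_eq[OF R2] by metis

lemma fv_turn: "fv d V x \<Longrightarrow> fv d V (turn x)"
  using turn_steps(2) ruling_step_fv(2) by blast

lemma fv_turn_pow: "fv d V x \<Longrightarrow> fv d V ((turn ^^ k) x)"
  by (induction k) (auto intro: fv_turn)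

text \<open>Transporting \<open>N\<close> once around the closed orbit of \<open>x\<close> does not change its ruling, hence not \<open>N\<close>.\<close>
lemma turn_pow_fixed_residual:
  assumes x: "fv d V x" "(turn ^^ n) x = x" and st: "(s, t) \<noteq> (0, 0)"
    and N: "lagr (\<lambda>u v. s * f u v + t * g u v) d N" "N \<inter> V = x \<union> x'" and x': "fv d V x'"
  shows "(turn ^^ n) x' = x'"
proof -
  define c where "c = (\<lambda>u v. s * f u v + t * g u v)"
  obtain c' where p: "pencil c c' d" "base_locus c c' = V"
    using member_pencil[OF st] unfolding c_def by blast
  interpret p: pencil c c' d by (rule p)
  have lagN: "lagr c d N" using N(1) by (simp add: c_def)
  \<comment> \<open>One end of the side runs backwards along the orbit of \<open>x\<close> while the
    other runs forwards along that of \<open>x'\<close>; for \<open>k = n\<close> the first end is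
    back at \<open>x\<close>.\<close>
  have "k \<le> n \<Longrightarrow> \<exists>M. same_ruling c N M \<and> M \<inter> V = (turn ^^ (n - k)) x \<union> (turn ^^ k) x'" for k
  proof (induction k)
    case 0
    then show ?case using x(2) N(2) same_ruling.trivial by (intro exI[of _ N]) auto
  next
    case (Suc k)
    then obtain M where M: "same_ruling c N M" "M \<inter> V = (turn ^^ (n - k)) x \<union> (turn ^^ k) x'" by auto
    define x0 where "x0 = (turn ^^ (n - Suc k)) x"
    have "n - k = Suc (n - Suc k)" using Suc.prems by simp
    then have x2: "(turn ^^ (n - k)) x = turn x0" by (simp add: x0_def)
    have "transports R1 R2 c M x0 ((turn ^^ k) x')"
      using transports_member[OF R1 R2 turn_steps[OF fv_turn_pow[OF x(1)]] st c_def
          p.f.same_ruling_lagr[OF M(1) lagN] _ fv_turn_pow[OF x']] M(2) x2 unfolding x0_def by blast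
    then obtain N0 x4 x5 where T: "same_ruling c M N0" "N0 \<inter> V = x5 \<union> x0"
      "ruling_step d V R1 ((turn ^^ k) x') x4" "ruling_step d V R2 x4 x5"
      unfolding transports_def by blast
    have "x5 = (turn ^^ Suc k) x'" using turn_eq[OF T(3,4)] by simp
    then show ?case
      using T(1,2) M(1) same_ruling_trans x0_def by (intro exI[of _ N0]) auto
  qed
  from this[of n] obtain M where M: "same_ruling c N M" "M \<inter> V = x \<union> (turn ^^ n) x'" by auto
  have "N = M"
    using p.same_ruling_fv_unique[OF M(1) lagN, unfolded p(2), OF x(1)] M(2) N(2) by blast
  then show ?thesis using fv_residual_eq[OF x(1) x' fv_turn_pow[OF x']] M(2) N(2) by metis
qed

theorem turn_pow_fixed:
  assumes "fv d V x" "(turn ^^ n) x = x" and y: "fv d V y"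
  shows "(turn ^^ n) y = y"
  using assms(1,2)
proof (induction "vec.dim y - vec.dim (x \<inter> y)" arbitrary: x rule: less_induct)
  case (less x)
  show ?case
  proof (cases "x = y")
    case True
    then show ?thesis using less.prems by simp
  next
    case False
    obtain s t N x' where N: "(s, t) \<noteq> (0, 0)" "lagr (\<lambda>u v. s * f u v + t * g u v) d N"
      "N \<inter> V = x \<union> x'" "fv d V x'" "vec.dim (x \<inter> y) < vec.dim (x' \<inter> y)"
      using step_towards[OF less.prems(1) y False] .
    have "vec.dim (x' \<inter> y) \<le> vec.dim y" by (intro vec.dim_subset) auto
    then have "vec.dim y - vec.dim (x' \<inter> y) < vec.dim y - vec.dim (x \<inter> y)" using N(5) by linarith
    then show ?thesis
      using less.hyps N(4) turn_pow_fixed_residual[OF less.prems N(1-4)] by blast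
  qed
qed

end

section \<open>Unirational families and rulings\<close>

lemma poly_funs_sum:
  assumes "finite I" "\<And>i. i \<in> I \<Longrightarrow> p i \<in> poly_funs"
  shows "(\<lambda>t. \<Sum>i\<in>I. p i t) \<in> poly_funs"
  using assms by (induction I rule: finite_induct) (auto intro: poly_funs.const poly_funs.add)

lemma poly_funs_prod:
  assumes "finite I" "\<And>i. i \<in> I \<Longrightarrow> p i \<in> poly_funs"
  shows "(\<lambda>t. \<Prod>i\<in>I. p i t) \<in> poly_funs"
  using assms by (induction I rule: finite_induct) (auto intro: poly_funs.const poly_funs.mult)

lemma poly_funs_diff:
  assumes "p \<in> poly_funs" "q \<in> poly_funs"
  shows "(\<lambda>t. p t - q t) \<in> poly_funs"
  using poly_funs.add[OF assms(1) poly_funs.mult[OF poly_funs.const[of "-1"] assms(2)]] by simp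

lemma poly_funs_subst:
  assumes "p \<in> poly_funs" "\<And>i. (\<lambda>t. q t i) \<in> poly_funs"
  shows "(\<lambda>t. p (q t)) \<in> poly_funs"
  using assms by (induction rule: poly_funs.induct) (auto intro: poly_funs.intros)

lemma poly_funs_line:
  assumes "p \<in> poly_funs"
  shows "\<exists>P. \<forall>s. p (\<lambda>i. u i + s * w i) = poly P s"
  using assms
proof (induction rule: poly_funs.induct)
  case (const c)
  show ?case by (intro exI[of _ "[:c:]"]) simp
next
  case (var i)
  show ?case by (intro exI[of _ "[:u i, w i:]"]) simp
next
  case (add p q)
  then obtain P Q where "\<forall>s. p (\<lambda>i. u i + s * w i) = poly P s" "\<forall>s. q (\<lambda>i. u i + s * w i) = poly Q s" by blast
  then show ?case by (intro exI[of _ "P + Q"]) simp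
next
  case (mult p q)
  then obtain P Q where "\<forall>s. p (\<lambda>i. u i + s * w i) = poly P s" "\<forall>s. q (\<lambda>i. u i + s * w i) = poly Q s" by blast
  then show ?case by (intro exI[of _ "P * Q"]) simp
qed

text \<open>Irreducibility of affine space, reduced to one variable: on the line through
  \<open>t0\<close> and \<open>t1\<close> both functions become nonzero polynomials, whose product
  has finitely many roots.\<close>

lemma poly_funs_nonzero_mult:
  assumes p: "p \<in> poly_funs" "p t0 \<noteq> 0" and q: "q \<in> poly_funs" "q t1 \<noteq> 0"
  shows "\<exists>t. p t \<noteq> 0 \<and> q t \<noteq> 0"
proof -
  let ?l = "\<lambda>s i. t0 i + s * (t1 i - t0 i)"
  obtain P where P: "\<And>s. p (?l s) = poly P s" using poly_funs_line[OF p(1), of t0 "\<lambda>i. t1 i - t0 i"] by blast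
  obtain Q where Q: "\<And>s. q (?l s) = poly Q s" using poly_funs_line[OF q(1), of t0 "\<lambda>i. t1 i - t0 i"] by blast
  have "poly P 0 \<noteq> 0" using P[of 0] p(2) by simp
  moreover have "poly Q 1 \<noteq> 0" using Q[of 1] q(2) by simp
  ultimately have "P * Q \<noteq> 0" by auto
  then have "finite {s. poly (P * Q) s = 0}" by (rule poly_roots_finite)
  then obtain s where "poly (P * Q) s \<noteq> 0"
    using infinite_UNIV_char_0[where 'a = complex] by (metis (mono_tags, lifting) UNIV_I ex_new_if_finite mem_Collect_eq)
  then show ?thesis using P[of s] Q[of s] by (intro exI[of _ "?l s"]) auto
qed

definition poly_vec :: "(('v \<Rightarrow> complex) \<Rightarrow> complex ^ 'n) \<Rightarrow> bool" where
  "poly_vec q \<longleftrightarrow> (\<forall>k. (\<lambda>t. q t $ k) \<in> poly_funs)"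

lemma poly_vec_const: "poly_vec (\<lambda>_. v)"
  by (simp add: poly_vec_def poly_funs.const)

lemma poly_vec_add: "poly_vec p \<Longrightarrow> poly_vec q \<Longrightarrow> poly_vec (\<lambda>t. p t + q t)"
  and poly_vec_diff: "poly_vec p \<Longrightarrow> poly_vec q \<Longrightarrow> poly_vec (\<lambda>t. p t - q t)"
  and poly_vec_scale: "r \<in> poly_funs \<Longrightarrow> poly_vec p \<Longrightarrow> poly_vec (\<lambda>t. r t *s p t)"
  by (auto simp: poly_vec_def intro: poly_funs.add poly_funs.mult poly_funs_diff)

lemma zariski_closedI:
  fixes Z :: "(complex ^ 'n) set set" and P :: "((nat \<times> 'n \<Rightarrow> complex) \<Rightarrow> complex) set"
  assumes "Z \<subseteq> lin_subspaces m" "P \<subseteq> poly_funs"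
    "\<And>F. frame_span m F \<in> lin_subspaces m \<Longrightarrow> frame_span m F \<in> Z \<longleftrightarrow> (\<forall>p\<in>P. p (\<lambda>(i, k). F i $ k) = 0)"
  shows "zariski_closed m Z"
  using assms unfolding zariski_closed_def by blast

lemma zariski_closed_subset: "zariski_closed m Z \<Longrightarrow> Z \<subseteq> lin_subspaces m"
  by (simp add: zariski_closed_def)

lemma dim_frame_span_le: "vec.dim (frame_span m F) \<le> m"
proof -
  have "vec.dim (frame_span m F) \<le> card (F ` {..<m})"
    unfolding frame_span_def by (simp add: vec.dim_le_card vec.span_superset)
  also have "\<dots> \<le> m" using card_image_le[of "{..<m}" F] by simp
  finally show ?thesis .
qed

lemma frame_span_surj:
  fixes L :: "(complex ^ 'n) set"
  assumes "L \<in> lin_subspaces m"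
  obtains F where "frame_span m F = L"
proof -
  have L: "vec.subspace L" "vec.dim L = m" using assms by (auto simp: lin_subspaces_def)
  obtain B where B: "B \<subseteq> L" "vec.independent B" "finite B" "vec.span B = L" "card B = vec.dim L"
    using basis_of_subspace[OF L(1)] .
  obtain F where "bij_betw F {0..<card B} B" using ex_bij_betw_nat_finite[OF B(3)] by blast
  then have "F ` {..<m} = B" using B(5) L(2) by (simp add: bij_betw_def lessThan_atLeast0)
  then show ?thesis using that[of F] B(4) by (simp add: frame_span_def)
qed

definition zariski_closure :: "nat \<Rightarrow> (complex ^ 'n) set set \<Rightarrow> (complex ^ 'n) set set" where
  "zariski_closure m I = \<Inter> {Z. zariski_closed m Z \<and> I \<subseteq> Z}"

lemma zariski_closed_lin_subspaces: "zariski_closed m (lin_subspaces m)"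
  by (rule zariski_closedI[where P = "{}"]) auto

lemma zariski_closure_least: "zariski_closed m Z \<Longrightarrow> I \<subseteq> Z \<Longrightarrow> zariski_closure m I \<subseteq> Z"
  by (auto simp: zariski_closure_def)

lemma subset_zariski_closure: "I \<subseteq> zariski_closure m I"
  by (auto simp: zariski_closure_def)

text \<open>The equations of all closed sets containing \<open>I\<close> are collected; the whole
  Grassmannian is one of these sets, so the intersection consists of subspaces of dimension
  \<open>m\<close>.\<close>

lemma zariski_closed_closure:
  fixes I :: "(complex ^ 'n) set set"
  assumes "I \<subseteq> lin_subspaces m"
  shows "zariski_closed m (zariski_closure m I)"
proof -
  let ?C = "{Z. zariski_closed m Z \<and> I \<subseteq> Z}"
  have "\<forall>Z\<in>?C. \<exists>P. P \<subseteq> (poly_funs :: ((nat \<times> 'n \<Rightarrow> complex) \<Rightarrow> complex) set) \<and>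
        (\<forall>F. frame_span m F \<in> lin_subspaces m \<longrightarrow>
          (frame_span m F \<in> Z \<longleftrightarrow> (\<forall>p\<in>P. p (\<lambda>(i, k). F i $ k) = 0)))"
    by (auto simp: zariski_closed_def)
  from bchoice[OF this] obtain P where
    *: "\<forall>Z\<in>?C. P Z \<subseteq> (poly_funs :: ((nat \<times> 'n \<Rightarrow> complex) \<Rightarrow> complex) set) \<and>
        (\<forall>F. frame_span m F \<in> lin_subspaces m \<longrightarrow>
          (frame_span m F \<in> Z \<longleftrightarrow> (\<forall>p\<in>P Z. p (\<lambda>(i, k). F i $ k) = 0)))" by (elim exE)
  have P: "P Z \<subseteq> poly_funs" if "Z \<in> ?C" for Z using bspec[OF * that] by (elim conjE)
  have P': "frame_span m F \<in> Z \<longleftrightarrow> (\<forall>p\<in>P Z. p (\<lambda>(i, k). F i $ k) = 0)"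
    if "Z \<in> ?C" "frame_span m F \<in> lin_subspaces m" for Z F
    using bspec[OF * that(1)] that(2) by (elim conjE allE[where x = F] impE)
  show ?thesis
  proof (rule zariski_closedI)
    show "zariski_closure m I \<subseteq> lin_subspaces m"
      using zariski_closed_lin_subspaces assms by (rule zariski_closure_least)
    show "(\<Union>Z\<in>?C. P Z) \<subseteq> poly_funs" using P by blast
    fix F :: "nat \<Rightarrow> complex ^ 'n"
    assume F: "frame_span m F \<in> lin_subspaces m"
    show "frame_span m F \<in> zariski_closure m I \<longleftrightarrow> (\<forall>p\<in>\<Union>Z\<in>?C. P Z. p (\<lambda>(i, k). F i $ k) = 0)"
      unfolding zariski_closure_def Inter_iff UN_ball_bex_simps using P'[OF _ F] by blast
  qed
qed

lemma frame_span_linear: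
  assumes "Vector_Spaces.linear (*s) (*s) h"
  shows "frame_span m (\<lambda>i. h (F i)) = h ` frame_span m F"
proof -
  interpret Vector_Spaces.linear "(*s)" "(*s)" h by (rule assms)
  show ?thesis by (simp add: frame_span_def span_image[symmetric] image_image)
qed

lemma linear_component:
  fixes h :: "complex ^ 'n \<Rightarrow> complex ^ 'n"
  assumes "Vector_Spaces.linear (*s) (*s) h"
  shows "h v $ k = (\<Sum>l\<in>UNIV. matrix h $ k $ l * v $ l)"
  by (subst matrix_works[OF assms, symmetric]) (simp add: matrix_vector_mult_def)

lemma zariski_closed_vimage:
  fixes h :: "complex ^ 'n \<Rightarrow> complex ^ 'n"
  assumes Z: "zariski_closed m Z" and h: "Vector_Spaces.linear (*s) (*s) h" "inj h"
  shows "zariski_closed m {L \<in> lin_subspaces m. h ` L \<in> Z}"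
proof -
  obtain P where P: "P \<subseteq> (poly_funs :: ((nat \<times> 'n \<Rightarrow> complex) \<Rightarrow> complex) set)"
    "\<And>F. frame_span m F \<in> lin_subspaces m \<Longrightarrow> frame_span m F \<in> Z \<longleftrightarrow> (\<forall>p\<in>P. p (\<lambda>(i, k). F i $ k) = 0)"
    using Z unfolding zariski_closed_def by blast
  \<comment> \<open>The action of \<open>h\<close> on frames in terms of their entries; composing
    with it turns the equations of \<open>Z\<close> into those of the preimage.\<close>
  define T where "T x = (\<lambda>(i, k). \<Sum>l\<in>UNIV. matrix h $ k $ l * x (i, l))" for x :: "nat \<times> 'n \<Rightarrow> complex"
  have T: "T (\<lambda>(i, k). F i $ k) = (\<lambda>(i, k). h (F i) $ k)" for F
    by (auto simp: T_def linear_component[OF h(1)])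
  have T_poly: "(\<lambda>x. T x ik) \<in> poly_funs" for ik
    by (cases ik) (auto simp: T_def intro!: poly_funs_sum poly_funs.mult poly_funs.const poly_funs.var)
  interpret h: Vector_Spaces.linear "(*s)" "(*s)" h by (rule h(1))
  show ?thesis
  proof (rule zariski_closedI)
    show "(\<lambda>p x. p (T x)) ` P \<subseteq> poly_funs"
    proof
      fix q assume "q \<in> (\<lambda>p x. p (T x)) ` P"
      then obtain p where "p \<in> P" and q: "q = (\<lambda>x. p (T x))" by blast
      then have "p \<in> poly_funs" using P(1) by blast
      then show "q \<in> poly_funs" unfolding q using T_poly by (rule poly_funs_subst)
    qed
    fix F :: "nat \<Rightarrow> complex ^ 'n"
    assume F: "frame_span m F \<in> lin_subspaces m"
    have "vec.dim (h ` frame_span m F) = vec.dim (frame_span m F)"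
      using vec.dim_image_eq[OF h(1)] h(2) by (meson inj_on_subset subset_UNIV)
    then have "frame_span m (\<lambda>i. h (F i)) \<in> lin_subspaces m"
      using F h.subspace_image by (auto simp: frame_span_linear[OF h(1)] lin_subspaces_def)
    then show "frame_span m F \<in> {L \<in> lin_subspaces m. h ` L \<in> Z} \<longleftrightarrow>
        (\<forall>p\<in>(\<lambda>p x. p (T x)) ` P. p (\<lambda>(i, k). F i $ k) = 0)"
      using F P(2)[of "\<lambda>i. h (F i)"] by (simp add: frame_span_linear[OF h(1)] T)
  qed auto
qed

lemma unirational_familyE:
  assumes "unirational_family m Z"
  obtains \<phi> :: "(nat \<Rightarrow> complex) \<Rightarrow> nat \<Rightarrow> complex ^ 'n"
  where "\<And>i k. i < m \<Longrightarrow> (\<lambda>t. \<phi> t i $ k) \<in> poly_funs" "rational_image m \<phi> \<noteq> {}" "rational_image m \<phi> \<subseteq> Z"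
    "\<And>Z'. zariski_closed m Z' \<Longrightarrow> rational_image m \<phi> \<subseteq> Z' \<Longrightarrow> Z \<subseteq> Z'"
proof -
  from assms obtain \<phi> :: "(nat \<Rightarrow> complex) \<Rightarrow> nat \<Rightarrow> complex ^ 'n"
    where "\<forall>i<m. \<forall>k. (\<lambda>t. \<phi> t i $ k) \<in> poly_funs" "rational_image m \<phi> \<noteq> {}" "rational_image m \<phi> \<subseteq> Z"
      "\<forall>Z'. zariski_closed m Z' \<and> rational_image m \<phi> \<subseteq> Z' \<longrightarrow> Z \<subseteq> Z'"
    unfolding unirational_family_def by (elim conjE exE)
  then show ?thesis by (intro that[of \<phi>]) simp_all
qed

section \<open>Symmetric matrices as forms, and polynomial reflections\<close>

definition bform :: "complex ^ 'n ^ 'n \<Rightarrow> complex ^ 'n \<Rightarrow> complex ^ 'n \<Rightarrow> complex" where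
  "bform A u v = (\<Sum>i\<in>UNIV. u $ i * (A *v v) $ i)"

lemma bform_expand: "bform A u v = (\<Sum>i\<in>UNIV. \<Sum>j\<in>UNIV. u $ i * (A $ i $ j * v $ j))"
  by (simp add: bform_def matrix_vector_mult_def sum_distrib_left)

lemma qform_bform: "qform A v = bform A v v"
  by (simp add: qform_def bform_def)

lemma sbil_bform:
  assumes "transpose A = A"
  shows "sbil (bform A)"
  unfolding sbil_def lfun_def
proof (intro conjI allI)
  have A: "A $ i $ j = A $ j $ i" for i j
    using arg_cong[OF assms, of "\<lambda>M. M $ j $ i"] by (simp add: transpose_def)
  fix u v w c
  have "bform A u v = (\<Sum>i\<in>UNIV. \<Sum>j\<in>UNIV. v $ j * (A $ j $ i * u $ i))"
    unfolding bform_expand by (intro sum.cong[OF refl]) (use A in \<open>simp add: mult_ac\<close>)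
  also have "\<dots> = bform A v u" unfolding bform_expand by (rule sum.swap)
  finally show "bform A u v = bform A v u" .
  show "bform A u (v + w) = bform A u v + bform A u w"
    by (simp add: bform_def matrix_vector_right_distrib sum.distrib distrib_left)
  show "bform A u (c *s v) = c * bform A u v"
    by (simp add: bform_expand sum_distrib_left mult_ac)
qed

lemma poly_funs_bform:
  assumes "poly_vec p" "poly_vec q"
  shows "(\<lambda>t. bform A (p t) (q t)) \<in> poly_funs"
  using assms unfolding bform_expand poly_vec_def
  by (intro poly_funs_sum poly_funs.mult poly_funs.const) auto

lemma frame_span_isotropic:
  assumes "sbil a"
  shows "(\<forall>v\<in>frame_span m F. a v v = 0) \<longleftrightarrow> (\<forall>i<m. \<forall>j<m. a (F i) (F j) = 0)"
proof (intro iffI allI impI)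
  fix i j assume *: "\<forall>v\<in>frame_span m F. a v v = 0" "i < m" "j < m"
  then have "F i \<in> frame_span m F" "F j \<in> frame_span m F"
    unfolding frame_span_def by (auto intro: vec.span_base)
  then show "a (F i) (F j) = 0"
    using isotropic_polarization[OF assms, of "frame_span m F"] *(1) by (simp add: frame_span_def)
next
  assume *: "\<forall>i<m. \<forall>j<m. a (F i) (F j) = 0"
  have 1: "a (F i) u = 0" if "i < m" "u \<in> frame_span m F" for i u
    using sbil_0_on_span[OF assms, of "F ` {..<m}" "F i"] * that by (auto simp: frame_span_def)
  show "\<forall>v\<in>frame_span m F. a v v = 0"
  proof
    fix v assume v: "v \<in> frame_span m F"
    then have "a v w = 0" if "w \<in> F ` {..<m}" for w using 1 that sbil_sym[OF assms, of v] by auto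
    then show "a v v = 0" using sbil_0_on_span[OF assms, of "F ` {..<m}" v] v by (auto simp: frame_span_def)
  qed
qed

lemma zariski_closed_isotropic:
  assumes "transpose A = A"
  shows "zariski_closed m {L \<in> lin_subspaces m. L \<subseteq> quadric A}"
proof (rule zariski_closedI)
  let ?p = "\<lambda>ij x. bform A (\<chi> k. x (fst ij, k)) (\<chi> k. x (snd ij, k))"
  show "?p ` ({..<m} \<times> {..<m}) \<subseteq> poly_funs"
    by (auto intro!: poly_funs_bform simp: poly_vec_def poly_funs.var)
  fix F :: "nat \<Rightarrow> complex ^ 'a"
  assume "frame_span m F \<in> lin_subspaces m"
  moreover have "frame_span m F \<subseteq> quadric A \<longleftrightarrow> (\<forall>v\<in>frame_span m F. bform A v v = 0)"
    by (auto simp: quadric_def qform_bform)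
  ultimately show "frame_span m F \<in> {L \<in> lin_subspaces m. L \<subseteq> quadric A} \<longleftrightarrow>
      (\<forall>p\<in>?p ` ({..<m} \<times> {..<m}). p (\<lambda>(i, k). F i $ k) = 0)"
    unfolding frame_span_isotropic[OF sbil_bform[OF assms]] by auto
qed auto

lemma scale_image_subspace:
  fixes L :: "(complex ^ 'n) set"
  assumes "vec.subspace L" "c \<noteq> 0"
  shows "(\<lambda>v. c *s v) ` L = L"
proof
  show "(\<lambda>v. c *s v) ` L \<subseteq> L" using assms by (auto intro: vec.subspace_scale)
  show "L \<subseteq> (\<lambda>v. c *s v) ` L"
  proof
    fix v assume "v \<in> L"
    then have "v = c *s ((1 / c) *s v)" "(1 / c) *s v \<in> L" using assms by (auto intro: vec.subspace_scale)
    then show "v \<in> (\<lambda>v. c *s v) ` L" by blast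
  qed
qed

text \<open>The reflection cleared of its denominator, so that it is polynomial in \<open>m\<close>.\<close>
definition scaled_refl :: "(complex ^ 'n \<Rightarrow> complex ^ 'n \<Rightarrow> complex) \<Rightarrow> complex ^ 'n \<Rightarrow> complex ^ 'n \<Rightarrow> complex ^ 'n" where
  "scaled_refl a m v = a m m *s v - (2 * a v m) *s m"

lemma scaled_refl_eq: "a m m \<noteq> 0 \<Longrightarrow> scaled_refl a m v = a m m *s refl_along a m v"
  by (simp add: scaled_refl_def refl_along_def vec_eq_iff algebra_simps)

context quadratic_form
begin

lemma scaled_refl_linear: "Vector_Spaces.linear (*s) (*s) (scaled_refl a m)"
  by unfold_locales (auto simp: scaled_refl_def asim vec_eq_iff algebra_simps)

text \<open>Because \<open>a m m = 0\<close> is included, the polynomial family of scaled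
  reflections keeps isotropic subspaces isotropic at every parameter.\<close>

lemma scaled_refl_similitude: "a (scaled_refl a m v) (scaled_refl a m v) = (a m m)\<^sup>2 * a v v"
  using asym[of m v] by (simp add: scaled_refl_def asim algebra_simps power2_eq_square)

lemma refl_along_subspace: "vec.subspace L \<Longrightarrow> vec.subspace (refl_along a m ` L)"
proof -
  interpret Vector_Spaces.linear "(*s)" "(*s)" "refl_along a m" by (rule refl_along_linear)
  show "vec.subspace L \<Longrightarrow> vec.subspace (refl_along a m ` L)" by (rule subspace_image)
qed

lemma scaled_refl_image:
  assumes "vec.subspace L" "a m m \<noteq> 0"
  shows "scaled_refl a m ` L = refl_along a m ` L"
proof -
  have "scaled_refl a m ` L = (\<lambda>v. a m m *s v) ` refl_along a m ` L"
    using assms(2) by (simp add: scaled_refl_eq image_image)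
  then show ?thesis using scale_image_subspace[OF refl_along_subspace[OF assms(1)] assms(2)] by simp
qed

text \<open>While \<open>L\<close> and \<open>M\<close> share a vector \<open>k\<close>, a
  reflection brings in an isotropic \<open>v\<close> with \<open>a v k \<noteq> 0\<close>. The new
  subspace meets \<open>L\<close> only in vectors of \<open>M\<close> perpendicular to
  \<open>v\<close>, so \<open>k\<close> drops out of the intersection.\<close>

lemma exists_complementary_lagr:
  assumes nd: "\<And>w. \<forall>u. a w u = 0 \<Longrightarrow> w = 0" and L: "lagr a d L"
  shows "lagr a d M0 \<Longrightarrow> \<exists>M. lagr a d M \<and> L \<inter> M \<subseteq> {0}"
proof (induction "vec.dim (L \<inter> M0)" arbitrary: M0 rule: less_induct)
  case (less M)
  note l = lagrD[OF L] and m = lagrD[OF less.prems]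
  show ?case
  proof (cases "L \<inter> M \<subseteq> {0}")
    case True
    then show ?thesis using less.prems by blast
  next
    case False
    then obtain k where k: "k \<in> L" "k \<in> M" "k \<noteq> 0" by blast
    obtain u where u: "a u k \<noteq> 0" using nd[of k] k(3) asym by metis
    \<comment> \<open>The multiple of \<open>k\<close> makes \<open>v\<close> isotropic without
      changing \<open>a v k\<close>.\<close>
    define v where "v = u - (a u u / (2 * a u k)) *s k"
    have kk: "a k k = 0" using k l(3) by blast
    have v: "a v v = 0" "a v k \<noteq> 0" using u kk asym[of k u] by (simp_all add: v_def asim field_simps)
    have "v \<notin> M" using v(2) k(2) m(3) by blast
    obtain q where q: "a q q \<noteq> 0" "v \<in> refl_along a q ` M" "\<And>w. w \<in> M \<Longrightarrow> a w v = 0 \<Longrightarrow> w \<in> refl_along a q ` M"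
      using refl_along_moves_into[OF less.prems v(1) \<open>v \<notin> M\<close>] by blast
    let ?M = "refl_along a q ` M" and ?y = "{w \<in> M. a w v = 0}"
    have lag: "lagr a d ?M" using less.prems q(1) by (rule lagr_refl_along)
    have y: "vec.subspace ?y" using m(1) sbil_lfun_left[OF bil] by (rule subspace_lfun)
    have "?M = vec.span (insert v ?y)"
    proof (rule sym, rule vec.subspace_dim_equal)
      show "vec.span (insert v ?y) \<subseteq> ?M"
        using q lagrD(1)[OF lag] by (intro vec.span_minimal) auto
      have "v \<notin> ?y" using \<open>v \<notin> M\<close> by blast
      then show "vec.dim ?M \<le> vec.dim (vec.span (insert v ?y))"
        using dim_span_insert[OF y] dim_le_dim_kernel[OF m(1) sbil_lfun_left[OF bil, of v]] m(2) lagrD(2)[OF lag] by simp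
    qed (use lagrD(1)[OF lag] in auto)
    have sub: "L \<inter> ?M \<subseteq> L \<inter> ?y"
    proof
      fix w assume w: "w \<in> L \<inter> ?M"
      then have "w \<in> vec.span (insert v ?y)" using \<open>?M = _\<close> by blast
      then obtain c where c: "w - c *s v \<in> ?y" by (rule span_insertE[OF y])
      have "a w k = 0" using w k l(3) by blast
      moreover have "a (w - c *s v) k = 0" using c k m(3) by blast
      ultimately have "c = 0" using v(2) by (simp add: asim)
      then show "w \<in> L \<inter> ?y" using c w by simp
    qed
    have Ly: "vec.subspace (L \<inter> ?y)" and LM: "vec.subspace (L \<inter> M)"
      using l(1) y m(1) by (auto intro: vec.subspace_inter)
    have "k \<notin> ?y" using v(2) asym[of v k] by simp
    then have "L \<inter> ?y \<noteq> L \<inter> M" using k by blast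
    moreover have "L \<inter> ?y \<subseteq> L \<inter> M" by blast
    ultimately have "\<not> vec.dim (L \<inter> M) \<le> vec.dim (L \<inter> ?y)"
      using vec.subspace_dim_equal[OF Ly LM] by blast
    moreover have "vec.dim (L \<inter> ?M) \<le> vec.dim (L \<inter> ?y)" using sub by (rule vec.dim_subset)
    ultimately have "vec.dim (L \<inter> ?M) < vec.dim (L \<inter> M)" by linarith
    then show ?thesis using less.hyps[OF _ lag] by blast
  qed
qed

end

text \<open>\<open>D\<close> is the determinant of the rows of \<open>F\<close> followed by a frame
  of \<open>M\<close>, numbered by \<open>h\<close>. It is nonzero exactly when these
  \<open>2 * d\<close> rows span, which forces \<open>F\<close> to be independent as well.\<close>

lemma (in quadratic_form) complementary_polynomial:
  assumes M: "lagr a d M"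
  obtains D :: "(nat \<times> 'n \<Rightarrow> complex) \<Rightarrow> complex" where "D \<in> poly_funs"
    "\<And>F. D (\<lambda>(i, k). F i $ k) \<noteq> 0 \<longleftrightarrow> frame_span d F \<in> lin_subspaces d \<and> frame_span d F \<inter> M \<subseteq> {0}"
proof -
  have "M \<in> lin_subspaces d" using lagrD(1,2)[OF M] by (simp add: lin_subspaces_def)
  then obtain G where G: "frame_span d G = M" by (rule frame_span_surj)
  obtain h :: "'n \<Rightarrow> nat" where h: "bij_betw h UNIV {0..<2 * d}"
    using ex_bij_betw_finite_nat[of "UNIV :: 'n set"] card_n by auto
  define D where "D x = det (\<chi> r k. if h r < d then x (h r, k) else G (h r - d) $ k)" for x :: "nat \<times> 'n \<Rightarrow> complex"
  show ?thesis
  proof (rule that)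
    have entry: "(\<lambda>x :: nat \<times> 'n \<Rightarrow> complex. if h r < d then x (h r, k) else G (h r - d) $ k) \<in> poly_funs" for r k
      by (cases "h r < d") (auto intro: poly_funs.intros)
    have "(\<lambda>x. D x) \<in> poly_funs"
      unfolding D_def det_def vec_lambda_beta
      by (intro poly_funs_sum poly_funs.mult poly_funs.const poly_funs_prod entry finite_permutations finite)
    then show "D \<in> poly_funs" .
    fix F :: "nat \<Rightarrow> complex ^ 'n"
    let ?A = "\<chi> r k. if h r < d then F (h r) $ k else G (h r - d) $ k"
    have row: "row r ?A = (if h r < d then F (h r) else G (h r - d))" for r
      by (simp add: row_def vec_eq_iff)
    have "rows ?A = (\<lambda>j. if j < d then F j else G (j - d)) ` range h"
      unfolding rows_def row by (auto simp: image_image)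
    also have "\<dots> = (\<lambda>j. if j < d then F j else G (j - d)) ` {0..<2 * d}"
      using h by (simp add: bij_betw_def)
    also have "\<dots> = F ` {..<d} \<union> G ` {..<d}"
    proof (intro equalityI subsetI)
      fix x assume "x \<in> (\<lambda>j. if j < d then F j else G (j - d)) ` {0..<2 * d}"
      then obtain j where j: "j \<in> {0..<2 * d}" "x = (if j < d then F j else G (j - d))" by blast
      then have "j < d \<or> j - d < d" by auto
      then show "x \<in> F ` {..<d} \<union> G ` {..<d}" using j by (cases "j < d") auto
    next
      fix x assume "x \<in> F ` {..<d} \<union> G ` {..<d}"
      then obtain i where i: "i < d" "x = F i \<or> x = G i" by auto
      then show "x \<in> (\<lambda>j. if j < d then F j else G (j - d)) ` {0..<2 * d}"
        using image_eqI[of x "\<lambda>j. if j < d then F j else G (j - d)" i "{0..<2 * d}"]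
          image_eqI[of x "\<lambda>j. if j < d then F j else G (j - d)" "i + d" "{0..<2 * d}"] by auto
    qed
    finally have rows: "rows ?A = F ` {..<d} \<union> G ` {..<d}" .
    have "D (\<lambda>(i, k). F i $ k) \<noteq> 0 \<longleftrightarrow> invertible ?A"
      unfolding invertible_det_nz D_def prod.case ..
    also have "\<dots> \<longleftrightarrow> vec.span (rows ?A) = UNIV"
      unfolding invertible_left_inverse by (rule matrix_left_invertible_span_rows_gen)
    also have "vec.span (rows ?A) = {x + y |x y. x \<in> frame_span d F \<and> y \<in> M}"
      unfolding rows vec.span_Un G[symmetric] frame_span_def ..
    finally have D_iff: "D (\<lambda>(i, k). F i $ k) \<noteq> 0 \<longleftrightarrow> {x + y |x y. x \<in> frame_span d F \<and> y \<in> M} = UNIV" .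
    have sub: "vec.subspace (frame_span d F)" by (simp add: frame_span_def)
    let ?S = "{x + y |x y. x \<in> frame_span d F \<and> y \<in> M}"
    have dims: "vec.dim ?S + vec.dim (frame_span d F \<inter> M) = vec.dim (frame_span d F) + d"
      using vec.dim_sums_Int[OF sub lagrD(1)[OF M]] lagrD(2)[OF M] by simp
    have le: "vec.dim (frame_span d F) \<le> d" by (rule dim_frame_span_le)
    have S: "vec.subspace ?S" using vec.subspace_sums[OF sub lagrD(1)[OF M]] .
    have "?S = UNIV \<longleftrightarrow> vec.dim ?S = 2 * d"
    proof
      show "vec.dim ?S = 2 * d" if "?S = UNIV" unfolding that using card_n vec_dim_card by metis
      show "?S = UNIV" if "vec.dim ?S = 2 * d"
      proof (rule vec.subspace_dim_equal[OF S vec.subspace_UNIV])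
        show "vec.dim (UNIV :: (complex ^ 'n) set) \<le> vec.dim ?S"
          using that card_n by (metis vec_dim_card order_refl)
      qed simp
    qed
    also have "\<dots> \<longleftrightarrow> vec.dim (frame_span d F) = d \<and> vec.dim (frame_span d F \<inter> M) = 0"
      using dims le by linarith
    also have "vec.dim (frame_span d F \<inter> M) = 0 \<longleftrightarrow> frame_span d F \<inter> M \<subseteq> {0}"
      by (rule vec.dim_eq_0)
    finally show "D (\<lambda>(i, k). F i $ k) \<noteq> 0 \<longleftrightarrow> frame_span d F \<in> lin_subspaces d \<and> frame_span d F \<inter> M \<subseteq> {0}"
      unfolding D_iff using sub by (simp add: lin_subspaces_def)
  qed
qed

section \<open>Maximal unirational families as reflection classes\<close>

locale quadric_ruling = quadratic_form "bform A" d
  for A :: "complex ^ 'n ^ 'n" and d :: nat +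
  fixes R :: "(complex ^ 'n) set set"
  assumes symm: "transpose A = A" and ruling: "ruling d (quadric A) R"
begin

lemma lagr_iff: "lagr (bform A) d L \<longleftrightarrow> L \<in> lin_subspaces d \<and> L \<subseteq> quadric A"
proof -
  have "(\<forall>u\<in>L. \<forall>v\<in>L. bform A u v = 0) \<longleftrightarrow> L \<subseteq> quadric A" if "vec.subspace L"
    using isotropic_polarization[OF bil that] unfolding quadric_def qform_bform by blast
  then show ?thesis by (auto simp: lagr_def lin_subspaces_def)
qed

lemma unirational: "unirational_family d R" and ruling_in_quadric: "L \<in> R \<Longrightarrow> L \<subseteq> quadric A"
  and maximal: "unirational_family d R' \<Longrightarrow> (\<And>L. L \<in> R' \<Longrightarrow> L \<subseteq> quadric A) \<Longrightarrow> R \<subseteq> R' \<Longrightarrow> R' = R"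
  using ruling unfolding ruling_def by blast+

lemma ruling_closed: "zariski_closed d R"
  using unirational by (simp add: unirational_family_def)

lemma ruling_lagr: "L \<in> R \<Longrightarrow> lagr (bform A) d L"
  using ruling_in_quadric zariski_closed_subset[OF ruling_closed] lagr_iff by blast

text \<open>Along the polynomial path from \<open>m'\<close> to \<open>m\<close> the scaled double reflections join a homothety to the given double
  reflection. The closure of the family they sweep out is again unirational, so it equals \<open>R\<close> by maximality.\<close>
lemma ruling_double_reflection:
  assumes L: "L \<in> R" and m: "bform A m m \<noteq> 0" and m': "bform A m' m' \<noteq> 0"
  shows "refl_along (bform A) m ` refl_along (bform A) m' ` L \<in> R"
proof -
  let ?a = "bform A"
  obtain \<phi> :: "(nat \<Rightarrow> complex) \<Rightarrow> nat \<Rightarrow> complex ^ 'n"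
    where \<phi>: "\<And>i k. i < d \<Longrightarrow> (\<lambda>t. \<phi> t i $ k) \<in> poly_funs"
    "rational_image d \<phi> \<noteq> {}" "rational_image d \<phi> \<subseteq> R"
    "\<And>Z'. zariski_closed d Z' \<Longrightarrow> rational_image d \<phi> \<subseteq> Z' \<Longrightarrow> R \<subseteq> Z'"
    by (rule unirational_familyE[OF unirational]) (rule that)
  \<comment> \<open>At \<open>s = 0\<close> both factors reflect along \<open>m'\<close> and the
    product is a homothety; at \<open>s = 1\<close> it is the wanted double reflection up to a
    scalar.\<close>
  define g where "g s v = scaled_refl ?a (m' + s *s (m - m')) (scaled_refl ?a m' v)" for s v
  \<comment> \<open>Variable 0 is the path parameter; the shift hands the other variables to
    \<open>\<phi>\<close>.\<close>
  define \<psi> where "\<psi> t i = g (t 0) (\<phi> (\<lambda>n. t (Suc n)) i)" for t :: "nat \<Rightarrow> complex" and i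
  have lin: "Vector_Spaces.linear (*s) (*s) (g s)" for s
    unfolding g_def using Vector_Spaces.linear_compose[OF scaled_refl_linear scaled_refl_linear]
    by (simp add: o_def)
  have span_\<psi>: "frame_span d (\<psi> t) = g (t 0) ` frame_span d (\<phi> (\<lambda>n. t (Suc n)))" for t
    unfolding \<psi>_def by (rule frame_span_linear[OF lin])
  have g0: "g 0 ` L = L" if "vec.subspace L" for L
    using that refl_along_image_self[OF m'] lagr_refl_along
      refl_along_subspace[OF that]
    by (simp add: g_def image_image[symmetric] scaled_refl_image m')
  have g1: "g 1 ` L = refl_along ?a m ` refl_along ?a m' ` L" if "vec.subspace L" for L
    using refl_along_subspace[OF that]
    by (simp add: g_def image_image[symmetric] scaled_refl_image m m' that)
  have poly: "(\<lambda>t. \<psi> t i $ k) \<in> poly_funs" if i: "i < d" for i k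
  proof -
    have shift: "poly_vec (\<lambda>t. \<phi> (\<lambda>n. t (Suc n)) i)"
      unfolding poly_vec_def
      by (intro allI poly_funs_subst[where q = "\<lambda>t n. t (Suc n)", OF \<phi>(1)[OF i]] poly_funs.var)
    have scaled: "poly_vec (\<lambda>t. scaled_refl ?a (p t) (q t))" if "poly_vec p" "poly_vec q" for p q :: "(nat \<Rightarrow> complex) \<Rightarrow> _"
      unfolding scaled_refl_def using that
      by (intro poly_vec_diff poly_vec_scale poly_funs.mult poly_funs.const poly_funs_bform)
    have "poly_vec (\<lambda>t. \<psi> t i)"
      unfolding \<psi>_def g_def
      by (intro scaled shift poly_vec_add poly_vec_scale poly_vec_const poly_funs.var)
    then show ?thesis by (simp add: poly_vec_def)
  qed
  have sub_I: "rational_image d \<phi> \<subseteq> rational_image d \<psi>"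
  proof
    fix K assume K: "K \<in> rational_image d \<phi>"
    then obtain t where t: "K = frame_span d (\<phi> t)" "K \<in> lin_subspaces d" by (auto simp: rational_image_def)
    have "frame_span d (\<psi> (case_nat 0 t)) = K"
      unfolding span_\<psi> using t g0[of K] by (simp add: lin_subspaces_def)
    then show "K \<in> rational_image d \<psi>" using t(2) by (auto simp: rational_image_def)
  qed
  let ?Q = "{K \<in> lin_subspaces d. K \<subseteq> quadric A}"
  have \<psi>_Q: "rational_image d \<psi> \<subseteq> ?Q"
  proof
    fix K assume "K \<in> rational_image d \<psi>"
    then obtain t where t: "K = frame_span d (\<psi> t)" "K \<in> lin_subspaces d" by (auto simp: rational_image_def)
    let ?N = "frame_span d (\<phi> (\<lambda>n. t (Suc n)))"
    have K: "K = g (t 0) ` ?N" using t span_\<psi> by simp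
    \<comment> \<open>An image of full dimension forces the source frame to be independent, so it
      represents a member of \<open>R\<close>.\<close>
    have "d \<le> vec.dim ?N" using vec.dim_image_le[OF lin, of "t 0" ?N] t(2) K by (simp add: lin_subspaces_def)
    moreover have "vec.dim ?N \<le> d" by (rule dim_frame_span_le)
    ultimately have "?N \<in> rational_image d \<phi>"
      by (auto simp: rational_image_def lin_subspaces_def frame_span_def)
    then have "lagr ?a d ?N" using \<phi>(3) ruling_lagr by blast
    then have "?a v v = 0" if "v \<in> K" for v
      using that unfolding K g_def by (auto simp: scaled_refl_similitude dest: lagrD(3))
    then show "K \<in> ?Q" using t(2) by (auto simp: quadric_def qform_bform)
  qed
  define R' where "R' = zariski_closure d (rational_image d \<psi>)"
  have closed: "zariski_closed d R'"
    unfolding R'_def by (rule zariski_closed_closure) (auto simp: rational_image_def)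
  have \<psi>_R': "rational_image d \<psi> \<subseteq> R'" unfolding R'_def by (rule subset_zariski_closure)
  have "unirational_family d R'"
    unfolding unirational_family_def
  proof (intro conjI exI[of _ \<psi>] allI impI)
    show "rational_image d \<psi> \<noteq> {}" using sub_I \<phi>(2) by blast
    fix Z' assume "zariski_closed d Z' \<and> rational_image d \<psi> \<subseteq> Z'"
    then show "R' \<subseteq> Z'" unfolding R'_def using zariski_closure_least by blast
  qed (use closed \<psi>_R' poly in auto)
  moreover have "R' \<subseteq> ?Q"
    unfolding R'_def by (rule zariski_closure_least[OF zariski_closed_isotropic[OF symm] \<psi>_Q])
  moreover have "R \<subseteq> R'" using \<phi>(4)[OF closed] sub_I \<psi>_R' by blast
  ultimately have "R' = R" using maximal by blast
  let ?h = "refl_along ?a m \<circ> refl_along ?a m'"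
  have h: "Vector_Spaces.linear (*s) (*s) ?h" "inj ?h"
    using Vector_Spaces.linear_compose[OF refl_along_linear refl_along_linear]
      refl_along_inj[OF m] refl_along_inj[OF m'] by (auto intro: inj_compose)
  \<comment> \<open>\<open>L\<close> itself may lie outside the image of \<open>\<phi>\<close>. The
    subspaces that \<open>?h\<close> maps into \<open>R\<close> form a closed set containing the
    image, hence all of \<open>R\<close>.\<close>
  have "rational_image d \<phi> \<subseteq> {K \<in> lin_subspaces d. ?h ` K \<in> R}"
  proof
    fix K assume K: "K \<in> rational_image d \<phi>"
    then obtain t where t: "K = frame_span d (\<phi> t)" "K \<in> lin_subspaces d" by (auto simp: rational_image_def)
    have sK: "vec.subspace K" using t(2) by (simp add: lin_subspaces_def)
    have "frame_span d (\<psi> (case_nat 1 t)) = ?h ` K"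
      using t g1[OF sK] by (simp add: span_\<psi> image_comp)
    moreover have "lagr ?a d (?h ` K)"
      using lagr_refl_along[OF lagr_refl_along[OF ruling_lagr m'] m, of K] K \<phi>(3) by (auto simp: image_comp)
    ultimately have "?h ` K \<in> rational_image d \<psi>"
      unfolding rational_image_def lagr_iff by (metis IntI rangeI)
    then show "K \<in> {K \<in> lin_subspaces d. ?h ` K \<in> R}" using t(2) \<psi>_R' \<open>R' = R\<close> by blast
  qed
  then have "R \<subseteq> {K \<in> lin_subspaces d. ?h ` K \<in> R}"
    using \<phi>(4)[OF zariski_closed_vimage[OF ruling_closed h]] by blast
  then show ?thesis using L by (auto simp: image_comp)
qed

lemma ruling_same_ruling: "same_ruling (bform A) L L' \<Longrightarrow> L \<in> R \<Longrightarrow> L' \<in> R"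
  by (induction rule: same_ruling.induct) (auto intro: ruling_double_reflection)

text \<open>If \<open>L'\<close> is the mirror image of \<open>L\<close>, let \<open>M\<close> be complementary to \<open>L\<close> and \<open>M'\<close> its mirror image. A unirational family
  is irreducible, so one of its members would be complementary to both \<open>M\<close> and \<open>M'\<close>, contradicting parity.\<close>
lemma ruling_not_adjacent:
  assumes nd: "\<And>w. \<forall>u. bform A w u = 0 \<Longrightarrow> w = 0"
    and L: "L \<in> R" and L': "L' \<in> R" and dim: "vec.dim (L \<inter> L') + 1 = d"
  shows False
proof -
  let ?a = "bform A"
  have lag: "lagr ?a d L" "lagr ?a d L'" using L L' ruling_lagr by auto
  note l = lagrD[OF lag(1)] and l' = lagrD[OF lag(2)]
  have "\<not> L' \<subseteq> L"
  proof
    assume "L' \<subseteq> L"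
    then have "L \<inter> L' = L'" by blast
    then show False using dim l'(2) by simp
  qed
  then obtain v where v: "v \<in> L'" "v \<notin> L" by blast
  obtain m where m: "?a m m \<noteq> 0" "v \<in> refl_along ?a m ` L"
    "\<And>w. w \<in> L \<Longrightarrow> ?a w v = 0 \<Longrightarrow> w \<in> refl_along ?a m ` L"
    using refl_along_moves_into[OF lag(1) l'(3)[OF v(1) v(1)] v(2)] by blast
  have lagm: "lagr ?a d (refl_along ?a m ` L)" using lagr_refl_along[OF lag(1) m(1)] .
  \<comment> \<open>\<open>L'\<close> and the mirror image of \<open>L\<close> are both spanned by
    \<open>v\<close> and \<open>L \<inter> L'\<close>, so they coincide.\<close>
  let ?S = "vec.span (insert v (L \<inter> L'))"
  have sub: "vec.subspace (L \<inter> L')" using l(1) l'(1) by (rule vec.subspace_inter)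
  have dS: "vec.dim ?S = d" using dim_span_insert[OF sub, of v] v dim by simp
  have S: "?S \<subseteq> L'" "?S \<subseteq> refl_along ?a m ` L"
    using v m l'(3) by (intro vec.span_minimal[OF _ l'(1)] vec.span_minimal[OF _ lagrD(1)[OF lagm]]; blast)+
  then have "?S = L'" "?S = refl_along ?a m ` L"
    using vec.subspace_dim_equal[OF vec.subspace_span l'(1) S(1)]
      vec.subspace_dim_equal[OF vec.subspace_span lagrD(1)[OF lagm] S(2)] dS l'(2) lagrD(2)[OF lagm] by simp_all
  then have L'_eq: "L' = refl_along ?a m ` L" by simp
  obtain M where M: "lagr ?a d M" "L \<inter> M \<subseteq> {0}"
    using exists_complementary_lagr[OF nd lag(1) lag(1)] by blast
  let ?M = "refl_along ?a m ` M"
  have M': "lagr ?a d ?M" using M(1) m(1) by (rule lagr_refl_along)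
  have "refl_along ?a m 0 = 0" by (simp add: refl_along_def asim)
  then have LM': "L' \<inter> ?M \<subseteq> {0}"
    unfolding L'_eq image_Int[OF refl_along_inj[OF m(1)], symmetric] using M(2) by auto
  obtain \<phi> :: "(nat \<Rightarrow> complex) \<Rightarrow> nat \<Rightarrow> complex ^ 'n"
    where \<phi>: "\<And>i k. i < d \<Longrightarrow> (\<lambda>t. \<phi> t i $ k) \<in> poly_funs"
    "rational_image d \<phi> \<noteq> {}" "rational_image d \<phi> \<subseteq> R"
    "\<And>Z'. zariski_closed d Z' \<Longrightarrow> rational_image d \<phi> \<subseteq> Z' \<Longrightarrow> R \<subseteq> Z'"
    by (rule unirational_familyE[OF unirational]) (rule that)
  \<comment> \<open>Only the first \<open>d\<close> vectors are known to be polynomial in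
    \<open>t\<close>; setting the rest to zero makes every entry polynomial.\<close>
  define \<phi>' where "\<phi>' t i = (if i < d then \<phi> t i else 0)" for t i
  have span_eq: "frame_span d (\<phi>' t) = frame_span d (\<phi> t)" for t
    unfolding frame_span_def \<phi>'_def by (intro arg_cong[where f = vec.span] image_cong) auto
  have poly: "(\<lambda>t. \<phi>' t i $ k) \<in> poly_funs" for i k
    using \<phi>(1) by (cases "i < d") (auto simp: \<phi>'_def poly_funs.const)
  \<comment> \<open>If no parameter gave a subspace complementary to \<open>N\<close>, the image
    would lie in the closed set of subspaces meeting \<open>N\<close>, and so would
    \<open>K\<close>.\<close>
  have generic: "\<exists>D. D \<in> poly_funs \<and> (\<exists>t. D t \<noteq> 0) \<and>
      (\<forall>t. D t \<noteq> 0 \<longrightarrow> frame_span d (\<phi> t) \<in> R \<and> frame_span d (\<phi> t) \<inter> N \<subseteq> {0})"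
    if N: "lagr ?a d N" and K: "K \<in> R" "K \<inter> N \<subseteq> {0}" for N K
  proof -
    obtain D where D: "D \<in> poly_funs"
      "\<And>F. D (\<lambda>(i, k). F i $ k) \<noteq> 0 \<longleftrightarrow> frame_span d F \<in> lin_subspaces d \<and> frame_span d F \<inter> N \<subseteq> {0}"
      using complementary_polynomial[OF N] by blast
    define E where "E t = D (\<lambda>(i, k). \<phi>' t i $ k)" for t
    have "E \<in> poly_funs"
      unfolding E_def using D(1)
    proof (rule poly_funs_subst)
      show "(\<lambda>t. (\<lambda>(i, k). \<phi>' t i $ k) ik) \<in> poly_funs" for ik by (cases ik) (simp add: poly)
    qed
    moreover have E: "E t \<noteq> 0 \<longleftrightarrow> frame_span d (\<phi> t) \<in> lin_subspaces d \<and> frame_span d (\<phi> t) \<inter> N \<subseteq> {0}" for t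
      unfolding E_def D(2) span_eq ..
    moreover have "\<exists>t. E t \<noteq> 0"
    proof (rule ccontr)
      assume 0: "\<not> ?thesis"
      let ?Z = "{K \<in> lin_subspaces d. \<not> K \<inter> N \<subseteq> {0}}"
      have "zariski_closed d ?Z"
      proof (rule zariski_closedI[where P = "{D}"])
        fix F :: "nat \<Rightarrow> complex ^ 'n"
        assume "frame_span d F \<in> lin_subspaces d"
        then show "frame_span d F \<in> ?Z \<longleftrightarrow> (\<forall>p\<in>{D}. p (\<lambda>(i, k). F i $ k) = 0)" using D(2)[of F] by blast
      qed (use D(1) in auto)
      moreover have "rational_image d \<phi> \<subseteq> ?Z" using 0 E unfolding rational_image_def by blast
      ultimately have "R \<subseteq> ?Z" by (rule \<phi>(4))
      then show False using K by blast
    qed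
    moreover have "frame_span d (\<phi> t) \<in> R" if "frame_span d (\<phi> t) \<in> lin_subspaces d" for t
      using \<phi>(3) that unfolding rational_image_def by blast
    ultimately show ?thesis by (intro exI[of _ E]) blast
  qed
  obtain D t0 where D: "D \<in> poly_funs" "D t0 \<noteq> 0"
    "\<And>t. D t \<noteq> 0 \<Longrightarrow> frame_span d (\<phi> t) \<in> R \<and> frame_span d (\<phi> t) \<inter> M \<subseteq> {0}"
    using generic[OF M(1) L M(2)] by blast
  obtain D' t1 where D': "D' \<in> poly_funs" "D' t1 \<noteq> 0"
    "\<And>t. D' t \<noteq> 0 \<Longrightarrow> frame_span d (\<phi> t) \<in> R \<and> frame_span d (\<phi> t) \<inter> ?M \<subseteq> {0}"
    using generic[OF M' L' LM'] by blast
  obtain t where "D t \<noteq> 0" "D' t \<noteq> 0" using poly_funs_nonzero_mult[OF D(1,2) D'(1,2)] by blast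
  then have N: "frame_span d (\<phi> t) \<in> R" "frame_span d (\<phi> t) \<inter> M \<subseteq> {0}" "frame_span d (\<phi> t) \<inter> ?M \<subseteq> {0}"
    using D(3) D'(3) by blast+
  have "odd (vec.dim (frame_span d (\<phi> t) \<inter> M) + vec.dim (frame_span d (\<phi> t) \<inter> ?M))"
    using odd_dim_Int_refl_along[OF nd M(1) ruling_lagr[OF N(1)] m(1)] .
  moreover have "vec.dim (frame_span d (\<phi> t) \<inter> M) = 0" "vec.dim (frame_span d (\<phi> t) \<inter> ?M) = 0"
    using N(2,3) by (simp_all only: vec.dim_eq_0)
  ultimately show False by simp
qed

text \<open>In the nonsingular case the class of \<open>L\<close> has a member through a hyperplane
  of \<open>L'\<close>. It lies in \<open>R\<close>, so if it differed from \<open>L'\<close> the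
  two would contradict \<open>ruling_not_adjacent\<close>.\<close>

lemma ruling_is_ruling: "is_ruling (bform A) d R"
proof -
  let ?a = "bform A"
  obtain L where L: "L \<in> R" using unirational_familyE[OF unirational] by (metis subset_empty ex_in_conv)
  have "same_ruling ?a L L'" if L': "L' \<in> R" for L'
  proof (cases "\<exists>k. k \<noteq> 0 \<and> (\<forall>u. ?a k u = 0)")
    case True
    then show ?thesis using same_ruling_degenerate ruling_lagr L L' by blast
  next
    case False
    then have nd: "\<And>w. \<forall>u. ?a w u = 0 \<Longrightarrow> w = 0" by blast
    have lag: "lagr ?a d L'" using L' by (rule ruling_lagr)
    have "\<not> L' \<subseteq> {0}" using lagrD(2)[OF lag] d_pos by (metis not_one_le_zero vec.dim_eq_0)
    then obtain v where v: "v \<in> L'" "v \<noteq> 0" by blast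
    obtain \<phi> where \<phi>: "lfun \<phi>" "\<phi> v = 1" using coordinate_functional[of "{0}" v] v by auto
    let ?x = "{w \<in> L'. \<phi> w = 0}"
    have x: "vec.subspace ?x" using lagrD(1)[OF lag] \<phi>(1) by (rule subspace_lfun)
    have ge: "d \<le> Suc (vec.dim ?x)" using dim_le_dim_kernel[OF lagrD(1)[OF lag] \<phi>(1)] lagrD(2)[OF lag] by simp
    have "v \<notin> ?x" using \<phi>(2) by simp
    then have "?x \<noteq> L'" using v(1) by blast
    then have "\<not> d \<le> vec.dim ?x"
      using vec.subspace_dim_equal[OF x lagrD(1)[OF lag]] lagrD(2)[OF lag] by auto
    then have dx: "vec.dim ?x < d" by simp
    obtain L'' where L'': "same_ruling ?a L L''" "?x \<subseteq> L''"
      using lagr_class_through[OF x _ dx ruling_lagr[OF L]] lagrD(3)[OF lag] by blast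
    have R'': "L'' \<in> R" using ruling_same_ruling[OF L''(1) L] .
    have lag'': "lagr ?a d L''" using R'' by (rule ruling_lagr)
    have "L'' = L'"
    proof (rule ccontr)
      assume "L'' \<noteq> L'"
      have sub: "vec.subspace (L'' \<inter> L')" using lagrD(1)[OF lag''] lagrD(1)[OF lag] by (rule vec.subspace_inter)
      have "vec.dim ?x \<le> vec.dim (L'' \<inter> L')" using L''(2) by (intro vec.dim_subset) auto
      moreover have "\<not> d \<le> vec.dim (L'' \<inter> L')"
        using vec.subspace_dim_equal[OF sub lagrD(1)[OF lag'']] vec.subspace_dim_equal[OF sub lagrD(1)[OF lag]]
          lagrD(2)[OF lag''] lagrD(2)[OF lag] \<open>L'' \<noteq> L'\<close> by auto
      ultimately have "vec.dim (L'' \<inter> L') + 1 = d" using ge by linarith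
      then show False using ruling_not_adjacent[OF nd R'' L'] by blast
    qed
    then show ?thesis using L''(1) by simp
  qed
  then have "R = {L'. same_ruling ?a L L'}" using ruling_same_ruling[OF _ L] by blast
  then show ?thesis unfolding is_ruling_def using ruling_lagr[OF L] by blast
qed

end

section \<open>Closed chains\<close>

context ruled_pencil
begin

text \<open>The chain of \<open>x\<close>: \<open>vertex x j\<close> is the intersection of its members \<open>side x j\<close> and \<open>side x (j + 1)\<close>.\<close>
definition vertex :: "(complex ^ 'n) set \<Rightarrow> nat \<Rightarrow> (complex ^ 'n) set" where
  "vertex x j = (if even j then (turn ^^ (j div 2)) x else residual R1 ((turn ^^ (j div 2)) x))"

definition side :: "(complex ^ 'n) set \<Rightarrow> nat \<Rightarrow> (complex ^ 'n) set" where
  "side x j = (SOME L. L \<in> (if odd j then R1 else R2) \<and> L \<inter> V = vertex x (j - 1) \<union> vertex x j)"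

lemma vertex_0 [simp]: "vertex x 0 = x"
  by (simp add: vertex_def)

lemma vertex_double: "vertex x (2 * k) = (turn ^^ k) x"
  by (simp add: vertex_def)

lemma vertex_step:
  assumes "fv d V x"
  shows "ruling_step d V (if even j then R1 else R2) (vertex x j) (vertex x (Suc j))"
proof (cases "even j")
  case True
  then show ?thesis
    using turn_steps(1)[OF fv_turn_pow[OF assms, of "j div 2"]] by (simp add: vertex_def)
next
  case False
  then obtain k where "j = 2 * k + 1" by (elim oddE)
  then show ?thesis
    using turn_steps(2)[OF fv_turn_pow[OF assms, of k]] by (simp add: vertex_def)
qed

lemma fv_vertex: "fv d V x \<Longrightarrow> fv d V (vertex x j)"
  using vertex_step ruling_step_fv(1) by blast

lemma side:
  assumes "fv d V x" "j \<ge> 1"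
  shows "side x j \<in> (if odd j then R1 else R2)" "side x j \<inter> V = vertex x (j - 1) \<union> vertex x j"
proof -
  have "\<exists>L. L \<in> (if odd j then R1 else R2) \<and> L \<inter> V = vertex x (j - 1) \<union> vertex x j"
    using vertex_step[OF assms(1), of "j - 1"] assms(2) by (auto simp: ruling_step_def split: if_splits)
  from someI_ex[OF this]
  show "side x j \<in> (if odd j then R1 else R2)" "side x j \<inter> V = vertex x (j - 1) \<union> vertex x j"
    unfolding side_def by blast+
qed

lemma vertex_shift: "vertex x (2 * k + j) = vertex ((turn ^^ k) x) j"
proof -
  have half: "(2 * k + j) div 2 = j div 2 + k" by simp
  have "(turn ^^ ((2 * k + j) div 2)) x = (turn ^^ (j div 2)) ((turn ^^ k) x)"
    unfolding half funpow_add by simp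
  then show ?thesis by (simp add: vertex_def)
qed

lemma unique_in_rulings:
  assumes R: "R = R1 \<or> R = R2" and x: "fv d V x" and L: "L \<in> R" "L' \<in> R" "x \<subseteq> L" "x \<subseteq> L'"
  shows "L = L'"
  using R is_ruling_unique[OF R1 x] swap.is_ruling_unique[OF R2 x] L by blast

lemma rulings_disjoint:
  assumes "L \<in> R1" "L' \<in> R2"
  shows "L \<noteq> L'"
proof
  assume "L = L'"
  have "lagr f d L" "lagr g d L'" using is_ruling_lagr[OF R1 assms(1)] swap.is_ruling_lagr[OF R2 assms(2)] .
  then have "L \<subseteq> V" using \<open>L = L'\<close> by (auto simp: base_locus_def lagr_def)
  then show False using lagr_not_base \<open>lagr f d L\<close> by blast
qed

lemma Int_of_rulings:
  assumes "L \<in> R1" "L' \<in> R2" "fv d V x" "x \<subseteq> L" "x \<subseteq> L'"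
  shows "L \<inter> L' = x"
  using lagr_Int_eq[OF is_ruling_lagr[OF R1 assms(1)] swap.is_ruling_lagr[OF R2 assms(2)] assms(3-5)] .

lemma side_Int:
  assumes x: "fv d V x" and j: "j \<ge> 1"
  shows "side x j \<inter> side x (j + 1) = vertex x j"
proof -
  have sub: "vertex x j \<subseteq> side x j" "vertex x j \<subseteq> side x (j + 1)"
    using side(2)[OF x j] side(2)[OF x, of "j + 1"] by auto
  show ?thesis
  proof (cases "odd j")
    case True
    then have "side x j \<in> R1" "side x (j + 1) \<in> R2" using side(1)[OF x j] side(1)[OF x, of "j + 1"] by auto
    then show ?thesis using Int_of_rulings[OF _ _ fv_vertex[OF x]] sub by blast
  next
    case False
    then have "side x j \<in> R2" "side x (j + 1) \<in> R1" using side(1)[OF x j] side(1)[OF x, of "j + 1"] by auto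
    then show ?thesis using Int_of_rulings[OF _ _ fv_vertex[OF x], of "side x (j + 1)" "side x j"] sub by blast
  qed
qed

lemma side_eqI:
  assumes x: "fv d V x" and i: "i \<ge> 1" and L: "L \<in> (if odd i then R1 else R2)" "vertex x (i - 1) \<subseteq> L \<or> vertex x i \<subseteq> L"
  shows "L = side x i"
proof -
  have "(if odd i then R1 else R2) = R1 \<or> (if odd i then R1 else R2) = R2" by simp
  then show ?thesis
    using unique_in_rulings[OF _ fv_vertex[OF x] L(1) side(1)[OF x i]] side(2)[OF x i] L(2) by blast
qed

text \<open>Steps are involutions: the step of the ruling that led from \<open>vertex x j\<close> to
  this vertex now leads back.\<close>

lemma vertex_eq_reflect:
  assumes x: "fv d V x" and par: "even i \<longleftrightarrow> even j" and eq: "vertex x i = vertex x (Suc j)"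
  shows "vertex x (Suc i) = vertex x j"
proof -
  have "ruling_step d V (if even j then R1 else R2) (vertex x i) (vertex x j)"
    using ruling_step_sym[OF vertex_step[OF x, of j]] eq by simp
  then show ?thesis
    using vertex_step[OF x, of i] par ruling_step_unique[OF R1] swap.ruling_step_unique[OF R2]
    by (cases "even j") auto
qed

text \<open>Equal vertices at odd distance fold the sequence. Moving both ends inwards keeps them
  equal until they are neighbours, and the side between them is tangent.\<close>

lemma vertex_eq_tangent:
  assumes x: "fv d V x"
  shows "vertex x i = vertex x (i + 2 * m + 1) \<Longrightarrow> \<exists>t\<in>{i..i + 2 * m}. vertex x t = vertex x (Suc t)"
proof (induction m arbitrary: i)
  case 0
  then show ?case by auto
next
  case (Suc m)
  have "vertex x (Suc i) = vertex x (i + 2 * Suc m)"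
    using Suc.prems by (intro vertex_eq_reflect[OF x]) auto
  then obtain t where "t \<in> {Suc i..Suc i + 2 * m}" "vertex x t = vertex x (Suc t)"
    using Suc.IH[of "Suc i"] by auto
  then show ?case by (intro bexI[of _ t]) auto
qed

lemma FV_iff: "y \<in> FV d V \<longleftrightarrow> fv d V y"
  using f.d_pos by (auto simp: FV_def fv_def lin_subspaces_def)

text \<open>Distinctness is used twice: the chain never turns back at a side, so its intersections
  follow the two involutions, and the orbit does not close before \<open>n\<close> turns.\<close>

lemma turn_pow_of_chain:
  assumes chain: "closed_chain d V R1 R2 n L" and inj: "inj_on L {1..2 * n}" and n: "n \<ge> 2"
  obtains x where "fv d V x" "(turn ^^ n) x = x" "\<And>m. 1 \<le> m \<Longrightarrow> m < n \<Longrightarrow> (turn ^^ m) x \<noteq> x"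
proof -
  have closed: "L (2 * n + 1) = L 1" and
    mem: "\<And>i. i \<in> {1..n} \<Longrightarrow> L (2 * i - 1) \<in> R1 \<and> L (2 * i) \<in> R2" and
    meet: "\<And>j. j \<in> {1..2 * n} \<Longrightarrow> fv d V (L j \<inter> L (j + 1))"
    using chain unfolding closed_chain_def FV_iff by blast+
  have L_in: "L j \<in> (if odd j then R1 else R2)" if "1 \<le> j" "j \<le> 2 * n + 1" for j
  proof (cases "odd j")
    case True
    then obtain k where k: "j = 2 * k + 1" by (elim oddE)
    show ?thesis
    proof (cases "k < n")
      case True
      then show ?thesis using mem[of "Suc k"] k by simp
    next
      case False
      then have "j = 2 * n + 1" using that k by simp
      then show ?thesis using closed mem[of 1] n by simp
    qed
  next
    case False
    then have "even j" by simp
    then obtain k where "j = 2 * k" by (elim evenE)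
    then show ?thesis using mem[of k] that by simp
  qed
  define x where "x = L (2 * n) \<inter> L 1"
  have x: "fv d V x" using meet[of "2 * n"] closed n by (simp add: x_def)
  \<comment> \<open>The cyclic predecessor: \<open>x\<close> lies between \<open>L (2 * n)\<close>
    and \<open>L 1\<close>.\<close>
  define prev where "prev j = (if j = 1 then 2 * n else j - 1)" for j
  have core: "L j = side x j \<and> L j \<inter> L (j + 1) = vertex x j"
    if j: "1 \<le> j" "j \<le> 2 * n" and prev: "L (prev j) \<inter> L j = vertex x (j - 1)" for j
  proof
    let ?y = "L j \<inter> L (j + 1)"
    have y: "fv d V ?y" using meet[of j] j by simp
    have "L j \<in> (if odd j then R1 else R2)" using L_in j by simp
    then show Lj: "L j = side x j" using side_eqI[OF x j(1)] prev by blast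
    have "?y \<subseteq> L j \<inter> V" using fvD(3)[OF y] by blast
    then have "?y \<subseteq> vertex x (j - 1) \<union> vertex x j" using side(2)[OF x j(1)] Lj by simp
    then have "?y \<subseteq> vertex x (j - 1) \<or> ?y \<subseteq> vertex x j"
      using subspace_subset_Un[OF fvD(1)[OF y] fvD(1)[OF fv_vertex[OF x]] fvD(1)[OF fv_vertex[OF x]]] by blast
    then consider "?y = vertex x (j - 1)" | "?y = vertex x j"
      using fv_eqI[OF y fv_vertex[OF x]] by blast
    then show "?y = vertex x j"
    proof cases
      \<comment> \<open>The chain would turn back here: both neighbours of \<open>L j\<close>
        contain the same vertex and belong to the same ruling, so they coincide, although for
        \<open>n \<ge> 2\<close> their positions differ.\<close>
      case 1
      define next' where "next' = (if j = 2 * n then 1 else j + 1)"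
      have next': "L next' = L (j + 1)" using closed by (simp add: next'_def)
      have rng: "prev j \<in> {1..2 * n}" "next' \<in> {1..2 * n}" "prev j \<noteq> next'" "odd (prev j) \<longleftrightarrow> odd (j + 1)"
        using j n by (auto simp: prev_def next'_def)
      have "L (prev j) \<in> (if odd (j + 1) then R1 else R2)" "L (j + 1) \<in> (if odd (j + 1) then R1 else R2)"
        using L_in[of "prev j"] L_in[of "j + 1"] rng j by auto
      moreover have "vertex x (j - 1) \<subseteq> L (prev j)" "vertex x (j - 1) \<subseteq> L (j + 1)"
        using 1 prev by blast+
      ultimately have "L (prev j) = L (j + 1)"
        using unique_in_rulings[OF _ fv_vertex[OF x]] by metis
      then have "L (prev j) = L next'" using next' by simp
      then show ?thesis using inj_onD[OF inj _ rng(1,2)] rng(3) by blast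
    qed
  qed
  have step: "L j = side x j \<and> L j \<inter> L (j + 1) = vertex x j" if "1 \<le> j" "j \<le> 2 * n" for j
    using that
  proof (induction j rule: nat_induct_at_least)
    case base
    have "L (prev 1) \<inter> L 1 = vertex x (1 - 1)" by (simp add: prev_def x_def)
    then show ?case using n by (intro core) auto
  next
    case (Suc j)
    have "L j \<inter> L (j + 1) = vertex x j" by (rule conjunct2[OF Suc.IH]) (use Suc.prems in simp)
    then have "L (prev (Suc j)) \<inter> L (Suc j) = vertex x (Suc j - 1)" using Suc.hyps by (simp add: prev_def)
    then show ?case using Suc.prems by (intro core) auto
  qed
  have "vertex x (2 * n) = x" using step[of "2 * n"] n closed by (simp add: x_def)
  moreover have "(turn ^^ m) x \<noteq> x" if m: "1 \<le> m" "m < n" for m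
  proof
    assume eq: "(turn ^^ m) x = x"
    have "L (2 * m + 1) = side x (2 * m + 1)" using step[of "2 * m + 1"] m by simp
    then have "x \<subseteq> L (2 * m + 1)" using side(2)[OF x, of "2 * m + 1"] eq vertex_double[of x m] by auto
    moreover have "L (2 * m + 1) \<in> R1" "L 1 \<in> R1" using L_in[of "2 * m + 1"] L_in[of 1] m n by auto
    moreover have "x \<subseteq> L 1" by (auto simp: x_def)
    ultimately have "L (2 * m + 1) = L 1" using unique_in_rulings[OF _ x] by blast
    then show False using inj_onD[OF inj, of "2 * m + 1" 1] m by auto
  qed
  ultimately show thesis using that[OF x] vertex_double[of x n] by auto
qed

text \<open>Periodicity passes from \<open>x0\<close> to \<open>x\<close>. Equal sides have the same
  pair of vertices: in the same order they give a shorter period, which would pass back to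
  \<open>x0\<close>; in opposite order they force a tangent side, the folded case.\<close>

lemma porism_long:
  assumes per: "fv d V x0" "(turn ^^ n) x0 = x0" "\<And>m. 1 \<le> m \<Longrightarrow> m < n \<Longrightarrow> (turn ^^ m) x0 \<noteq> x0"
    and n: "n \<ge> 1" and x: "fv d V x"
  shows "closed_chain d V R1 R2 n (side x)" "passes_through n (side x) x"
    "inj_on (side x) {1..2 * n} \<or> folded d V n (side x)"
proof -
  have "(turn ^^ n) x = x" using turn_pow_fixed[OF per(1,2) x] .
  then have last: "vertex x (2 * n) = x" by (simp add: vertex_double)
  have closed: "side x (2 * n + 1) = side x 1"
    using side(1)[OF x, of "2 * n + 1"] side(2)[OF x, of "2 * n + 1"] last
    by (intro side_eqI[OF x]) auto
  have meet: "side x j \<inter> side x (j + 1) = vertex x j" if "j \<in> {1..2 * n}" for j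
    using side_Int[OF x] that by simp
  show "closed_chain d V R1 R2 n (side x)"
    unfolding closed_chain_def
  proof (intro conjI ballI)
    fix i assume "i \<in> {1..n}"
    then have "odd (2 * i - 1)" "2 * i - 1 \<ge> 1" "2 * i \<ge> 1" by auto
    then show "side x (2 * i - 1) \<in> R1" "side x (2 * i) \<in> R2"
      using side(1)[OF x, of "2 * i - 1"] side(1)[OF x, of "2 * i"] by auto
  next
    fix j assume "j \<in> {1..2 * n}"
    then show "side x j \<inter> side x (j + 1) \<in> FV d V" using meet fv_vertex[OF x] FV_iff by simp
  qed (rule closed)
  show "passes_through n (side x) x"
    unfolding passes_through_def using meet[of "2 * n"] last n by (intro bexI[of _ "2 * n"]) auto
  show "inj_on (side x) {1..2 * n} \<or> folded d V n (side x)"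
  proof (cases "\<exists>j\<in>{1..2 * n}. side x j \<inter> V \<in> FV d V")
    case True
    have "side x 1 \<inter> V = (side x (2 * n) \<inter> side x 1) \<union> (side x 1 \<inter> side x 2)"
      using side(2)[OF x, of 1] meet[of "2 * n"] meet[of 1] closed last n by (simp add: numeral_2_eq_2)
    moreover have "side x j \<inter> V = (side x (j - 1) \<inter> side x j) \<union> (side x j \<inter> side x (j + 1))"
      if "j \<in> {2..2 * n}" for j
    proof -
      have j: "j - 1 \<in> {1..2 * n}" "j - 1 + 1 = j" "j \<in> {1..2 * n}" "1 \<le> j" using that by auto
      show ?thesis using side(2)[OF x j(4)] meet[OF j(1)] meet[OF j(3)] unfolding j(2) by simp
    qed
    ultimately show ?thesis unfolding folded_def using True by blast
  next
    case False
    have no_tangent: "vertex x t \<noteq> vertex x (Suc t)" if "Suc t \<le> 2 * n" for t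
    proof
      assume "vertex x t = vertex x (Suc t)"
      then have "side x (Suc t) \<inter> V \<in> FV d V"
        using side(2)[OF x, of "Suc t"] fv_vertex[OF x] FV_iff by simp
      then show False using False that by auto
    qed
    have no_period: "vertex x e \<noteq> vertex x (e + 2 * m)" if e: "even e" and m: "1 \<le> m" "m < n" for e m
    proof
      assume eq: "vertex x e = vertex x (e + 2 * m)"
      obtain k where k: "e = 2 * k" using e by (elim evenE)
      have "vertex x (e + 2 * m) = (turn ^^ m) ((turn ^^ k) x)"
        using vertex_shift[of x k "2 * m"] k by (simp add: vertex_double)
      then have "(turn ^^ m) ((turn ^^ k) x) = (turn ^^ k) x" using eq k by (simp add: vertex_double)
      then have "(turn ^^ m) x0 = x0" using turn_pow_fixed[OF fv_turn_pow[OF x] _ per(1)] by blast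
      then show False using per(3)[OF m] by blast
    qed
    have "side x i \<noteq> side x j" if ij: "1 \<le> i" "i < j" "j \<le> 2 * n" for i j
    proof
      assume eq: "side x i = side x j"
      have i1: "1 \<le> j" using ij by simp
      have par: "odd i \<longleftrightarrow> odd j"
        using side(1)[OF x ij(1)] side(1)[OF x i1] eq rulings_disjoint by (auto split: if_splits)
      have "even (j - i)" using par ij by (simp add: even_diff_nat)
      then obtain m where m: "j - i = 2 * m" by (elim evenE)
      then have j: "j = i + 2 * m" using ij by simp
      have m': "1 \<le> m" "m < n" using m ij by auto
      have "vertex x (i - 1) \<union> vertex x i = vertex x (j - 1) \<union> vertex x j"
        using side(2)[OF x ij(1)] side(2)[OF x i1] eq by simp
      from fv_Un_eq[OF fv_vertex[OF x] fv_vertex[OF x] fv_vertex[OF x] fv_vertex[OF x] this]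
      show False
      proof
        assume same: "vertex x (i - 1) = vertex x (j - 1) \<and> vertex x i = vertex x j"
        show False
        proof (cases "even i")
          case True
          then show False using no_period[OF True m'] same j by simp
        next
          case False
          then have "even (i - 1)" using ij(1) by simp
          moreover have "i - 1 + 2 * m = j - 1" using j ij(1) by simp
          ultimately show False using no_period[of "i - 1" m] m' same by simp
        qed
      next
        assume flip: "vertex x (i - 1) = vertex x j \<and> vertex x i = vertex x (j - 1)"
        have "j = i - 1 + 2 * m + 1" using j ij(1) by simp
        then obtain t where t: "t \<in> {i - 1..i - 1 + 2 * m}" "vertex x t = vertex x (Suc t)"
          using vertex_eq_tangent[OF x, of "i - 1" m] flip by auto
        have "Suc t \<le> 2 * n" using t(1) j ij unfolding atLeastAtMost_iff by linarith
        then show False using no_tangent t(2) by blast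
      qed
    qed
    then have "inj_on (side x) {1..2 * n}"
      by (intro linorder_inj_onI') auto
    then show ?thesis ..
  qed
qed

text \<open>Both intersections of a chain of two subspaces are the same, so one member of each
  ruling through \<open>x\<close> suffices.\<close>

lemma porism_two:
  assumes x: "fv d V x"
  shows "\<exists>L. closed_chain d V R1 R2 1 L \<and> passes_through 1 L x \<and> inj_on L {1..2 * 1}"
proof -
  obtain L1 where L1: "L1 \<in> R1" "x \<subseteq> L1" using is_ruling_exists[OF R1 x] .
  obtain L2 where L2: "L2 \<in> R2" "x \<subseteq> L2" using swap.is_ruling_exists[OF R2 x] .
  have x12: "L1 \<inter> L2 = x" using Int_of_rulings[OF L1(1) L2(1) x L1(2) L2(2)] .
  define L where "L j = (if odd j then L1 else L2)" for j :: nat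
  have "L1 \<noteq> L2" "L2 \<inter> L1 = x" using rulings_disjoint[OF L1(1) L2(1)] x12 by auto
  moreover have "{1..2} = {1, 2 :: nat}" by auto
  ultimately show ?thesis
    using L1(1) L2(1) x12 x FV_iff
    by (intro exI[of _ L]) (simp add: closed_chain_def passes_through_def L_def)
qed

end

theorem theorem15:
  fixes A B :: "complex ^ 'n ^ 'n" and d n :: nat
    and V :: "(complex ^ 'n) set"
    and R1 R2 :: "(complex ^ 'n) set set"
  assumes dim: "CARD('n) = 2 * d"
    and quadrics: "quadric_matrix A" "quadric_matrix B"
    and V: "V = quadric A \<inter> quadric B"
    and smooth: "smooth_intersection A B"
    and rulings: "ruling d (quadric A) R1" "ruling d (quadric B) R2"
    and n: "n \<ge> 1"
    and chain: "\<exists>L. closed_chain d V R1 R2 n L \<and> inj_on L {1..2 * n}"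
  shows "\<forall>x\<in>FV d V. \<exists>L. closed_chain d V R1 R2 n L \<and> passes_through n L x \<and>
           (inj_on L {1..2 * n} \<or> folded d V n L)"
proof
  have sym: "transpose A = A" "transpose B = B" using quadrics by (auto simp: quadric_matrix_def)
  note bil = sbil_bform[OF sym(1)] sbil_bform[OF sym(2)]
  \<comment> \<open>Pairing with coordinate vectors recovers the entries of the gradient, up to the
    factor 2, and so translates the Jacobian criterion.\<close>
  have comp: "bform M v (axis i 1) = (M *v v) $ i" if "sbil (bform M)" for M :: "complex ^ 'n ^ 'n" and v i
  proof -
    have "bform M v (axis i 1) = bform M (axis i 1) v" using that by (rule sbil_sym)
    also have "\<dots> = (M *v v) $ i" by (simp add: bform_def axis_def if_distrib[of "\<lambda>c. c * _"] cong: if_cong)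
    finally show ?thesis .
  qed
  interpret P: pencil "bform A" "bform B" d
  proof
    fix v s t
    assume v: "v \<noteq> 0" "bform A v v = 0" "bform B v v = 0"
      and 0: "\<And>u. s * bform A v u + t * bform B v u = 0"
    have "s *s (A *v v) + t *s (B *v v) = 0"
      using 0[of "axis i 1" for i] by (simp add: vec_eq_iff comp bil)
    then show "s = 0 \<and> t = 0"
      using smooth v unfolding smooth_intersection_def quadric_def qform_bform by blast
  qed (use bil dim in auto)
  interpret RA: quadric_ruling A d R1 using sym rulings by unfold_locales
  interpret RB: quadric_ruling B d R2 using sym rulings by unfold_locales
  interpret ruled_pencil "bform A" "bform B" d R1 R2
    using RA.ruling_is_ruling RB.ruling_is_ruling by unfold_locales
  have V_eq: "V = base_locus (bform A) (bform B)"
    unfolding V by (auto simp: quadric_def base_locus_def qform_bform)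
  fix x assume "x \<in> FV d V"
  then have x: "fv d V x" using FV_iff unfolding V_eq by blast
  show "\<exists>L. closed_chain d V R1 R2 n L \<and> passes_through n L x \<and> (inj_on L {1..2 * n} \<or> folded d V n L)"
  proof (cases "n = 1")
    case True
    then show ?thesis using porism_two x unfolding V_eq by blast
  next
    case False
    then have n2: "n \<ge> 2" using n by simp
    obtain x0 where "fv d V x0" "(turn ^^ n) x0 = x0" "\<And>m. 1 \<le> m \<Longrightarrow> m < n \<Longrightarrow> (turn ^^ m) x0 \<noteq> x0"
      using chain turn_pow_of_chain[OF _ _ n2] unfolding V_eq by blast
    from porism_long[OF this[unfolded V_eq] n x[unfolded V_eq]] show ?thesis unfolding V_eq by blast
  qed
qed

end
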